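(* Let $k$ be an algebraically closed field of characteristic $0$. Each of the following Lie superalgebras $L=\varinjlim_{i} L_i$ over $k$ (direct limit over integers $i\ge2$ with respect to the natural inclusions $L_i\to L_{i+1}$) is centrally closed: 1. $\mathfrak{sl}(\infty,n)$, with $L_i=\mathfrak{sl}(i,n)$, for $n\ge0$; 2. $\mathfrak{sl}(\infty,\infty)$, with $L_i=\mathfrak{sl}(i,i)$; 3. $\mathrm B(\infty,2s)$, with $L_i=\mathfrak{osp}(2i+1,2s)$, for $s\ge0$; 4. $\mathrm B(\infty,\infty)$, with $L_i=\mathfrak{osp}(2i+1,2i)$; 5. $\mathrm B(2r+1,\infty)$, with $L_i=\mathfrak{osp}(2r+1,2i)$, for $r\ge0$; 6. $\mathrm C(\infty)$, with $L_i=\mathfrak{osp}(2,2i)$; 7. $\mathrm D(\infty,2s)$, with $L_i=\mathfrak{osp}(2i,2s)$, for $s\ge0$; 8. $\mathrm D(\infty,\infty)$, with $L_i=\mathfrak{osp}(2i,2i)$; 9. $\mathrm D(2m,\infty)$, with $L_i=\mathfrak{osp}(2m,2i)$, for $m\ge2$; 10. $\mathrm{SP}(\infty)$, with $L_i=\mathrm{SP}(i)$; 11. $\mathfrak{sq}(\infty)$, with $L_i=\mathfrak{sq}(i)$.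
   Context: For a Lie superalgebra $L$ over $k$, $\mathfrak{uce}(L)=(L\otimes_kL)/\mathcal B_L$, where $\mathcal B_L$ is spanned by $x\otimes y+(-1)^{|x||y|}y\otimes x$; $x_{\bar0}\otimes x_{\bar0}$ for $x_{\bar0}\in L_{\bar0}$; and $(-1)^{|x||z|}x\otimes[y,z]+(-1)^{|y||x|}y\otimes[z,x]+(-1)^{|z||y|}z\otimes[x,y]$ ($x,y,z$ homogeneous, $|\cdot|$ the degree). With $\langle x,y\rangle=x\otimes y+\mathcal B_L$ it is a Lie superalgebra with product $[\langle l_1,l_2\rangle,\langle l_3,l_4\rangle]=\langle[l_1,l_2],[l_3,l_4]\rangle$, and $\mathfrak u_L:\mathfrak{uce}(L)\to L$, $\langle x,y\rangle\mapsto[x,y]$, is a morphism, which is a universal central extension if $L$ is perfect ($L=[L,L]$). A perfect Lie superalgebra $L$ is centrally closed if $\mathfrak u_L$ is an isomorphism. Let $\mathfrak{gl}(m,n)$ be the Lie superalgebra of endomorphisms of a superspace $V=V_{\bar0}\oplus V_{\bar1}$ over $k$ with $\dim V_{\bar0}=m$, $\dim V_{\bar1}=n$, with product $[x,y]=xy-(-1)^{|x||y|}yx$; its elements are block matrices $x=\begin{pmatrix} x_1 & x_2 \\ x_3 & x_4 \end{pmatrix}$ with $x_1$ of size $m\times m$ and $x_4$ of size $n\times n$, where even elements have $x_2=x_3=0$ and odd elements have $x_1=x_4=0$. - $\mathfrak{sl}(m,n)=[\mathfrak{gl}(m,n),\mathfrak{gl}(m,n)]=\{x:\operatorname{tr}(x_1)=\operatorname{tr}(x_4)\}$.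 - $\mathfrak{osp}(m,n)$ ($n$ even) is the usual ortho-symplectic subalgebra of $\mathfrak{sl}(m,n)$, consisting of (the span of) homogeneous $x$ leaving invariant an even nondegenerate supersymmetric bilinear form $b$ on $V$ (symmetric on $V_{\bar0}$, alternating on $V_{\bar1}$, with $V_{\bar0}\perp V_{\bar1}$). Here invariance means $b(xu,v)+(-1)^{|x||u|}b(u,xv)=0$ for homogeneous $u,v\in V$. - $\mathrm{SP}(m)$ is the subalgebra of $\mathfrak{sl}(m,m)$ leaving invariant, in the same sense, an odd nondegenerate super-antisymmetric bilinear form. - $\mathfrak{sq}(m)$ is the subalgebra of $\mathfrak{sl}(m,m)$ of matrices with $x_1=x_4$, $x_2=x_3$ and $\operatorname{tr}(x_2)=0$. The natural inclusions $L_i\to L_{i+1}$ are those induced by embedding the natural module of $L_i$ as a direct summand of that of $L_{i+1}$ (compatibly with the forms in the $\mathfrak{osp}$ and $\mathrm{SP}$ cases, and with the block structure in the $\mathfrak{sq}$ case), extending endomorphisms by zero on the complement. *)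

theory Defs
  imports
    "Jordan_Normal_Form.VS_Connect"
    "HOL-Algebra.QuotRing"
    "HOL-Library.Z2"
    "HOL-Library.Poly_Mapping"
begin

section \<open>Superalgebras\<close>

text \<open>
  The scalars are a type \<open>'k\<close> of class \<^class>\<open>field\<close>, seen as the ring record \<^term>\<open>class_ring\<close>.
  The degrees live in the two-element field \<^typ>\<open>bit\<close>. In a superalgebra the field \<^const>\<open>mult\<close> is the
  (Lie) product \<open>[x, y]\<close>; the field \<^const>\<open>one\<close>, inherited from the library's ring records, has no
  meaning and is set to \<^const>\<open>undefined\<close>.
\<close>

record ('k, 'a) superalgebra = "('k, 'a) module" +
  homog :: "bit \<Rightarrow> 'a set"

definition ksign :: "bit \<Rightarrow> bit \<Rightarrow> 'k :: ring_1" where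
  "ksign p q = (if p = 1 \<and> q = 1 then - 1 else 1)"

abbreviation lspan :: "('k :: field, 'a, 'c) module_scheme \<Rightarrow> 'a set \<Rightarrow> 'a set" where
  "lspan V S \<equiv> LinearCombinations.module.span class_ring V S"

text \<open>The Jacobi identity is in the cyclic form that also appears in \<open>uce_relations\<close> below.
  Since 2 and 3 are invertible, \<open>[x, x] = 0\<close> for even \<open>x\<close> and \<open>[y, [y, y]] = 0\<close> for odd \<open>y\<close>
  follow from the axioms.\<close>

locale lie_superalgebra = vectorspace "class_ring :: 'k ring" L
  for L :: "('k :: field_char_0, 'a) superalgebra" (structure) +
  assumes homog_subspace: "VectorSpace.subspace class_ring (homog L p) L"
    and homog_sum: "carrier L = homog L 0 <+>\<^bsub>L\<^esub> homog L 1"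
    and homog_inter: "homog L 0 \<inter> homog L 1 = {\<zero>\<^bsub>L\<^esub>}"
    and bracket_closed: "\<lbrakk>x \<in> carrier L; y \<in> carrier L\<rbrakk> \<Longrightarrow> x \<otimes>\<^bsub>L\<^esub> y \<in> carrier L"
    and bracket_add_left: "\<lbrakk>x \<in> carrier L; y \<in> carrier L; z \<in> carrier L\<rbrakk>
      \<Longrightarrow> (x \<oplus>\<^bsub>L\<^esub> y) \<otimes>\<^bsub>L\<^esub> z = (x \<otimes>\<^bsub>L\<^esub> z) \<oplus>\<^bsub>L\<^esub> (y \<otimes>\<^bsub>L\<^esub> z)"
    and bracket_add_right: "\<lbrakk>x \<in> carrier L; y \<in> carrier L; z \<in> carrier L\<rbrakk>
      \<Longrightarrow> x \<otimes>\<^bsub>L\<^esub> (y \<oplus>\<^bsub>L\<^esub> z) = (x \<otimes>\<^bsub>L\<^esub> y) \<oplus>\<^bsub>L\<^esub> (x \<otimes>\<^bsub>L\<^esub> z)"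
    and bracket_smult_left: "\<lbrakk>x \<in> carrier L; y \<in> carrier L\<rbrakk>
      \<Longrightarrow> (c \<odot>\<^bsub>L\<^esub> x) \<otimes>\<^bsub>L\<^esub> y = c \<odot>\<^bsub>L\<^esub> (x \<otimes>\<^bsub>L\<^esub> y)"
    and bracket_smult_right: "\<lbrakk>x \<in> carrier L; y \<in> carrier L\<rbrakk>
      \<Longrightarrow> x \<otimes>\<^bsub>L\<^esub> (c \<odot>\<^bsub>L\<^esub> y) = c \<odot>\<^bsub>L\<^esub> (x \<otimes>\<^bsub>L\<^esub> y)"
    and bracket_graded: "\<lbrakk>x \<in> homog L p; y \<in> homog L q\<rbrakk> \<Longrightarrow> x \<otimes>\<^bsub>L\<^esub> y \<in> homog L (p + q)"
    and bracket_antisym: "\<lbrakk>x \<in> homog L p; y \<in> homog L q\<rbrakk>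
      \<Longrightarrow> (x \<otimes>\<^bsub>L\<^esub> y) \<oplus>\<^bsub>L\<^esub> (ksign p q \<odot>\<^bsub>L\<^esub> (y \<otimes>\<^bsub>L\<^esub> x)) = \<zero>\<^bsub>L\<^esub>"
    and bracket_jacobi: "\<lbrakk>x \<in> homog L p; y \<in> homog L q; z \<in> homog L r\<rbrakk>
      \<Longrightarrow> (ksign p r \<odot>\<^bsub>L\<^esub> (x \<otimes>\<^bsub>L\<^esub> (y \<otimes>\<^bsub>L\<^esub> z)))
        \<oplus>\<^bsub>L\<^esub> (ksign q p \<odot>\<^bsub>L\<^esub> (y \<otimes>\<^bsub>L\<^esub> (z \<otimes>\<^bsub>L\<^esub> x)))
        \<oplus>\<^bsub>L\<^esub> (ksign r q \<odot>\<^bsub>L\<^esub> (z \<otimes>\<^bsub>L\<^esub> (x \<otimes>\<^bsub>L\<^esub> y))) = \<zero>\<^bsub>L\<^esub>"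

definition superalgebra_hom ::
  "('k :: field, 'a) superalgebra \<Rightarrow> ('k, 'b) superalgebra \<Rightarrow> ('a \<Rightarrow> 'b) set" where
  "superalgebra_hom A B = {f \<in> LinearCombinations.module_hom class_ring A B.
     (\<forall>x\<in>carrier A. \<forall>y\<in>carrier A. f (x \<otimes>\<^bsub>A\<^esub> y) = f x \<otimes>\<^bsub>B\<^esub> f y) \<and>
     (\<forall>p. \<forall>x\<in>homog A p. f x \<in> homog B p)}"

definition superalgebra_iso ::
  "('k :: field, 'a) superalgebra \<Rightarrow> ('k, 'b) superalgebra \<Rightarrow> ('a \<Rightarrow> 'b) set" where
  "superalgebra_iso A B = {f \<in> superalgebra_hom A B. bij_betw f (carrier A) (carrier B) \<and>
     inv_into (carrier A) f \<in> superalgebra_hom B A}"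

definition subsuperalgebra :: "('k, 'a) superalgebra \<Rightarrow> 'a set \<Rightarrow> ('k, 'a) superalgebra" where
  "subsuperalgebra L S = L\<lparr>carrier := S, homog := (\<lambda>p. homog L p \<inter> S)\<rparr>"


section \<open>Quotients and tensor products of vector spaces\<close>

text \<open>As for the product in the library's \<^const>\<open>FactRing\<close>, the scalar multiple of a coset is the
  union of the cosets of the multiples of all representatives, which are all the same coset.\<close>

definition quot_space :: "('k, 'a, 'c) module_scheme \<Rightarrow> 'a set \<Rightarrow> ('k, 'a set) module" where
  "quot_space V N = \<lparr>carrier = a_rcosets\<^bsub>V\<^esub> N, mult = undefined, one = undefined,
     zero = N, add = set_add V, smult = (\<lambda>c X. \<Union>x\<in>X. N +>\<^bsub>V\<^esub> (c \<odot>\<^bsub>V\<^esub> x))\<rparr>"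

text \<open>The map induced on a quotient by a map that is constant on cosets.\<close>

definition quot_lift :: "('a \<Rightarrow> 'b) \<Rightarrow> 'a set \<Rightarrow> 'b" where
  "quot_lift f X = the_elem (f ` X)"

definition free_space :: "'s set \<Rightarrow> ('k :: field, 's \<Rightarrow>\<^sub>0 'k) module" where
  "free_space S = \<lparr>carrier = {t. Poly_Mapping.keys t \<subseteq> S}, mult = undefined, one = undefined,
     zero = 0, add = (+), smult = (\<lambda>c. Poly_Mapping.map ((*) c))\<rparr>"

definition bilinear_relations ::
  "('k :: field, 'a, 'c) module_scheme \<Rightarrow> ('k, 'b, 'd) module_scheme \<Rightarrow> ('a \<times> 'b \<Rightarrow>\<^sub>0 'k) set" where
  "bilinear_relations V W =
     {Poly_Mapping.single (x \<oplus>\<^bsub>V\<^esub> x', y) 1 - Poly_Mapping.single (x, y) 1 - Poly_Mapping.single (x', y) 1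
       | x x' y. x \<in> carrier V \<and> x' \<in> carrier V \<and> y \<in> carrier W} \<union>
     {Poly_Mapping.single (x, y \<oplus>\<^bsub>W\<^esub> y') 1 - Poly_Mapping.single (x, y) 1 - Poly_Mapping.single (x, y') 1
       | x y y'. x \<in> carrier V \<and> y \<in> carrier W \<and> y' \<in> carrier W} \<union>
     {Poly_Mapping.single (c \<odot>\<^bsub>V\<^esub> x, y) 1 - Poly_Mapping.single (x, y) c
       | c x y. x \<in> carrier V \<and> y \<in> carrier W} \<union>
     {Poly_Mapping.single (x, c \<odot>\<^bsub>W\<^esub> y) 1 - Poly_Mapping.single (x, y) c
       | c x y. x \<in> carrier V \<and> y \<in> carrier W}"

definition tensor_null ::
  "('k :: field, 'a, 'c) module_scheme \<Rightarrow> ('k, 'b, 'd) module_scheme \<Rightarrow> ('a \<times> 'b \<Rightarrow>\<^sub>0 'k) set" where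
  "tensor_null V W = lspan (free_space (carrier V \<times> carrier W)) (bilinear_relations V W)"

definition tensor_space ::
  "('k :: field, 'a, 'c) module_scheme \<Rightarrow> ('k, 'b, 'd) module_scheme \<Rightarrow> ('k, ('a \<times> 'b \<Rightarrow>\<^sub>0 'k) set) module" where
  "tensor_space V W = quot_space (free_space (carrier V \<times> carrier W)) (tensor_null V W)"

definition pure_tensor ::
  "('k :: field, 'a, 'c) module_scheme \<Rightarrow> ('k, 'b, 'd) module_scheme \<Rightarrow> 'a \<Rightarrow> 'b \<Rightarrow> ('a \<times> 'b \<Rightarrow>\<^sub>0 'k) set" where
  "pure_tensor V W x y =
     tensor_null V W +>\<^bsub>free_space (carrier V \<times> carrier W)\<^esub> Poly_Mapping.single (x, y) 1"

text \<open>The linear map \<open>V \<otimes> W \<rightarrow> M\<close> induced by a bilinear map \<open>\<beta>\<close>.\<close>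

definition tensor_lift ::
  "('k :: field, 'm, 'c) module_scheme \<Rightarrow> ('a \<Rightarrow> 'b \<Rightarrow> 'm) \<Rightarrow> ('a \<times> 'b \<Rightarrow>\<^sub>0 'k) set \<Rightarrow> 'm" where
  "tensor_lift M \<beta> = quot_lift
     (\<lambda>t. \<Oplus>\<^bsub>M\<^esub>s\<in>Poly_Mapping.keys t. Poly_Mapping.lookup t s \<odot>\<^bsub>M\<^esub> \<beta> (fst s) (snd s))"


section \<open>The superalgebra \<open>uce\<close>\<close>

definition uce_relations :: "('k :: field, 'a) superalgebra \<Rightarrow> ('a \<times> 'a \<Rightarrow>\<^sub>0 'k) set set" where
  "uce_relations L = (let T = tensor_space L L; t = pure_tensor L L in
     {t x y \<oplus>\<^bsub>T\<^esub> (ksign p q \<odot>\<^bsub>T\<^esub> t y x) | x y p q. x \<in> homog L p \<and> y \<in> homog L q} \<union>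
     {t x x | x. x \<in> homog L 0} \<union>
     {(ksign p r \<odot>\<^bsub>T\<^esub> t x (y \<otimes>\<^bsub>L\<^esub> z)) \<oplus>\<^bsub>T\<^esub> (ksign q p \<odot>\<^bsub>T\<^esub> t y (z \<otimes>\<^bsub>L\<^esub> x))
        \<oplus>\<^bsub>T\<^esub> (ksign r q \<odot>\<^bsub>T\<^esub> t z (x \<otimes>\<^bsub>L\<^esub> y))
       | x y z p q r. x \<in> homog L p \<and> y \<in> homog L q \<and> z \<in> homog L r})"

definition uce_null :: "('k :: field, 'a) superalgebra \<Rightarrow> ('a \<times> 'a \<Rightarrow>\<^sub>0 'k) set set" where
  "uce_null L = lspan (tensor_space L L) (uce_relations L)"

definition uce_space :: "('k :: field, 'a) superalgebra \<Rightarrow> ('k, ('a \<times> 'a \<Rightarrow>\<^sub>0 'k) set set) module" where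
  "uce_space L = quot_space (tensor_space L L) (uce_null L)"

definition uce_pair :: "('k :: field, 'a) superalgebra \<Rightarrow> 'a \<Rightarrow> 'a \<Rightarrow> ('a \<times> 'a \<Rightarrow>\<^sub>0 'k) set set" where
  "uce_pair L x y = uce_null L +>\<^bsub>tensor_space L L\<^esub> pure_tensor L L x y"

definition uce_map :: "('k :: field, 'a) superalgebra \<Rightarrow> ('a \<times> 'a \<Rightarrow>\<^sub>0 'k) set set \<Rightarrow> 'a" where
  "uce_map L = quot_lift (tensor_lift L (mult L))"

text \<open>The bilinear product with \<open>[\<langle>a, b\<rangle>, \<langle>c, d\<rangle>] = \<langle>[a, b], [c, d]\<rangle>\<close> is \<open>[X, Y] = \<langle>u X, u Y\<rangle>\<close>,
  where \<open>u\<close> is the map \<open>\<langle>a, b\<rangle> \<mapsto> [a, b]\<close>. The degree of \<open>\<langle>x, y\<rangle>\<close> is the sum of the degrees of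
  \<open>x\<close> and \<open>y\<close>, as in the tensor product.\<close>

definition uce :: "('k :: field, 'a) superalgebra \<Rightarrow> ('k, ('a \<times> 'a \<Rightarrow>\<^sub>0 'k) set set) superalgebra" where
  "uce L = \<lparr>carrier = carrier (uce_space L),
     mult = (\<lambda>X Y. uce_pair L (uce_map L X) (uce_map L Y)), one = undefined,
     zero = zero (uce_space L), add = add (uce_space L), smult = smult (uce_space L),
     homog = (\<lambda>p. lspan (uce_space L)
       {uce_pair L x y | x y q r. x \<in> homog L q \<and> y \<in> homog L r \<and> q + r = p})\<rparr>"

definition perfect :: "('k :: field, 'a) superalgebra \<Rightarrow> bool" where
  "perfect L \<longleftrightarrow> carrier L = lspan L {x \<otimes>\<^bsub>L\<^esub> y | x y. x \<in> carrier L \<and> y \<in> carrier L}"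

definition centrally_closed :: "('k :: field_char_0, 'a) superalgebra \<Rightarrow> bool" where
  "centrally_closed L \<longleftrightarrow>
     lie_superalgebra L \<and> perfect L \<and> uce_map L \<in> superalgebra_iso (uce L) L"


section \<open>Direct limits\<close>

text \<open>The direct limit of \<open>L s \<rightarrow> L (s + 1) \<rightarrow> L (s + 2) \<rightarrow> \<dots>\<close> with maps \<open>f i : L i \<rightarrow> L (i + 1)\<close>:
  the disjoint union of the \<open>L i\<close> modulo eventual equality. The composite map \<open>L i \<rightarrow> L j\<close> is
  \<^term>\<open>fold f [i..<j]\<close>.\<close>

definition limit_rel ::
  "nat \<Rightarrow> (nat \<Rightarrow> ('k, 'a) superalgebra) \<Rightarrow> (nat \<Rightarrow> 'a \<Rightarrow> 'a) \<Rightarrow> ((nat \<times> 'a) \<times> (nat \<times> 'a)) set" where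
  "limit_rel s L f = {((i, x), (j, y)). s \<le> i \<and> x \<in> carrier (L i) \<and> s \<le> j \<and> y \<in> carrier (L j) \<and>
     (\<exists>l\<ge>max i j. fold f [i..<l] x = fold f [j..<l] y)}"

definition limit_class ::
  "nat \<Rightarrow> (nat \<Rightarrow> ('k, 'a) superalgebra) \<Rightarrow> (nat \<Rightarrow> 'a \<Rightarrow> 'a) \<Rightarrow> nat \<Rightarrow> 'a \<Rightarrow> (nat \<times> 'a) set" where
  "limit_class s L f i x = limit_rel s L f `` {(i, x)}"

definition limit_op ::
  "nat \<Rightarrow> (nat \<Rightarrow> ('k, 'a) superalgebra) \<Rightarrow> (nat \<Rightarrow> 'a \<Rightarrow> 'a) \<Rightarrow> (nat \<Rightarrow> 'a \<Rightarrow> 'a \<Rightarrow> 'a)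
    \<Rightarrow> (nat \<times> 'a) set \<Rightarrow> (nat \<times> 'a) set \<Rightarrow> (nat \<times> 'a) set" where
  "limit_op s L f g X Y = (\<Union>(i, x)\<in>X. \<Union>(j, y)\<in>Y.
     (let l = max i j in limit_class s L f l (g l (fold f [i..<l] x) (fold f [j..<l] y))))"

definition direct_limit ::
  "nat \<Rightarrow> (nat \<Rightarrow> ('k, 'a) superalgebra) \<Rightarrow> (nat \<Rightarrow> 'a \<Rightarrow> 'a) \<Rightarrow> ('k, (nat \<times> 'a) set) superalgebra" where
  "direct_limit s L f =
     \<lparr>carrier = (SIGMA i:{s..}. carrier (L i)) // limit_rel s L f,
      mult = limit_op s L f (\<lambda>l. mult (L l)), one = undefined,
      zero = limit_class s L f s (zero (L s)),
      add = limit_op s L f (\<lambda>l. add (L l)),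
      smult = (\<lambda>c X. \<Union>(i, x)\<in>X. limit_class s L f i (smult (L i) c x)),
      homog = (\<lambda>p. {limit_class s L f i x | i x. s \<le> i \<and> x \<in> homog (L i) p})\<rparr>"


section \<open>The superspace \<open>k\<^sup>m\<^sup>|\<^sup>n\<close> and its endomorphisms\<close>

text \<open>The superspace with even dimension \<open>m\<close> and odd dimension \<open>n\<close> is \<^term>\<open>carrier_vec (m + n)\<close>,
  the first \<open>m\<close> coordinates being the even ones.\<close>

definition coord_degree :: "nat \<Rightarrow> nat \<Rightarrow> bit" where
  "coord_degree m i = (if i < m then 0 else 1)"

definition homog_vec :: "nat \<Rightarrow> nat \<Rightarrow> bit \<Rightarrow> 'k :: field vec set" where
  "homog_vec m n p = {v \<in> carrier_vec (m + n). \<forall>i<m + n. coord_degree m i \<noteq> p \<longrightarrow> v $ i = 0}"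

definition homog_mat :: "nat \<Rightarrow> nat \<Rightarrow> bit \<Rightarrow> 'k :: field mat set" where
  "homog_mat m n p = {x \<in> carrier_mat (m + n) (m + n).
     \<forall>i<m + n. \<forall>j<m + n. coord_degree m i + coord_degree m j \<noteq> p \<longrightarrow> x $$ (i, j) = 0}"

definition mat_component :: "nat \<Rightarrow> bit \<Rightarrow> 'k :: field mat \<Rightarrow> 'k mat" where
  "mat_component m p x = mat (dim_row x) (dim_col x)
     (\<lambda>(i, j). if coord_degree m i + coord_degree m j = p then x $$ (i, j) else 0)"

text \<open>\<open>[x, y] = x y - (-1)\<^sup>|\<^sup>x\<^sup>|\<^sup>|\<^sup>y\<^sup>| y x\<close>, extended bilinearly from homogeneous elements.\<close>

definition supercommutator :: "nat \<Rightarrow> 'k :: field mat \<Rightarrow> 'k mat \<Rightarrow> 'k mat" where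
  "supercommutator m x y =
     (let x0 = mat_component m 0 x; x1 = mat_component m 1 x;
          y0 = mat_component m 0 y; y1 = mat_component m 1 y
      in (x0 * y0 - y0 * x0) + (x0 * y1 - y1 * x0) + (x1 * y0 - y0 * x1) + (x1 * y1 + y1 * x1))"

definition gl :: "nat \<Rightarrow> nat \<Rightarrow> ('k :: field, 'k mat) superalgebra" where
  "gl m n = \<lparr>carrier = carrier_mat (m + n) (m + n), mult = supercommutator m, one = undefined,
     zero = 0\<^sub>m (m + n) (m + n), add = (+), smult = (\<cdot>\<^sub>m), homog = homog_mat m n\<rparr>"

definition trace :: "'k :: field mat \<Rightarrow> 'k" where
  "trace x = (\<Sum>i<dim_row x. x $$ (i, i))"

definition sl :: "nat \<Rightarrow> nat \<Rightarrow> ('k :: field, 'k mat) superalgebra" where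
  "sl m n = subsuperalgebra (gl m n) {x \<in> carrier (gl m n).
     case split_block x m m of (x1, x2, x3, x4) \<Rightarrow> trace x1 = trace x4}"

definition sq :: "nat \<Rightarrow> ('k :: field, 'k mat) superalgebra" where
  "sq m = subsuperalgebra (gl m m) {x \<in> carrier (sl m m).
     case split_block x m m of (x1, x2, x3, x4) \<Rightarrow> x1 = x4 \<and> x2 = x3 \<and> trace x2 = 0}"


section \<open>Invariant bilinear forms\<close>

definition bilinear_form :: "nat \<Rightarrow> ('k :: field vec \<Rightarrow> 'k vec \<Rightarrow> 'k) \<Rightarrow> bool" where
  "bilinear_form d b \<longleftrightarrow>
     (\<forall>u\<in>carrier_vec d. \<forall>v\<in>carrier_vec d. \<forall>w\<in>carrier_vec d.
        b (u + v) w = b u w + b v w \<and> b w (u + v) = b w u + b w v) \<and>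
     (\<forall>c. \<forall>u\<in>carrier_vec d. \<forall>v\<in>carrier_vec d. b (c \<cdot>\<^sub>v u) v = c * b u v \<and> b u (c \<cdot>\<^sub>v v) = c * b u v)"

definition nondegenerate :: "nat \<Rightarrow> ('k :: field vec \<Rightarrow> 'k vec \<Rightarrow> 'k) \<Rightarrow> bool" where
  "nondegenerate d b \<longleftrightarrow>
     (\<forall>u\<in>carrier_vec d. (\<forall>v\<in>carrier_vec d. b u v = 0) \<longrightarrow> u = 0\<^sub>v d) \<and>
     (\<forall>v\<in>carrier_vec d. (\<forall>u\<in>carrier_vec d. b u v = 0) \<longrightarrow> v = 0\<^sub>v d)"

definition form_of_degree :: "nat \<Rightarrow> nat \<Rightarrow> bit \<Rightarrow> ('k :: field vec \<Rightarrow> 'k vec \<Rightarrow> 'k) \<Rightarrow> bool" where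
  "form_of_degree m n d b \<longleftrightarrow>
     (\<forall>p q. \<forall>u\<in>homog_vec m n p. \<forall>v\<in>homog_vec m n q. p + q \<noteq> d \<longrightarrow> b u v = 0)"

definition supersymmetric :: "nat \<Rightarrow> nat \<Rightarrow> ('k :: field vec \<Rightarrow> 'k vec \<Rightarrow> 'k) \<Rightarrow> bool" where
  "supersymmetric m n b \<longleftrightarrow>
     (\<forall>p q. \<forall>u\<in>homog_vec m n p. \<forall>v\<in>homog_vec m n q. b u v = ksign p q * b v u)"

definition super_antisymmetric :: "nat \<Rightarrow> nat \<Rightarrow> ('k :: field vec \<Rightarrow> 'k vec \<Rightarrow> 'k) \<Rightarrow> bool" where
  "super_antisymmetric m n b \<longleftrightarrow>
     (\<forall>p q. \<forall>u\<in>homog_vec m n p. \<forall>v\<in>homog_vec m n q. b u v = - (ksign p q * b v u))"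

text \<open>For a supersymmetric form \<open>b\<close> of degree 0, the restriction to the odd part is antisymmetric,
  which is the same as alternating when 2 is invertible.\<close>

definition osp_form :: "nat \<Rightarrow> nat \<Rightarrow> ('k :: field vec \<Rightarrow> 'k vec \<Rightarrow> 'k) \<Rightarrow> bool" where
  "osp_form m n b \<longleftrightarrow> bilinear_form (m + n) b \<and> nondegenerate (m + n) b \<and>
     form_of_degree m n 0 b \<and> supersymmetric m n b"

definition SP_form :: "nat \<Rightarrow> ('k :: field vec \<Rightarrow> 'k vec \<Rightarrow> 'k) \<Rightarrow> bool" where
  "SP_form m b \<longleftrightarrow> bilinear_form (m + m) b \<and> nondegenerate (m + m) b \<and>
     form_of_degree m m 1 b \<and> super_antisymmetric m m b"

definition leaves_invariant ::
  "nat \<Rightarrow> nat \<Rightarrow> ('k :: field vec \<Rightarrow> 'k vec \<Rightarrow> 'k) \<Rightarrow> bit \<Rightarrow> 'k mat \<Rightarrow> bool" where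
  "leaves_invariant m n b p x \<longleftrightarrow> (\<forall>q r. \<forall>u\<in>homog_vec m n q. \<forall>v\<in>homog_vec m n r.
     b (x *\<^sub>v u) v + ksign p q * b u (x *\<^sub>v v) = 0)"

definition form_superalgebra ::
  "nat \<Rightarrow> nat \<Rightarrow> ('k :: field vec \<Rightarrow> 'k vec \<Rightarrow> 'k) \<Rightarrow> ('k, 'k mat) superalgebra" where
  "form_superalgebra m n b = subsuperalgebra (sl m n)
     (lspan (sl m n) {x. \<exists>p. x \<in> homog (sl m n) p \<and> leaves_invariant m n b p x})"

text \<open>The orthosymplectic and periplectic superalgebras are taken with respect to a given form \<open>b\<close>,
  meant to satisfy \<^term>\<open>osp_form m n b\<close> and \<^term>\<open>SP_form m b\<close>, respectively.\<close>

abbreviation osp :: "nat \<Rightarrow> nat \<Rightarrow> ('k :: field vec \<Rightarrow> 'k vec \<Rightarrow> 'k) \<Rightarrow> ('k, 'k mat) superalgebra" where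
  "osp m n b \<equiv> form_superalgebra m n b"

abbreviation SP :: "nat \<Rightarrow> ('k :: field vec \<Rightarrow> 'k vec \<Rightarrow> 'k) \<Rightarrow> ('k, 'k mat) superalgebra" where
  "SP m b \<equiv> form_superalgebra m m b"


section \<open>Natural inclusions\<close>

text \<open>For \<open>m \<le> m'\<close> and \<open>n \<le> n'\<close> the superspace \<open>k\<^sup>m\<^sup>|\<^sup>n\<close> is embedded into \<open>k\<^sup>m\<^sup>'\<^sup>|\<^sup>n\<^sup>'\<close> on the first
  \<open>m\<close> even and the first \<open>n\<close> odd coordinates; the complement is spanned by the remaining unit
  vectors, and endomorphisms are extended by zero on it.\<close>

definition pad_vec :: "nat \<Rightarrow> 'k :: field vec \<Rightarrow> 'k vec" where
  "pad_vec d v = vec d (\<lambda>i. if i < dim_vec v then v $ i else 0)"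

definition incl_vec :: "nat \<Rightarrow> nat \<Rightarrow> nat \<Rightarrow> nat \<Rightarrow> 'k :: field vec \<Rightarrow> 'k vec" where
  "incl_vec m n m' n' v = pad_vec m' (vec_first v m) @\<^sub>v pad_vec n' (vec_last v n)"

definition incl_compl :: "nat \<Rightarrow> nat \<Rightarrow> nat \<Rightarrow> nat \<Rightarrow> 'k :: field vec set" where
  "incl_compl m n m' n' =
     {w \<in> carrier_vec (m' + n'). (\<forall>i<m. w $ i = 0) \<and> (\<forall>j<n. w $ (m' + j) = 0)}"

definition pad_mat :: "nat \<Rightarrow> nat \<Rightarrow> 'k :: field mat \<Rightarrow> 'k mat" where
  "pad_mat r c x = mat r c (\<lambda>(i, j). if i < dim_row x \<and> j < dim_col x then x $$ (i, j) else 0)"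

definition incl_mat :: "nat \<Rightarrow> nat \<Rightarrow> nat \<Rightarrow> 'k :: field mat \<Rightarrow> 'k mat" where
  "incl_mat m m' n' x = (case split_block x m m of (x1, x2, x3, x4) \<Rightarrow>
     four_block_mat (pad_mat m' m' x1) (pad_mat m' n' x2) (pad_mat n' m' x3) (pad_mat n' n' x4))"

text \<open>The form on the larger space extends the one on the smaller space, and the direct sum
  decomposition of the larger space is orthogonal.\<close>

definition compatible_forms ::
  "nat \<Rightarrow> nat \<Rightarrow> nat \<Rightarrow> nat \<Rightarrow> ('k :: field vec \<Rightarrow> 'k vec \<Rightarrow> 'k) \<Rightarrow> ('k vec \<Rightarrow> 'k vec \<Rightarrow> 'k) \<Rightarrow> bool" where
  "compatible_forms m n m' n' b b' \<longleftrightarrow>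
     (\<forall>u\<in>carrier_vec (m + n). \<forall>v\<in>carrier_vec (m + n).
        b' (incl_vec m n m' n' u) (incl_vec m n m' n' v) = b u v) \<and>
     (\<forall>u\<in>carrier_vec (m + n). \<forall>w\<in>incl_compl m n m' n'.
        b' (incl_vec m n m' n' u) w = 0 \<and> b' w (incl_vec m n m' n' u) = 0)"

definition osp_forms ::
  "(nat \<Rightarrow> nat) \<Rightarrow> (nat \<Rightarrow> nat) \<Rightarrow> (nat \<Rightarrow> 'k :: field vec \<Rightarrow> 'k vec \<Rightarrow> 'k) \<Rightarrow> bool" where
  "osp_forms m n b \<longleftrightarrow> (\<forall>i\<ge>2. osp_form (m i) (n i) (b i) \<and>
     compatible_forms (m i) (n i) (m (Suc i)) (n (Suc i)) (b i) (b (Suc i)))"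

definition SP_forms :: "(nat \<Rightarrow> 'k :: field vec \<Rightarrow> 'k vec \<Rightarrow> 'k) \<Rightarrow> bool" where
  "SP_forms b \<longleftrightarrow> (\<forall>i\<ge>2. SP_form i (b i) \<and> compatible_forms i i (Suc i) (Suc i) (b i) (b (Suc i)))"

text \<open>The direct limit over \<open>i \<ge> 2\<close>, where \<open>L i\<close> consists of endomorphisms of \<open>k\<^sup>m\<^sup>|\<^sup>n\<close> for \<open>m = m i\<close>
  and \<open>n = n i\<close>.\<close>

definition natural_limit ::
  "(nat \<Rightarrow> nat) \<Rightarrow> (nat \<Rightarrow> nat) \<Rightarrow> (nat \<Rightarrow> ('k :: field, 'k mat) superalgebra)
    \<Rightarrow> ('k, (nat \<times> 'k mat) set) superalgebra" where
  "natural_limit m n L = direct_limit 2 L (\<lambda>i. incl_mat (m i) (m (Suc i)) (n (Suc i)))"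

definition sl_limit :: "(nat \<Rightarrow> nat) \<Rightarrow> (nat \<Rightarrow> nat) \<Rightarrow> ('k :: field, (nat \<times> 'k mat) set) superalgebra" where
  "sl_limit m n = natural_limit m n (\<lambda>i. sl (m i) (n i))"

definition osp_limit ::
  "(nat \<Rightarrow> nat) \<Rightarrow> (nat \<Rightarrow> nat) \<Rightarrow> (nat \<Rightarrow> 'k :: field vec \<Rightarrow> 'k vec \<Rightarrow> 'k)
    \<Rightarrow> ('k, (nat \<times> 'k mat) set) superalgebra" where
  "osp_limit m n b = natural_limit m n (\<lambda>i. osp (m i) (n i) (b i))"

definition SP_limit ::
  "(nat \<Rightarrow> 'k :: field vec \<Rightarrow> 'k vec \<Rightarrow> 'k) \<Rightarrow> ('k, (nat \<times> 'k mat) set) superalgebra" where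
  "SP_limit b = natural_limit (\<lambda>i. i) (\<lambda>i. i) (\<lambda>i. SP i (b i))"

definition sq_limit :: "('k :: field, (nat \<times> 'k mat) set) superalgebra" where
  "sq_limit = natural_limit (\<lambda>i. i) (\<lambda>i. i) sq"

end

theory Submission
  imports Defs
begin

text \<open>Let \<open>L\<close> be the limit of superalgebras \<open>L i\<close> in one of the families. Suppose that
  \<open>\<Sum> \<langle>x\<^sub>s, y\<^sub>s\<rangle>\<close> is a nonzero element of the kernel of \<open>uce(L) \<rightarrow> L\<close>. A linear functional that separates it
  from zero is the same as a \<open>k\<close>-valued super 2-cocycle \<open>\<phi>\<close> on \<open>L\<close> with \<open>\<Sum> \<phi>(x\<^sub>s, y\<^sub>s) \<noteq> 0\<close>
  (\<open>cocycle_separation\<close>). So it is enough to show that \<open>\<Sum> [x\<^sub>s, y\<^sub>s] = 0\<close> implies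
  \<open>\<Sum> \<phi>(x\<^sub>s, y\<^sub>s) = 0\<close> for all cocycles, and that \<open>L\<close> is perfect (\<open>centrally_closed_criterion\<close>). The
  finitely many elements \<open>x\<^sub>s, y\<^sub>s\<close> and the relation between them already exist in some \<open>L i\<close>, so it
  suffices that on the image of \<open>L i\<close> in \<open>L (i + 1)\<close> every cocycle of \<open>L (i + 1)\<close> is a coboundary,
  \<open>\<phi>(y, x) = g([y, x])\<close> with \<open>g\<close> linear, and every element is a sum of brackets in \<open>L (i + 1)\<close>
  (\<open>limit_centrally_closed\<close>).

  Both properties come from one coordinate \<open>w\<close> of the natural module of \<open>L (i + 1)\<close> that does not
  belong to the natural module of \<open>L i\<close>. For \<open>sl\<close>, let \<open>p\<close> and \<open>q\<close> run through the coordinates of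
  the smaller module and consider the matrix units \<open>E\<^bsub>p w\<^esub>\<close> and \<open>E\<^bsub>w q\<^esub>\<close>. Under the bracket with
  elements of \<open>L i\<close> they transform like the columns and rows of a matrix, and
  \<open>\<Sum> x\<^bsub>p q\<^esub> [E\<^bsub>p w\<^esub>, E\<^bsub>w q\<^esub>] = x\<close> because \<open>x\<close> has supertrace zero. Hence
  \<open>x \<mapsto> \<Sum> x\<^bsub>p q\<^esub> E\<^bsub>p w\<^esub> \<otimes> E\<^bsub>w q\<^esub>\<close> is an \<open>L i\<close>-equivariant section of the bracket. This exhibits \<open>x\<close> as a
  sum of brackets (\<open>image_in_brackets\<close>). Moreover, by the cocycle identity \<open>\<phi>(y, [c, e])\<close> is obtained
  by letting \<open>y\<close> act on \<open>c \<otimes> e\<close> as a derivation and applying \<open>\<phi>\<close>; by equivariance this action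
  turns the tensor of \<open>x\<close> into the tensor of \<open>[y, x]\<close>, so that
  \<open>g(x) = \<Sum> x\<^bsub>p q\<^esub> \<phi>(E\<^bsub>p w\<^esub>, E\<^bsub>w q\<^esub>)\<close> does what is required (\<open>cocycle_is_coboundary\<close>).

  In the other families the matrix unit \<open>E\<^bsub>i j\<^esub>\<close> is replaced by an element of the subalgebra: by
  \<open>E\<^bsub>i j\<^esub> - \<theta>(E\<^bsub>i j\<^esub>)\<close> with the superadjoint \<open>\<theta>\<close> of the form in the case of \<open>osp\<close> and \<open>SP\<close>
  (\<open>form_section\<close>), and by the sum of \<open>E\<^bsub>i j\<^esub>\<close> and its conjugate under the parity change in the case of
  \<open>sq\<close> (\<open>sq_section\<close>). The correction contributes a second copy of \<open>x\<close>, so the product of the new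
  section is \<open>2 x\<close>, and the argument goes through unchanged (\<open>corrected_units\<close>). For the forms this
  uses that the smaller module and its complement are orthogonal, so that the brackets of a matrix
  unit with a correction vanish.\<close>

section \<open>Vector spaces, quotients and free spaces\<close>

abbreviation vspace :: "('k :: field, 'a, 'c) module_scheme \<Rightarrow> bool" where
  "vspace V \<equiv> vectorspace class_ring V"

abbreviation linear_maps ::
  "('k :: field, 'a, 'c) module_scheme \<Rightarrow> ('k, 'b, 'd) module_scheme \<Rightarrow> ('a \<Rightarrow> 'b) set" where
  "linear_maps V W \<equiv> LinearCombinations.module_hom class_ring V W"

lemma subspace_iff:
  assumes "vspace V"
  shows "VectorSpace.subspace class_ring N V \<longleftrightarrow> N \<subseteq> carrier V \<and> \<zero>\<^bsub>V\<^esub> \<in> N \<and>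
    (\<forall>x\<in>N. \<forall>y\<in>N. x \<oplus>\<^bsub>V\<^esub> y \<in> N) \<and> (\<forall>c. \<forall>x\<in>N. c \<odot>\<^bsub>V\<^esub> x \<in> N)"
  using assms vectorspace.axioms(1)[OF assms]
  unfolding subspace_def submodule_def by auto

lemma vspaceI:
  fixes V :: "('k :: field, 'a, 'c) module_scheme"
  assumes "\<zero>\<^bsub>V\<^esub> \<in> carrier V"
    and "\<And>x y. x \<in> carrier V \<Longrightarrow> y \<in> carrier V \<Longrightarrow> x \<oplus>\<^bsub>V\<^esub> y \<in> carrier V"
    and "\<And>c x. x \<in> carrier V \<Longrightarrow> c \<odot>\<^bsub>V\<^esub> x \<in> carrier V"
    and "\<And>x y. x \<in> carrier V \<Longrightarrow> y \<in> carrier V \<Longrightarrow> x \<oplus>\<^bsub>V\<^esub> y = y \<oplus>\<^bsub>V\<^esub> x"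
    and "\<And>x y z. x \<in> carrier V \<Longrightarrow> y \<in> carrier V \<Longrightarrow> z \<in> carrier V
      \<Longrightarrow> (x \<oplus>\<^bsub>V\<^esub> y) \<oplus>\<^bsub>V\<^esub> z = x \<oplus>\<^bsub>V\<^esub> (y \<oplus>\<^bsub>V\<^esub> z)"
    and "\<And>x. x \<in> carrier V \<Longrightarrow> x \<oplus>\<^bsub>V\<^esub> \<zero>\<^bsub>V\<^esub> = x"
    and "\<And>x. x \<in> carrier V \<Longrightarrow> x \<oplus>\<^bsub>V\<^esub> ((- 1) \<odot>\<^bsub>V\<^esub> x) = \<zero>\<^bsub>V\<^esub>"
    and "\<And>a b x. x \<in> carrier V \<Longrightarrow> (a * b) \<odot>\<^bsub>V\<^esub> x = a \<odot>\<^bsub>V\<^esub> (b \<odot>\<^bsub>V\<^esub> x)"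
    and "\<And>x. x \<in> carrier V \<Longrightarrow> 1 \<odot>\<^bsub>V\<^esub> x = x"
    and "\<And>a b x. x \<in> carrier V \<Longrightarrow> (a + b) \<odot>\<^bsub>V\<^esub> x = (a \<odot>\<^bsub>V\<^esub> x) \<oplus>\<^bsub>V\<^esub> (b \<odot>\<^bsub>V\<^esub> x)"
    and "\<And>a x y. x \<in> carrier V \<Longrightarrow> y \<in> carrier V
      \<Longrightarrow> a \<odot>\<^bsub>V\<^esub> (x \<oplus>\<^bsub>V\<^esub> y) = (a \<odot>\<^bsub>V\<^esub> x) \<oplus>\<^bsub>V\<^esub> (a \<odot>\<^bsub>V\<^esub> y)"
  shows "vspace V"
proof (rule vs_criteria)
  show "\<forall>v\<in>carrier V. \<exists>neg_v\<in>carrier V. v \<oplus>\<^bsub>V\<^esub> neg_v = \<zero>\<^bsub>V\<^esub>"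
    using assms(3,7) by blast
qed (use assms in \<open>auto simp: class_field\<close>)

lemma vspaceD:
  fixes V :: "('k :: field, 'a, 'c) module_scheme"
  assumes "vspace V"
  shows vs_zero: "\<zero>\<^bsub>V\<^esub> \<in> carrier V"
    and vs_add: "\<And>x y. x \<in> carrier V \<Longrightarrow> y \<in> carrier V \<Longrightarrow> x \<oplus>\<^bsub>V\<^esub> y \<in> carrier V"
    and vs_smult: "\<And>c x. x \<in> carrier V \<Longrightarrow> c \<odot>\<^bsub>V\<^esub> x \<in> carrier V"
    and vs_comm: "\<And>x y. x \<in> carrier V \<Longrightarrow> y \<in> carrier V \<Longrightarrow> x \<oplus>\<^bsub>V\<^esub> y = y \<oplus>\<^bsub>V\<^esub> x"
    and vs_assoc: "\<And>x y z. x \<in> carrier V \<Longrightarrow> y \<in> carrier V \<Longrightarrow> z \<in> carrier V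
      \<Longrightarrow> (x \<oplus>\<^bsub>V\<^esub> y) \<oplus>\<^bsub>V\<^esub> z = x \<oplus>\<^bsub>V\<^esub> (y \<oplus>\<^bsub>V\<^esub> z)"
    and vs_r_zero: "\<And>x. x \<in> carrier V \<Longrightarrow> x \<oplus>\<^bsub>V\<^esub> \<zero>\<^bsub>V\<^esub> = x"
    and vs_neg: "\<And>x. x \<in> carrier V \<Longrightarrow> x \<oplus>\<^bsub>V\<^esub> ((- 1) \<odot>\<^bsub>V\<^esub> x) = \<zero>\<^bsub>V\<^esub>"
    and vs_smult_assoc: "\<And>a b x. x \<in> carrier V \<Longrightarrow> (a * b) \<odot>\<^bsub>V\<^esub> x = a \<odot>\<^bsub>V\<^esub> (b \<odot>\<^bsub>V\<^esub> x)"
    and vs_one: "\<And>x. x \<in> carrier V \<Longrightarrow> 1 \<odot>\<^bsub>V\<^esub> x = x"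
    and vs_l_distr: "\<And>a b x. x \<in> carrier V \<Longrightarrow> (a + b) \<odot>\<^bsub>V\<^esub> x = (a \<odot>\<^bsub>V\<^esub> x) \<oplus>\<^bsub>V\<^esub> (b \<odot>\<^bsub>V\<^esub> x)"
    and vs_r_distr: "\<And>a x y. x \<in> carrier V \<Longrightarrow> y \<in> carrier V
      \<Longrightarrow> a \<odot>\<^bsub>V\<^esub> (x \<oplus>\<^bsub>V\<^esub> y) = (a \<odot>\<^bsub>V\<^esub> x) \<oplus>\<^bsub>V\<^esub> (a \<odot>\<^bsub>V\<^esub> y)"
    and vs_zero_smult: "\<And>x. x \<in> carrier V \<Longrightarrow> 0 \<odot>\<^bsub>V\<^esub> x = \<zero>\<^bsub>V\<^esub>"
    and vs_smult_zero: "\<And>c. c \<odot>\<^bsub>V\<^esub> \<zero>\<^bsub>V\<^esub> = \<zero>\<^bsub>V\<^esub>"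
    and vs_minus: "\<And>x y. x \<in> carrier V \<Longrightarrow> y \<in> carrier V \<Longrightarrow> x \<ominus>\<^bsub>V\<^esub> y = x \<oplus>\<^bsub>V\<^esub> ((- 1) \<odot>\<^bsub>V\<^esub> y)"
proof -
  interpret vectorspace "class_ring :: 'k ring" V by fact
  show "\<zero>\<^bsub>V\<^esub> \<in> carrier V" by simp
  show "\<And>x y. x \<in> carrier V \<Longrightarrow> y \<in> carrier V \<Longrightarrow> x \<oplus>\<^bsub>V\<^esub> y \<in> carrier V" by simp
  show "\<And>c x. x \<in> carrier V \<Longrightarrow> c \<odot>\<^bsub>V\<^esub> x \<in> carrier V" using smult_closed by simp
  show "\<And>x y. x \<in> carrier V \<Longrightarrow> y \<in> carrier V \<Longrightarrow> x \<oplus>\<^bsub>V\<^esub> y = y \<oplus>\<^bsub>V\<^esub> x" by (simp add: M.a_comm)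
  show "\<And>x y z. x \<in> carrier V \<Longrightarrow> y \<in> carrier V \<Longrightarrow> z \<in> carrier V
      \<Longrightarrow> (x \<oplus>\<^bsub>V\<^esub> y) \<oplus>\<^bsub>V\<^esub> z = x \<oplus>\<^bsub>V\<^esub> (y \<oplus>\<^bsub>V\<^esub> z)" by (simp add: M.a_assoc)
  show "\<And>x. x \<in> carrier V \<Longrightarrow> x \<oplus>\<^bsub>V\<^esub> \<zero>\<^bsub>V\<^esub> = x" by simp
  show 0: "\<And>x. x \<in> carrier V \<Longrightarrow> 0 \<odot>\<^bsub>V\<^esub> x = \<zero>\<^bsub>V\<^esub>" using lmult_0 by simp
  show "\<And>c. c \<odot>\<^bsub>V\<^esub> \<zero>\<^bsub>V\<^esub> = \<zero>\<^bsub>V\<^esub>" using rmult_0 by simp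
  show "\<And>a b x. x \<in> carrier V \<Longrightarrow> (a * b) \<odot>\<^bsub>V\<^esub> x = a \<odot>\<^bsub>V\<^esub> (b \<odot>\<^bsub>V\<^esub> x)" using smult_assoc1 by simp
  show 1: "\<And>x. x \<in> carrier V \<Longrightarrow> 1 \<odot>\<^bsub>V\<^esub> x = x" using smult_one by simp
  show d: "\<And>a b x. x \<in> carrier V \<Longrightarrow> (a + b) \<odot>\<^bsub>V\<^esub> x = (a \<odot>\<^bsub>V\<^esub> x) \<oplus>\<^bsub>V\<^esub> (b \<odot>\<^bsub>V\<^esub> x)"
    using smult_l_distr by simp
  show "\<And>a x y. x \<in> carrier V \<Longrightarrow> y \<in> carrier V
      \<Longrightarrow> a \<odot>\<^bsub>V\<^esub> (x \<oplus>\<^bsub>V\<^esub> y) = (a \<odot>\<^bsub>V\<^esub> x) \<oplus>\<^bsub>V\<^esub> (a \<odot>\<^bsub>V\<^esub> y)" using smult_r_distr by simp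
  show n: "\<And>x. x \<in> carrier V \<Longrightarrow> x \<oplus>\<^bsub>V\<^esub> ((- 1) \<odot>\<^bsub>V\<^esub> x) = \<zero>\<^bsub>V\<^esub>"
    using d[of _ 1 "-1"] 0 1 by simp
  show "\<And>x y. x \<in> carrier V \<Longrightarrow> y \<in> carrier V \<Longrightarrow> x \<ominus>\<^bsub>V\<^esub> y = x \<oplus>\<^bsub>V\<^esub> ((- 1) \<odot>\<^bsub>V\<^esub> y)"
    using smult_minus_1[symmetric] by (simp add: a_minus_def class_ring_simps)
qed

lemma linear_mapsD:
  assumes "f \<in> linear_maps V W"
  shows lin_closed: "x \<in> carrier V \<Longrightarrow> f x \<in> carrier W"
    and lin_add: "x \<in> carrier V \<Longrightarrow> y \<in> carrier V \<Longrightarrow> f (x \<oplus>\<^bsub>V\<^esub> y) = f x \<oplus>\<^bsub>W\<^esub> f y"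
    and lin_smult: "x \<in> carrier V \<Longrightarrow> f (c \<odot>\<^bsub>V\<^esub> x) = c \<odot>\<^bsub>W\<^esub> f x"
  using assms unfolding LinearCombinations.module_hom_def by auto

lemma linear_mapsI:
  assumes "\<And>x. x \<in> carrier V \<Longrightarrow> f x \<in> carrier W"
    and "\<And>x y. x \<in> carrier V \<Longrightarrow> y \<in> carrier V \<Longrightarrow> f (x \<oplus>\<^bsub>V\<^esub> y) = f x \<oplus>\<^bsub>W\<^esub> f y"
    and "\<And>c x. x \<in> carrier V \<Longrightarrow> f (c \<odot>\<^bsub>V\<^esub> x) = c \<odot>\<^bsub>W\<^esub> f x"
  shows "f \<in> linear_maps V W"
  using assms unfolding LinearCombinations.module_hom_def by auto

lemma lin_zero:
  assumes "vspace V" "vspace W" "f \<in> linear_maps V W"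
  shows "f \<zero>\<^bsub>V\<^esub> = \<zero>\<^bsub>W\<^esub>"
proof -
  have "f \<zero>\<^bsub>V\<^esub> = f (0 \<odot>\<^bsub>V\<^esub> \<zero>\<^bsub>V\<^esub>)"
    using assms(1) by (simp add: vs_smult_zero)
  also have "\<dots> = 0 \<odot>\<^bsub>W\<^esub> f \<zero>\<^bsub>V\<^esub>"
    by (rule lin_smult[OF assms(3) vs_zero[OF assms(1)]])
  also have "\<dots> = \<zero>\<^bsub>W\<^esub>"
    by (rule vs_zero_smult[OF assms(2) lin_closed[OF assms(3) vs_zero[OF assms(1)]]])
  finally show ?thesis .
qed

lemma lin_minus:
  assumes "vspace V" "vspace W" "f \<in> linear_maps V W" "x \<in> carrier V" "y \<in> carrier V"
  shows "f (x \<ominus>\<^bsub>V\<^esub> y) = f x \<ominus>\<^bsub>W\<^esub> f y"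
  using assms by (simp add: vs_minus lin_closed[OF assms(3)] lin_add[OF assms(3)] lin_smult[OF assms(3)] vs_smult)

lemma vs_minus_eq_zero:
  fixes V :: "('k :: field, 'a, 'c) module_scheme"
  assumes "vspace V" "x \<in> carrier V" "y \<in> carrier V"
  shows "x \<ominus>\<^bsub>V\<^esub> y = \<zero>\<^bsub>V\<^esub> \<longleftrightarrow> x = y"
proof -
  interpret vectorspace "class_ring :: 'k ring" V by fact
  show ?thesis using assms by simp
qed

lemma lin_kernel_subspace:
  assumes "vspace V" "vspace W" "f \<in> linear_maps V W"
  shows "VectorSpace.subspace class_ring {x \<in> carrier V. f x = \<zero>\<^bsub>W\<^esub>} V"
  unfolding subspace_iff[OF assms(1)] using assms
  by (auto simp: lin_zero[OF assms] lin_add[OF assms(3)] lin_smult[OF assms(3)] vs_zero vs_add vs_smult vs_smult_zero vs_r_zero)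

lemma lspan_subspace:
  assumes "vspace V" "S \<subseteq> carrier V"
  shows "VectorSpace.subspace class_ring (lspan V S) V"
  using vectorspace.span_is_subspace[OF assms] .

lemma lspan_carrier: "vspace V \<Longrightarrow> S \<subseteq> carrier V \<Longrightarrow> lspan V S \<subseteq> carrier V"
  using lspan_subspace[of V S] subspace_iff[of V "lspan V S"] by simp

lemma lspan_superset:
  assumes "vspace V" "S \<subseteq> carrier V"
  shows "S \<subseteq> lspan V S"
  using module.in_own_span[OF vectorspace.axioms(1)[OF assms(1)] assms(2)] .

lemma lspan_minimal:
  assumes "vspace V" "VectorSpace.subspace class_ring N V" "S \<subseteq> N"
  shows "lspan V S \<subseteq> N"
  using module.span_is_subset[OF vectorspace.axioms(1)[OF assms(1)] assms(3)] assms(2)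
  unfolding subspace_def by blast

text \<open>A space that arises from a vector space by transporting all operations along a surjection
  inherits the axioms. Quotient spaces are instances.\<close>

lemma vspace_image:
  fixes V :: "('k :: field, 'a, 'c) module_scheme" and W :: "('k, 'b, 'd) module_scheme"
  assumes V: "vspace V" and c: "carrier W = \<pi> ` carrier V" and z: "\<zero>\<^bsub>W\<^esub> = \<pi> \<zero>\<^bsub>V\<^esub>"
    and a: "\<And>x y. x \<in> carrier V \<Longrightarrow> y \<in> carrier V \<Longrightarrow> \<pi> x \<oplus>\<^bsub>W\<^esub> \<pi> y = \<pi> (x \<oplus>\<^bsub>V\<^esub> y)"
    and s: "\<And>r x. x \<in> carrier V \<Longrightarrow> r \<odot>\<^bsub>W\<^esub> \<pi> x = \<pi> (r \<odot>\<^bsub>V\<^esub> x)"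
  shows "vspace W"
proof (rule vspaceI, goal_cases)
  case (4 x y)
  then show ?case using V by (auto simp: c a) (metis vs_comm)
next
  case (5 x y w)
  then show ?case using V by (auto simp: c a vs_add vs_assoc)
next
  case (6 x)
  then show ?case using V by (auto simp: c a z vs_zero vs_r_zero)
next
  case (7 x)
  then show ?case using V by (auto simp: c a s z vs_smult vs_neg)
qed (use V in \<open>auto simp: c z a s vs_zero vs_add vs_smult vs_smult_assoc vs_one vs_l_distr vs_r_distr\<close>)

subsection \<open>Quotient spaces\<close>

context
  fixes V :: "('k :: field, 'a, 'c) module_scheme" and N :: "'a set"
  assumes V: "vspace V" and N: "VectorSpace.subspace class_ring N V"
begin

private lemma ab: "abelian_subgroup N V"
proof -
  interpret V: vectorspace "class_ring :: 'k ring" V by (fact V)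
  have *: "N \<subseteq> carrier V" "\<zero>\<^bsub>V\<^esub> \<in> N" "\<And>x y. x \<in> N \<Longrightarrow> y \<in> N \<Longrightarrow> x \<oplus>\<^bsub>V\<^esub> y \<in> N"
    "\<And>c x. x \<in> N \<Longrightarrow> c \<odot>\<^bsub>V\<^esub> x \<in> N" using N subspace_iff[OF V] by auto
  have "additive_subgroup N V"
  proof (rule additive_subgroupI, rule V.M.add.subgroupI)
    fix a assume a: "a \<in> N"
    have "\<ominus>\<^bsub>V\<^esub> a = (- 1) \<odot>\<^bsub>V\<^esub> a"
      using V.smult_minus_1[of a] a *(1) by (auto simp: class_ring_simps)
    then show "\<ominus>\<^bsub>V\<^esub> a \<in> N" using *(4)[OF a, of "-1"] by simp
  qed (use * in auto)
  then show ?thesis by (rule abelian_subgroupI3) (rule V.M.abelian_group_axioms)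
qed

lemma quot_eq_iff:
  assumes "x \<in> carrier V" "y \<in> carrier V"
  shows "N +>\<^bsub>V\<^esub> x = N +>\<^bsub>V\<^esub> y \<longleftrightarrow> x \<ominus>\<^bsub>V\<^esub> y \<in> N"
proof -
  interpret A: abelian_subgroup N V by (fact ab)
  interpret V: vectorspace "class_ring :: 'k ring" V by (fact V)
  have "x \<in> N +>\<^bsub>V\<^esub> y \<longleftrightarrow> x \<ominus>\<^bsub>V\<^esub> y \<in> N" using A.a_rcos_module[of y x] assms by (simp add: a_minus_def)
  then show ?thesis using A.a_repr_independence' A.a_rcos_self assms by metis
qed

lemma mem_coset_iff:
  "x \<in> carrier V \<Longrightarrow> y \<in> N +>\<^bsub>V\<^esub> x \<longleftrightarrow> y \<in> carrier V \<and> N +>\<^bsub>V\<^esub> y = N +>\<^bsub>V\<^esub> x"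
proof -
  interpret A: abelian_subgroup N V by (fact ab)
  assume x: "x \<in> carrier V"
  show ?thesis using A.a_repr_independence' A.a_rcos_self x A.a_elemrcos_carrier by metis
qed

lemma quot_carrier: "carrier (quot_space V N) = (\<lambda>x. N +>\<^bsub>V\<^esub> x) ` carrier V"
  by (auto simp: quot_space_def A_RCOSETS_def')

lemma quot_zero: "\<zero>\<^bsub>quot_space V N\<^esub> = N +>\<^bsub>V\<^esub> \<zero>\<^bsub>V\<^esub>"
proof -
  interpret V: vectorspace "class_ring :: 'k ring" V by (fact V)
  show ?thesis using N by (simp add: quot_space_def subspace_iff[OF V])
qed

lemma quot_add:
  assumes "x \<in> carrier V" "y \<in> carrier V"
  shows "(N +>\<^bsub>V\<^esub> x) \<oplus>\<^bsub>quot_space V N\<^esub> (N +>\<^bsub>V\<^esub> y) = N +>\<^bsub>V\<^esub> (x \<oplus>\<^bsub>V\<^esub> y)"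
  using abelian_subgroup.a_rcos_sum[OF ab assms] by (simp add: quot_space_def)

lemma quot_smult:
  assumes x: "x \<in> carrier V"
  shows "c \<odot>\<^bsub>quot_space V N\<^esub> (N +>\<^bsub>V\<^esub> x) = N +>\<^bsub>V\<^esub> (c \<odot>\<^bsub>V\<^esub> x)"
proof -
  have "N +>\<^bsub>V\<^esub> (c \<odot>\<^bsub>V\<^esub> y) = N +>\<^bsub>V\<^esub> (c \<odot>\<^bsub>V\<^esub> x)" if "y \<in> N +>\<^bsub>V\<^esub> x" for y
  proof -
    have y: "y \<in> carrier V" "y \<ominus>\<^bsub>V\<^esub> x \<in> N" using that mem_coset_iff x quot_eq_iff by auto
    have "c \<odot>\<^bsub>V\<^esub> y \<ominus>\<^bsub>V\<^esub> c \<odot>\<^bsub>V\<^esub> x = c \<odot>\<^bsub>V\<^esub> (y \<ominus>\<^bsub>V\<^esub> x)"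
      using V x y by (simp add: vs_minus vs_smult vs_r_distr vs_smult_assoc[symmetric] mult.commute)
    then show ?thesis using y N x V by (simp add: quot_eq_iff vs_smult subspace_iff[OF V])
  qed
  moreover have "x \<in> N +>\<^bsub>V\<^esub> x" using mem_coset_iff x by auto
  ultimately have "(\<Union>y\<in>N +>\<^bsub>V\<^esub> x. N +>\<^bsub>V\<^esub> (c \<odot>\<^bsub>V\<^esub> y)) = N +>\<^bsub>V\<^esub> (c \<odot>\<^bsub>V\<^esub> x)"
    by (metis (no_types, lifting) SUP_cong SUP_const empty_iff)
  then show ?thesis unfolding quot_space_def by simp
qed

lemma quot_vspace: "vspace (quot_space V N)"
  by (rule vspace_image[OF V quot_carrier quot_zero]) (simp_all add: quot_add quot_smult)

lemma quot_proj_linear: "(\<lambda>x. N +>\<^bsub>V\<^esub> x) \<in> linear_maps V (quot_space V N)"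
  by (rule linear_mapsI) (auto simp: quot_add quot_smult quot_carrier)

lemma quot_proj_eq_zero:
  assumes "x \<in> carrier V"
  shows "N +>\<^bsub>V\<^esub> x = \<zero>\<^bsub>quot_space V N\<^esub> \<longleftrightarrow> x \<in> N"
  using assms V by (simp add: quot_zero quot_eq_iff vs_zero vs_minus vs_smult_zero vs_r_zero)

lemma quot_lift_coset:
  assumes W: "vspace W" and f: "f \<in> linear_maps V W" and k: "\<And>x. x \<in> N \<Longrightarrow> f x = \<zero>\<^bsub>W\<^esub>"
    and x: "x \<in> carrier V"
  shows "quot_lift f (N +>\<^bsub>V\<^esub> x) = f x"
proof -
  have "f y = f x" if "y \<in> N +>\<^bsub>V\<^esub> x" for y
  proof -
    have y: "y \<in> carrier V" "y \<ominus>\<^bsub>V\<^esub> x \<in> N" using that mem_coset_iff x quot_eq_iff by auto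
    then have "f y \<ominus>\<^bsub>W\<^esub> f x = \<zero>\<^bsub>W\<^esub>" using k[of "y \<ominus>\<^bsub>V\<^esub> x"] lin_minus[OF V W f y(1) x] by simp
    then show ?thesis using vs_minus_eq_zero W f y(1) x lin_closed by metis
  qed
  moreover have "x \<in> N +>\<^bsub>V\<^esub> x" using mem_coset_iff x by auto
  ultimately have "f ` (N +>\<^bsub>V\<^esub> x) = {f x}" by (metis image_constant_conv image_cong empty_iff)
  then show ?thesis by (simp add: quot_lift_def)
qed

lemma quot_lift_linear:
  assumes W: "vspace W" and f: "f \<in> linear_maps V W" and k: "\<And>x. x \<in> N \<Longrightarrow> f x = \<zero>\<^bsub>W\<^esub>"
  shows "quot_lift f \<in> linear_maps (quot_space V N) W"
  by (rule linear_mapsI)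
    (use V f in \<open>auto simp: quot_carrier quot_add quot_smult quot_lift_coset[OF assms] vs_add vs_smult
      lin_closed[OF f] lin_add[OF f] lin_smult[OF f]\<close>)

end

subsection \<open>Free spaces\<close>

lemma lookup_map_scale [simp]: "Poly_Mapping.lookup (Poly_Mapping.map ((*) c) t) s = c * Poly_Mapping.lookup t s"
  for c :: "'k :: field"
  by transfer (auto simp: when_def)

lemma map_scale_single [simp]:
  "Poly_Mapping.map ((*) c) (Poly_Mapping.single s a) = Poly_Mapping.single s (c * a)"
  for c :: "'k :: field"
  by (rule poly_mapping_eqI) (simp add: lookup_single when_def)

lemma free_space_simps [simp]:
  "carrier (free_space S) = {t. Poly_Mapping.keys t \<subseteq> S}"
  "zero (free_space S) = 0"
  "add (free_space S) = (+)"
  "smult (free_space S) = (\<lambda>c. Poly_Mapping.map ((*) c))"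
  by (simp_all add: free_space_def)

lemma keys_map_scale: "Poly_Mapping.keys (Poly_Mapping.map ((*) c) t) \<subseteq> Poly_Mapping.keys t"
  for c :: "'k :: field"
  by (auto simp: in_keys_iff)

lemma free_vspace: "vspace (free_space S :: ('k :: field, _) module)"
proof (rule vspaceI, goal_cases)
  case (2 x y)
  then show ?case using Poly_Mapping.keys_add[of x y] by auto
next
  case (3 c x)
  then show ?case using keys_map_scale[of c x] by auto
qed (auto intro!: poly_mapping_eqI simp: lookup_add algebra_simps)

lemma vector_space_free: "vector_space (\<lambda>c. Poly_Mapping.map ((*) (c :: 'k :: field)))"
  by unfold_locales (auto intro!: poly_mapping_eqI simp: lookup_add algebra_simps)

text \<open>A basis of \<open>N\<close> together with \<open>t\<close> extends to a basis of the whole space, on which \<open>g\<close> may be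
  prescribed. The expansion of \<open>g\<close> over the generators is recorded because a bilinear form on a
  Lie superalgebra is determined by its values on pairs.\<close>

lemma free_space_separation:
  fixes t :: "'s \<Rightarrow>\<^sub>0 'k :: field"
  assumes N: "VectorSpace.subspace class_ring N (free_space S)" and t: "t \<notin> N"
  obtains g :: "('s \<Rightarrow>\<^sub>0 'k) \<Rightarrow> 'k"
  where "\<And>u v. g (u + v) = g u + g v" and "\<And>u v. g (u - v) = g u - g v"
    and "\<And>c u. g (Poly_Mapping.map ((*) c) u) = c * g u"
    and "\<And>u. g u = (\<Sum>s\<in>Poly_Mapping.keys u. Poly_Mapping.lookup u s * g (Poly_Mapping.single s 1))"
    and "\<And>u. u \<in> N \<Longrightarrow> g u = 0" and "g t \<noteq> 0"
proof -
  let ?sc = "\<lambda>c :: 'k. Poly_Mapping.map ((*) c) :: ('s \<Rightarrow>\<^sub>0 'k) \<Rightarrow> _"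
  interpret F: vector_space ?sc by (rule vector_space_free)
  interpret K: vector_space "(*) :: 'k \<Rightarrow> 'k \<Rightarrow> 'k" by unfold_locales (auto simp: algebra_simps)
  interpret P: vector_space_pair ?sc "(*) :: 'k \<Rightarrow> 'k \<Rightarrow> 'k" ..
  have sub: "F.subspace N"
    using N unfolding subspace_iff[OF free_vspace] F.subspace_def by auto
  obtain B where B: "B \<subseteq> N" "F.independent B" "F.span B = N"
    using F.basis_exists[of N] F.span_subspace[OF _ _ sub] by metis
  have ind: "F.independent (insert t B)"
    using B t by (simp add: F.independent_insert)
  obtain g where g: "Vector_Spaces.linear ?sc (*) g" "\<forall>x\<in>insert t B. g x = (if x = t then 1 else 0)"
    using P.linear_independent_extend[OF ind, of "\<lambda>x. if x = t then 1 else 0"] by blast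
  interpret G: Vector_Spaces.linear ?sc "(*)" g by (fact g(1))
  have gB: "g x = 0" if "x \<in> B" for x
  proof -
    have "x \<noteq> t" using that B(1) t by blast
    then show ?thesis using g(2) that by simp
  qed
  have gN: "g u = 0" if "u \<in> N" for u
    using G.eq_0_on_span[of B u] gB that B(3) by blast
  have ge: "g u = (\<Sum>s\<in>Poly_Mapping.keys u. Poly_Mapping.lookup u s * g (Poly_Mapping.single s 1))" for u
  proof -
    have "u = (\<Sum>s\<in>Poly_Mapping.keys u. ?sc (Poly_Mapping.lookup u s) (Poly_Mapping.single s 1))"
      by (rule poly_mapping_eqI) (simp add: lookup_sum lookup_single when_def in_keys_iff)
    then have "g u = g (\<Sum>s\<in>Poly_Mapping.keys u. ?sc (Poly_Mapping.lookup u s) (Poly_Mapping.single s 1))"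
      by (rule arg_cong)
    also have "\<dots> = (\<Sum>s\<in>Poly_Mapping.keys u. Poly_Mapping.lookup u s * g (Poly_Mapping.single s 1))"
      by (simp only: G.sum G.scale)
    finally show ?thesis .
  qed
  show thesis
    by (rule that[OF G.add G.diff G.scale ge gN]) (use g(2) in auto)
qed

section \<open>Cocycles and the kernel of the universal central extension\<close>

text \<open>The linear extension of \<open>h\<close> from the generators to the free space.\<close>

definition free_eval :: "('k :: field, 'm, 'c) module_scheme \<Rightarrow> ('s \<Rightarrow> 'm) \<Rightarrow> ('s \<Rightarrow>\<^sub>0 'k) \<Rightarrow> 'm" where
  "free_eval M h t = (\<Oplus>\<^bsub>M\<^esub>s\<in>Poly_Mapping.keys t. Poly_Mapping.lookup t s \<odot>\<^bsub>M\<^esub> h s)"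

context
  fixes M :: "('k :: field, 'm, 'c) module_scheme" and h :: "'s \<Rightarrow> 'm" and S :: "'s set"
  assumes M: "vspace M" and h: "h \<in> S \<rightarrow> carrier M"
begin

interpretation M: vectorspace "class_ring :: 'k ring" M by (fact M)

private lemma h_closed: "s \<in> S \<Longrightarrow> c \<odot>\<^bsub>M\<^esub> h s \<in> carrier M"
  using h vs_smult[OF M] by auto

private lemma free_eval_superset:
  assumes "finite A" "Poly_Mapping.keys t \<subseteq> A" "A \<subseteq> S"
  shows "free_eval M h t = (\<Oplus>\<^bsub>M\<^esub>s\<in>A. Poly_Mapping.lookup t s \<odot>\<^bsub>M\<^esub> h s)"
  unfolding free_eval_def
proof (rule M.add.finprod_mono_neutral_cong_left)
  fix s assume "s \<in> A - Poly_Mapping.keys t"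
  then show "Poly_Mapping.lookup t s \<odot>\<^bsub>M\<^esub> h s = \<zero>\<^bsub>M\<^esub>"
    using assms h vs_zero_smult[OF M, of "h s"] by (auto simp: in_keys_iff)
qed (use assms h_closed in auto)

lemma free_eval_single: "s \<in> S \<Longrightarrow> free_eval M h (Poly_Mapping.single s c) = c \<odot>\<^bsub>M\<^esub> h s"
  using free_eval_superset[of "{s}" "Poly_Mapping.single s c"] h_closed[of s c] by simp

lemma free_eval_linear: "free_eval M h \<in> linear_maps (free_space S) M"
proof (rule linear_mapsI)
  fix t :: "'s \<Rightarrow>\<^sub>0 'k" assume t: "t \<in> carrier (free_space S)"
  show "free_eval M h t \<in> carrier M"
    unfolding free_eval_def using t h_closed by (auto intro!: M.M.finsum_closed)
  fix c
  have "free_eval M h (c \<odot>\<^bsub>free_space S\<^esub> t)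
    = (\<Oplus>\<^bsub>M\<^esub>s\<in>Poly_Mapping.keys t. c \<odot>\<^bsub>M\<^esub> (Poly_Mapping.lookup t s \<odot>\<^bsub>M\<^esub> h s))"
    using t h h_closed keys_map_scale[of c t] vs_smult_assoc[OF M]
    by (subst free_eval_superset[of "Poly_Mapping.keys t"]) (auto intro!: M.M.finsum_cong' vs_smult[OF M] vs_smult_assoc[OF M])
  also have "\<dots> = c \<odot>\<^bsub>M\<^esub> free_eval M h t"
    unfolding free_eval_def using t h_closed by (subst M.finsum_smult) auto
  finally show "free_eval M h (c \<odot>\<^bsub>free_space S\<^esub> t) = c \<odot>\<^bsub>M\<^esub> free_eval M h t" .
next
  fix t u :: "'s \<Rightarrow>\<^sub>0 'k" assume t: "t \<in> carrier (free_space S)" and u: "u \<in> carrier (free_space S)"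
  define A where "A = Poly_Mapping.keys t \<union> Poly_Mapping.keys u"
  have A: "finite A" "A \<subseteq> S" using t u by (auto simp: A_def)
  have "free_eval M h (t \<oplus>\<^bsub>free_space S\<^esub> u)
    = (\<Oplus>\<^bsub>M\<^esub>s\<in>A. (Poly_Mapping.lookup t s \<odot>\<^bsub>M\<^esub> h s) \<oplus>\<^bsub>M\<^esub> (Poly_Mapping.lookup u s \<odot>\<^bsub>M\<^esub> h s))"
    using A h h_closed Poly_Mapping.keys_add[of t u]
    by (subst free_eval_superset[of A]) (auto simp: A_def lookup_add intro!: M.M.finsum_cong' vs_add[OF M] vs_l_distr[OF M])
  also have "\<dots> = free_eval M h t \<oplus>\<^bsub>M\<^esub> free_eval M h u"
    using A h_closed by (subst M.M.finsum_addf) (auto simp: A_def free_eval_superset[of A])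
  finally show "free_eval M h (t \<oplus>\<^bsub>free_space S\<^esub> u) = free_eval M h t \<oplus>\<^bsub>M\<^esub> free_eval M h u" .
qed

end

lemma ksign_simps [simp]:
  "ksign 0 p = 1" "ksign p 0 = 1" "ksign 1 1 = - 1"
  by (simp_all add: ksign_def)

text \<open>The bilinear forms on \<open>L\<close> that factor through \<open>uce(L)\<close>.\<close>

definition super_cocycle :: "('k :: field, 'a) superalgebra \<Rightarrow> ('a \<Rightarrow> 'a \<Rightarrow> 'k) \<Rightarrow> bool" where
  "super_cocycle L \<phi> \<longleftrightarrow>
    (\<forall>x\<in>carrier L. \<forall>y\<in>carrier L. \<forall>z\<in>carrier L.
      \<phi> (x \<oplus>\<^bsub>L\<^esub> y) z = \<phi> x z + \<phi> y z \<and> \<phi> z (x \<oplus>\<^bsub>L\<^esub> y) = \<phi> z x + \<phi> z y) \<and>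
    (\<forall>c. \<forall>x\<in>carrier L. \<forall>y\<in>carrier L. \<phi> (c \<odot>\<^bsub>L\<^esub> x) y = c * \<phi> x y \<and> \<phi> x (c \<odot>\<^bsub>L\<^esub> y) = c * \<phi> x y) \<and>
    (\<forall>p q. \<forall>x\<in>homog L p. \<forall>y\<in>homog L q. \<phi> x y + ksign p q * \<phi> y x = 0) \<and>
    (\<forall>p q r. \<forall>x\<in>homog L p. \<forall>y\<in>homog L q. \<forall>z\<in>homog L r.
      ksign p r * \<phi> x (y \<otimes>\<^bsub>L\<^esub> z) + ksign q p * \<phi> y (z \<otimes>\<^bsub>L\<^esub> x) + ksign r q * \<phi> z (x \<otimes>\<^bsub>L\<^esub> y) = 0)"

context lie_superalgebra
begin

lemma L_vspace: "vspace L"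
  by unfold_locales

lemma homog_carrier: "x \<in> homog L p \<Longrightarrow> x \<in> carrier L"
  using homog_subspace[of p] by (auto simp: subspace_iff[OF L_vspace])

lemma homog_closed:
  "\<zero>\<^bsub>L\<^esub> \<in> homog L p"
  "x \<in> homog L p \<Longrightarrow> y \<in> homog L p \<Longrightarrow> x \<oplus>\<^bsub>L\<^esub> y \<in> homog L p"
  "x \<in> homog L p \<Longrightarrow> c \<odot>\<^bsub>L\<^esub> x \<in> homog L p"
  using homog_subspace[of p] by (auto simp: subspace_iff[OF L_vspace])

lemma homog_decomp:
  assumes "x \<in> carrier L"
  obtains x0 x1 where "x0 \<in> homog L 0" "x1 \<in> homog L 1" "x = x0 \<oplus>\<^bsub>L\<^esub> x1"
proof -
  have "x \<in> homog L 0 <+>\<^bsub>L\<^esub> homog L 1" using assms unfolding homog_sum .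
  then show thesis using that unfolding set_add_def' by blast
qed

abbreviation "pairs \<equiv> free_space (carrier L \<times> carrier L) :: ('k, _) module"
abbreviation "bracket_sum \<equiv> free_eval L (\<lambda>s. fst s \<otimes>\<^bsub>L\<^esub> snd s)"
abbreviation "T \<equiv> tensor_space L L"
abbreviation "pt \<equiv> pure_tensor L L"
abbreviation sing :: "'a \<Rightarrow> 'a \<Rightarrow> 'a \<times> 'a \<Rightarrow>\<^sub>0 'k" where "sing x y \<equiv> Poly_Mapping.single (x, y) 1"

lemma bracket_sum_linear: "bracket_sum \<in> linear_maps pairs L"
  by (rule free_eval_linear[OF L_vspace]) (auto intro: bracket_closed)

lemma bracket_sum_single:
  "x \<in> carrier L \<Longrightarrow> y \<in> carrier L \<Longrightarrow> bracket_sum (Poly_Mapping.single (x, y) c) = c \<odot>\<^bsub>L\<^esub> (x \<otimes>\<^bsub>L\<^esub> y)"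
  by (subst free_eval_single[OF L_vspace, of _ "carrier L \<times> carrier L"]) (auto intro: bracket_closed)

lemma single_pairs: "x \<in> carrier L \<Longrightarrow> y \<in> carrier L \<Longrightarrow> Poly_Mapping.single (x, y) c \<in> carrier pairs"
  by auto

lemma diff_scale: "u - v = u + Poly_Mapping.map ((*) (- 1)) v" for u v :: "'s \<Rightarrow>\<^sub>0 'k"
  by (rule poly_mapping_eqI) (simp add: lookup_minus lookup_add)

lemma pairs_diff:
  assumes "u \<in> carrier pairs" "v \<in> carrier pairs"
  shows "u - v \<in> carrier pairs"
    and "f \<in> linear_maps pairs W \<Longrightarrow> f (u - v) = f u \<oplus>\<^bsub>W\<^esub> ((- 1) \<odot>\<^bsub>W\<^esub> f v)"
proof -
  have "Poly_Mapping.map ((*) (- 1)) v \<in> carrier pairs"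
    using vs_smult[OF free_vspace assms(2), of "-1"] by simp
  with assms(1) show "u - v \<in> carrier pairs"
    unfolding diff_scale using vs_add[OF free_vspace assms(1)] by simp
  show "f (u - v) = f u \<oplus>\<^bsub>W\<^esub> ((- 1) \<odot>\<^bsub>W\<^esub> f v)" if f: "f \<in> linear_maps pairs W"
    unfolding diff_scale
    using lin_add[OF f assms(1) vs_smult[OF free_vspace assms(2), of "-1"]] lin_smult[OF f assms(2), of "-1"]
    by simp
qed

lemma bilinear_relations_pairs: "bilinear_relations L L \<subseteq> carrier pairs"
  unfolding bilinear_relations_def
  by (intro Un_least) (auto simp del: free_space_simps intro!: pairs_diff(1) single_pairs
      intro: vs_add[OF L_vspace] vs_smult[OF L_vspace])

lemma tensor_null_subspace: "VectorSpace.subspace class_ring (tensor_null L L) pairs"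
  unfolding tensor_null_def by (rule lspan_subspace[OF free_vspace bilinear_relations_pairs])

lemma T_vspace: "vspace T"
  unfolding tensor_space_def by (rule quot_vspace[OF free_vspace tensor_null_subspace])

abbreviation "projT \<equiv> \<lambda>t. tensor_null L L +>\<^bsub>pairs\<^esub> t"

lemma projT_linear: "projT \<in> linear_maps pairs T"
  unfolding tensor_space_def by (rule quot_proj_linear[OF free_vspace tensor_null_subspace])

lemma T_carrier: "carrier T = projT ` carrier pairs"
  unfolding tensor_space_def by (rule quot_carrier[OF free_vspace tensor_null_subspace])

lemma pt_closed: "x \<in> carrier L \<Longrightarrow> y \<in> carrier L \<Longrightarrow> pt x y \<in> carrier T"
  unfolding pure_tensor_def T_carrier using single_pairs by blast

text \<open>The product is bilinear, so its linear extension to the free space descends to \<open>L \<otimes> L\<close>.\<close>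

lemma bracket_sum_tensor_null: "t \<in> tensor_null L L \<Longrightarrow> bracket_sum t = \<zero>\<^bsub>L\<^esub>"
proof -
  let ?K = "{t \<in> carrier pairs. bracket_sum t = \<zero>\<^bsub>L\<^esub>}"
  have neg: "z \<oplus>\<^bsub>L\<^esub> ((- 1) \<odot>\<^bsub>L\<^esub> z) = \<zero>\<^bsub>L\<^esub>" if "z \<in> carrier L" for z
    using vs_neg[OF L_vspace that] .
  note [simp] = pairs_diff(2)[OF _ _ bracket_sum_linear] bracket_sum_single vs_one[OF L_vspace]
    vs_add[OF L_vspace] vs_smult[OF L_vspace] bracket_closed vs_smult_assoc[OF L_vspace, symmetric]
    vs_r_distr[OF L_vspace]
  have 1: "bracket_sum (sing (x \<oplus>\<^bsub>L\<^esub> x') y - sing x y - sing x' y) = \<zero>\<^bsub>L\<^esub>"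
    if "x \<in> carrier L" "x' \<in> carrier L" "y \<in> carrier L" for x x' y
  proof -
    have "bracket_sum (sing (x \<oplus>\<^bsub>L\<^esub> x') y - sing x y - sing x' y)
      = ((x \<otimes>\<^bsub>L\<^esub> y) \<oplus>\<^bsub>L\<^esub> (x' \<otimes>\<^bsub>L\<^esub> y)) \<oplus>\<^bsub>L\<^esub> ((- 1) \<odot>\<^bsub>L\<^esub> (x \<otimes>\<^bsub>L\<^esub> y)) \<oplus>\<^bsub>L\<^esub> ((- 1) \<odot>\<^bsub>L\<^esub> (x' \<otimes>\<^bsub>L\<^esub> y))"
      using that by (simp del: free_space_simps add: pairs_diff(1) single_pairs bracket_add_left)
    also have "\<dots> = ((x \<otimes>\<^bsub>L\<^esub> y) \<oplus>\<^bsub>L\<^esub> (x' \<otimes>\<^bsub>L\<^esub> y)) \<oplus>\<^bsub>L\<^esub> ((- 1) \<odot>\<^bsub>L\<^esub> ((x \<otimes>\<^bsub>L\<^esub> y) \<oplus>\<^bsub>L\<^esub> (x' \<otimes>\<^bsub>L\<^esub> y)))"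
      using that by (simp add: M.a_assoc)
    also have "\<dots> = \<zero>\<^bsub>L\<^esub>" by (rule neg) (use that in simp)
    finally show ?thesis .
  qed
  have 2: "bracket_sum (sing x (y \<oplus>\<^bsub>L\<^esub> y') - sing x y - sing x y') = \<zero>\<^bsub>L\<^esub>"
    if "x \<in> carrier L" "y \<in> carrier L" "y' \<in> carrier L" for x y y'
  proof -
    have "bracket_sum (sing x (y \<oplus>\<^bsub>L\<^esub> y') - sing x y - sing x y')
      = ((x \<otimes>\<^bsub>L\<^esub> y) \<oplus>\<^bsub>L\<^esub> (x \<otimes>\<^bsub>L\<^esub> y')) \<oplus>\<^bsub>L\<^esub> ((- 1) \<odot>\<^bsub>L\<^esub> (x \<otimes>\<^bsub>L\<^esub> y)) \<oplus>\<^bsub>L\<^esub> ((- 1) \<odot>\<^bsub>L\<^esub> (x \<otimes>\<^bsub>L\<^esub> y'))"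
      using that by (simp del: free_space_simps add: pairs_diff(1) single_pairs bracket_add_right)
    also have "\<dots> = ((x \<otimes>\<^bsub>L\<^esub> y) \<oplus>\<^bsub>L\<^esub> (x \<otimes>\<^bsub>L\<^esub> y')) \<oplus>\<^bsub>L\<^esub> ((- 1) \<odot>\<^bsub>L\<^esub> ((x \<otimes>\<^bsub>L\<^esub> y) \<oplus>\<^bsub>L\<^esub> (x \<otimes>\<^bsub>L\<^esub> y')))"
      using that by (simp add: M.a_assoc)
    also have "\<dots> = \<zero>\<^bsub>L\<^esub>" by (rule neg) (use that in simp)
    finally show ?thesis .
  qed
  have 3: "bracket_sum (sing (c \<odot>\<^bsub>L\<^esub> x) y - Poly_Mapping.single (x, y) c) = \<zero>\<^bsub>L\<^esub>"
    "bracket_sum (sing x (c \<odot>\<^bsub>L\<^esub> y) - Poly_Mapping.single (x, y) c) = \<zero>\<^bsub>L\<^esub>"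
    if "x \<in> carrier L" "y \<in> carrier L" for c x y
    using that neg[of "c \<odot>\<^bsub>L\<^esub> (x \<otimes>\<^bsub>L\<^esub> y)"]
    by (simp_all del: free_space_simps add: single_pairs bracket_smult_left bracket_smult_right)
  have "bilinear_relations L L \<subseteq> ?K"
  proof
    fix t assume t: "t \<in> bilinear_relations L L"
    then have "t \<in> carrier pairs" using bilinear_relations_pairs by blast
    with t show "t \<in> ?K" unfolding bilinear_relations_def using 1 2 3 by (auto simp del: free_space_simps)
  qed
  then have "tensor_null L L \<subseteq> ?K" unfolding tensor_null_def
    by (rule lspan_minimal[OF free_vspace lin_kernel_subspace[OF free_vspace L_vspace bracket_sum_linear]])
  then show "t \<in> tensor_null L L \<Longrightarrow> bracket_sum t = \<zero>\<^bsub>L\<^esub>" by blast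
qed

lemma tensor_lift_eq: "tensor_lift L (mult L) = quot_lift bracket_sum"
  unfolding tensor_lift_def free_eval_def ..

lemma tensor_lift_linear: "tensor_lift L (mult L) \<in> linear_maps T L"
  unfolding tensor_lift_eq tensor_space_def
  by (rule quot_lift_linear[OF free_vspace tensor_null_subspace L_vspace bracket_sum_linear
        bracket_sum_tensor_null])

lemma tensor_lift_proj: "t \<in> carrier pairs \<Longrightarrow> tensor_lift L (mult L) (projT t) = bracket_sum t"
  unfolding tensor_lift_eq
  by (rule quot_lift_coset[OF free_vspace tensor_null_subspace L_vspace bracket_sum_linear
        bracket_sum_tensor_null])

lemma tensor_lift_pt:
  "x \<in> carrier L \<Longrightarrow> y \<in> carrier L \<Longrightarrow> tensor_lift L (mult L) (pt x y) = x \<otimes>\<^bsub>L\<^esub> y"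
  unfolding pure_tensor_def
  by (simp del: free_space_simps add: tensor_lift_proj single_pairs bracket_sum_single
      vs_one[OF L_vspace] bracket_closed)

end

lemma inv_into_linear:
  assumes V: "vspace V" and f: "f \<in> linear_maps V W" and b: "bij_betw f (carrier V) (carrier W)"
  shows "inv_into (carrier V) f \<in> linear_maps W V"
proof (rule linear_mapsI)
  let ?g = "inv_into (carrier V) f"
  have g: "?g y \<in> carrier V" "f (?g y) = y" if "y \<in> carrier W" for y
    using b that bij_betw_inv_into_right[OF b that] by (auto simp: bij_betw_def inv_into_into)
  have gf: "?g (f x) = x" if "x \<in> carrier V" for x
    using bij_betw_inv_into_left[OF b that] .
  show "?g y \<in> carrier V" if "y \<in> carrier W" for y using g that by simp
  show "?g (x \<oplus>\<^bsub>W\<^esub> y) = ?g x \<oplus>\<^bsub>V\<^esub> ?g y" if "x \<in> carrier W" "y \<in> carrier W" for x y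
    using lin_add[OF f g(1)[OF that(1)] g(1)[OF that(2)]] gf[OF vs_add[OF V g(1)[OF that(1)] g(1)[OF that(2)]]]
    by (simp add: g that)
  show "?g (c \<odot>\<^bsub>W\<^esub> x) = c \<odot>\<^bsub>V\<^esub> ?g x" if "x \<in> carrier W" for c x
    using lin_smult[OF f g(1)[OF that], of c] gf[OF vs_smult[OF V g(1)[OF that], of c]]
    by (simp add: g that)
qed

lemma linear_inj_onI:
  assumes "vspace V" "vspace W" "f \<in> linear_maps V W"
    and k: "\<And>x. x \<in> carrier V \<Longrightarrow> f x = \<zero>\<^bsub>W\<^esub> \<Longrightarrow> x = \<zero>\<^bsub>V\<^esub>"
  shows "inj_on f (carrier V)"
proof (rule inj_onI)
  fix x y assume x: "x \<in> carrier V" and y: "y \<in> carrier V" and eq: "f x = f y"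
  have "f (x \<ominus>\<^bsub>V\<^esub> y) = \<zero>\<^bsub>W\<^esub>"
    using lin_minus[OF assms(1-3) x y] eq vs_minus_eq_zero[OF assms(2), of "f x" "f y"]
      lin_closed[OF assms(3)] x y by simp
  moreover have "x \<ominus>\<^bsub>V\<^esub> y \<in> carrier V"
    using x y assms(1) by (simp add: vs_minus vs_add vs_smult)
  ultimately show "x = y" using k vs_minus_eq_zero[OF assms(1) x y] by simp
qed

lemma lin_preimage_subspace:
  assumes "vspace V" "vspace W" "f \<in> linear_maps V W" "VectorSpace.subspace class_ring N W"
  shows "VectorSpace.subspace class_ring {x \<in> carrier V. f x \<in> N} V"
  using assms(4) unfolding subspace_iff[OF assms(1)] subspace_iff[OF assms(2)]
  by (auto simp: lin_zero[OF assms(1-3)] lin_add[OF assms(3)] lin_smult[OF assms(3)]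
      vs_zero[OF assms(1)] vs_add[OF assms(1)] vs_smult[OF assms(1)])

context lie_superalgebra
begin

lemma bracket_even_self:
  assumes x: "x \<in> homog L 0"
  shows "x \<otimes>\<^bsub>L\<^esub> x = \<zero>\<^bsub>L\<^esub>"
proof -
  let ?z = "x \<otimes>\<^bsub>L\<^esub> x"
  have z: "?z \<in> carrier L" using homog_carrier[OF x] bracket_closed by simp
  have "(2 :: 'k) \<odot>\<^bsub>L\<^esub> ?z = \<zero>\<^bsub>L\<^esub>"
    using bracket_antisym[OF x x] vs_l_distr[OF L_vspace z, of 1 1] vs_one[OF L_vspace z] by simp
  then have "(1 / 2 :: 'k) \<odot>\<^bsub>L\<^esub> ((2 :: 'k) \<odot>\<^bsub>L\<^esub> ?z) = \<zero>\<^bsub>L\<^esub>" using vs_smult_zero[OF L_vspace] by simp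
  then show ?thesis using vs_smult_assoc[OF L_vspace z, of "1/2" 2] vs_one[OF L_vspace z] by simp
qed

lemma uce_relations_T: "uce_relations L \<subseteq> carrier T"
  unfolding uce_relations_def Let_def
  by (auto intro!: vs_add[OF T_vspace] vs_smult[OF T_vspace] pt_closed bracket_closed dest: homog_carrier)

lemma uce_null_subspace: "VectorSpace.subspace class_ring (uce_null L) T"
  unfolding uce_null_def by (rule lspan_subspace[OF T_vspace uce_relations_T])

text \<open>Antisymmetry and the Jacobi identity make the map \<open>L \<otimes> L \<rightarrow> L\<close> descend further to \<open>uce(L)\<close>.\<close>

lemma tensor_lift_uce_null: "X \<in> uce_null L \<Longrightarrow> tensor_lift L (mult L) X = \<zero>\<^bsub>L\<^esub>"
proof -
  let ?l = "tensor_lift L (mult L)"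
  let ?K = "{X \<in> carrier T. ?l X = \<zero>\<^bsub>L\<^esub>}"
  note l = tensor_lift_linear
  note [simp] = lin_add[OF l] lin_smult[OF l] tensor_lift_pt pt_closed vs_add[OF T_vspace]
    vs_smult[OF T_vspace] homog_carrier bracket_closed
  have "?l X = \<zero>\<^bsub>L\<^esub>" if "X \<in> uce_relations L" for X
    using that bracket_antisym bracket_jacobi bracket_even_self
    unfolding uce_relations_def Let_def by auto
  then have "uce_relations L \<subseteq> ?K" using uce_relations_T by blast
  then have "uce_null L \<subseteq> ?K" unfolding uce_null_def
    by (rule lspan_minimal[OF T_vspace lin_kernel_subspace[OF T_vspace L_vspace l]])
  then show "X \<in> uce_null L \<Longrightarrow> ?l X = \<zero>\<^bsub>L\<^esub>" by blast
qed

abbreviation "U \<equiv> uce_space L"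
abbreviation "u \<equiv> uce_map L"
abbreviation "proj \<equiv> \<lambda>t. uce_null L +>\<^bsub>T\<^esub> (projT t)"

lemma U_vspace: "vspace U"
  unfolding uce_space_def by (rule quot_vspace[OF T_vspace uce_null_subspace])

lemma U_carrier: "carrier U = proj ` carrier pairs"
  unfolding uce_space_def quot_carrier[OF T_vspace uce_null_subspace] T_carrier by (simp add: image_image)

lemma projT_closed: "t \<in> carrier pairs \<Longrightarrow> projT t \<in> carrier T"
  unfolding T_carrier by (rule imageI)

lemma proj_linear: "proj \<in> linear_maps pairs U"
proof (rule linear_mapsI)
  note l = quot_proj_linear[OF T_vspace uce_null_subspace, folded uce_space_def]
  fix x assume x: "x \<in> carrier pairs"
  show "proj x \<in> carrier U" unfolding U_carrier using x by (rule imageI)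
  show "proj (c \<odot>\<^bsub>pairs\<^esub> x) = c \<odot>\<^bsub>U\<^esub> proj x" for c
    unfolding lin_smult[OF projT_linear x] lin_smult[OF l projT_closed[OF x]] ..
  fix y assume y: "y \<in> carrier pairs"
  show "proj (x \<oplus>\<^bsub>pairs\<^esub> y) = proj x \<oplus>\<^bsub>U\<^esub> proj y"
    unfolding lin_add[OF projT_linear x y] lin_add[OF l projT_closed[OF x] projT_closed[OF y]] ..
qed

lemma uce_pair_proj: "uce_pair L x y = proj (sing x y)"
  unfolding uce_pair_def pure_tensor_def ..

lemma uce_map_linear: "u \<in> linear_maps U L"
  unfolding uce_map_def uce_space_def
  by (rule quot_lift_linear[OF T_vspace uce_null_subspace L_vspace tensor_lift_linear tensor_lift_uce_null])

lemma uce_map_proj: "t \<in> carrier pairs \<Longrightarrow> u (proj t) = bracket_sum t"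
  unfolding uce_map_def
  using quot_lift_coset[OF T_vspace uce_null_subspace L_vspace tensor_lift_linear tensor_lift_uce_null
      projT_closed] tensor_lift_proj by simp

lemma uce_pair_closed: "x \<in> carrier L \<Longrightarrow> y \<in> carrier L \<Longrightarrow> uce_pair L x y \<in> carrier U"
  unfolding uce_pair_proj U_carrier by (rule imageI, rule single_pairs)

lemma uce_map_pair: "x \<in> carrier L \<Longrightarrow> y \<in> carrier L \<Longrightarrow> u (uce_pair L x y) = x \<otimes>\<^bsub>L\<^esub> y"
  unfolding uce_pair_proj using uce_map_proj[OF single_pairs[of x y 1]]
  by (simp add: bracket_sum_single vs_one[OF L_vspace] bracket_closed)

lemma proj_eq_zero: "t \<in> carrier pairs \<Longrightarrow> proj t = \<zero>\<^bsub>U\<^esub> \<longleftrightarrow> projT t \<in> uce_null L"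
  unfolding uce_space_def by (rule quot_proj_eq_zero[OF T_vspace uce_null_subspace projT_closed])

lemma proj_bilinear: "t \<in> bilinear_relations L L \<Longrightarrow> proj t = \<zero>\<^bsub>U\<^esub>"
proof -
  assume t: "t \<in> bilinear_relations L L"
  then have t': "t \<in> carrier pairs" using bilinear_relations_pairs by blast
  have "t \<in> tensor_null L L"
    using lspan_superset[OF free_vspace bilinear_relations_pairs] t unfolding tensor_null_def by blast
  then have "projT t = \<zero>\<^bsub>T\<^esub>" unfolding tensor_space_def
    using quot_proj_eq_zero[OF free_vspace tensor_null_subspace t'] by simp
  moreover have "\<zero>\<^bsub>T\<^esub> \<in> uce_null L" using uce_null_subspace by (simp add: subspace_iff[OF T_vspace])
  ultimately show ?thesis using proj_eq_zero[OF t'] by simp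
qed

lemma proj_uce_relation: "t \<in> carrier pairs \<Longrightarrow> projT t \<in> uce_relations L \<Longrightarrow> proj t = \<zero>\<^bsub>U\<^esub>"
  using lspan_superset[OF T_vspace uce_relations_T] proj_eq_zero unfolding uce_null_def by blast

text \<open>A functional on the free space over \<open>L \<times> L\<close> that vanishes on all relations defining
  \<open>uce(L)\<close> is a super 2-cocycle with values in \<open>k\<close>; so cocycles detect the nonzero elements of
  \<open>uce(L)\<close>.\<close>

lemma cocycle_separation:
  assumes t: "t \<in> carrier pairs" and nz: "proj t \<noteq> \<zero>\<^bsub>U\<^esub>"
  obtains \<phi> where "super_cocycle L \<phi>"
    and "(\<Sum>s\<in>Poly_Mapping.keys t. Poly_Mapping.lookup t s * \<phi> (fst s) (snd s)) \<noteq> 0"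
proof -
  let ?N = "{t \<in> carrier pairs. proj t = \<zero>\<^bsub>U\<^esub>}"
  have sub: "VectorSpace.subspace class_ring ?N pairs"
    by (rule lin_kernel_subspace[OF free_vspace U_vspace proj_linear])
  have tN: "t \<notin> ?N" using nz by simp
  obtain g where g: "\<And>u v. g (u + v) = g u + g v" "\<And>u v. g (u - v) = g u - g v"
    "\<And>c u. g (Poly_Mapping.map ((*) c) u) = c * g u"
    "\<And>u. g u = (\<Sum>s\<in>Poly_Mapping.keys u. Poly_Mapping.lookup u s * g (Poly_Mapping.single s 1))"
    "\<And>u. u \<in> ?N \<Longrightarrow> g u = 0" "g t \<noteq> 0"
    by (rule free_space_separation[OF sub tN]) (rule that)
  define \<phi> where "\<phi> x y = g (sing x y)" for x y
  have gs: "g (Poly_Mapping.single (x, y) c) = c * \<phi> x y" for x y c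
    using g(3)[of c "sing x y"] unfolding \<phi>_def by simp
  have gb: "g v = 0" if "v \<in> bilinear_relations L L" for v
    using that g(5)[of v] proj_bilinear bilinear_relations_pairs by blast
  have gu: "g v = 0" if "v \<in> carrier pairs" "projT v \<in> uce_relations L" for v
    using that g(5)[of v] proj_uce_relation by blast
  have pT: "projT (v + w) = projT v \<oplus>\<^bsub>T\<^esub> projT w" if "v \<in> carrier pairs" "w \<in> carrier pairs" for v w
    using lin_add[OF projT_linear that] by simp
  have pS: "projT (Poly_Mapping.single (x, y) c) = c \<odot>\<^bsub>T\<^esub> pt x y"
    if "x \<in> carrier L" "y \<in> carrier L" for x y c
    using lin_smult[OF projT_linear single_pairs[OF that, of 1], of c] unfolding pure_tensor_def by simp
  have sum: "v + w \<in> carrier pairs" if "v \<in> carrier pairs" "w \<in> carrier pairs" for v w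
    using vs_add[OF free_vspace that] by simp
  have coc: "super_cocycle L \<phi>"
    unfolding super_cocycle_def
  proof (intro conjI ballI allI)
    fix x y z assume c: "x \<in> carrier L" "y \<in> carrier L" "z \<in> carrier L"
    have "g (sing (x \<oplus>\<^bsub>L\<^esub> y) z - sing x z - sing y z) = 0"
      by (rule gb) (use c in \<open>unfold bilinear_relations_def, blast\<close>)
    then show "\<phi> (x \<oplus>\<^bsub>L\<^esub> y) z = \<phi> x z + \<phi> y z" by (simp add: g(1,2) gs algebra_simps)
    have "g (sing z (x \<oplus>\<^bsub>L\<^esub> y) - sing z x - sing z y) = 0"
      by (rule gb) (use c in \<open>unfold bilinear_relations_def, blast\<close>)
    then show "\<phi> z (x \<oplus>\<^bsub>L\<^esub> y) = \<phi> z x + \<phi> z y" by (simp add: g(1,2) gs algebra_simps)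
  next
    fix c x y assume c: "x \<in> carrier L" "y \<in> carrier L"
    have "g (sing (c \<odot>\<^bsub>L\<^esub> x) y - Poly_Mapping.single (x, y) c) = 0"
      by (rule gb) (use c in \<open>unfold bilinear_relations_def, blast\<close>)
    then show "\<phi> (c \<odot>\<^bsub>L\<^esub> x) y = c * \<phi> x y" by (simp add: g(1,2) gs algebra_simps)
    have "g (sing x (c \<odot>\<^bsub>L\<^esub> y) - Poly_Mapping.single (x, y) c) = 0"
      by (rule gb) (use c in \<open>unfold bilinear_relations_def, blast\<close>)
    then show "\<phi> x (c \<odot>\<^bsub>L\<^esub> y) = c * \<phi> x y" by (simp add: g(1,2) gs algebra_simps)
  next
    fix p q x y assume h: "x \<in> homog L p" "y \<in> homog L q"
    note c = h[THEN homog_carrier]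
    have "g (sing x y + Poly_Mapping.single (y, x) (ksign p q)) = 0"
    proof (rule gu)
      show "sing x y + Poly_Mapping.single (y, x) (ksign p q) \<in> carrier pairs"
        by (intro sum single_pairs c)
      have "projT (sing x y + Poly_Mapping.single (y, x) (ksign p q)) = pt x y \<oplus>\<^bsub>T\<^esub> (ksign p q \<odot>\<^bsub>T\<^esub> pt y x)"
        by (simp del: free_space_simps add: pT pS single_pairs c vs_one[OF T_vspace] pt_closed)
      then show "projT (sing x y + Poly_Mapping.single (y, x) (ksign p q)) \<in> uce_relations L"
        unfolding uce_relations_def Let_def using h by blast
    qed
    then show "\<phi> x y + ksign p q * \<phi> y x = 0" by (simp add: g(1) gs)
  next
    fix p q r x y z assume h: "x \<in> homog L p" "y \<in> homog L q" "z \<in> homog L r"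
    note c = h[THEN homog_carrier]
    let ?v = "Poly_Mapping.single (x, y \<otimes>\<^bsub>L\<^esub> z) (ksign p r) + Poly_Mapping.single (y, z \<otimes>\<^bsub>L\<^esub> x) (ksign q p)
      + Poly_Mapping.single (z, x \<otimes>\<^bsub>L\<^esub> y) (ksign r q)"
    have "g ?v = 0"
    proof (rule gu)
      show "?v \<in> carrier pairs"
        by (intro sum single_pairs c bracket_closed)
      have "projT ?v = (ksign p r \<odot>\<^bsub>T\<^esub> pt x (y \<otimes>\<^bsub>L\<^esub> z)) \<oplus>\<^bsub>T\<^esub> (ksign q p \<odot>\<^bsub>T\<^esub> pt y (z \<otimes>\<^bsub>L\<^esub> x))
        \<oplus>\<^bsub>T\<^esub> (ksign r q \<odot>\<^bsub>T\<^esub> pt z (x \<otimes>\<^bsub>L\<^esub> y))"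
        by (simp del: free_space_simps add: pT pS sum single_pairs c bracket_closed)
      then show "projT ?v \<in> uce_relations L"
        unfolding uce_relations_def Let_def using h by blast
    qed
    then show "ksign p r * \<phi> x (y \<otimes>\<^bsub>L\<^esub> z) + ksign q p * \<phi> y (z \<otimes>\<^bsub>L\<^esub> x) + ksign r q * \<phi> z (x \<otimes>\<^bsub>L\<^esub> y) = 0"
      by (simp add: g(1) gs)
  qed
  show thesis
  proof (rule that[OF coc])
    show "(\<Sum>s\<in>Poly_Mapping.keys t. Poly_Mapping.lookup t s * \<phi> (fst s) (snd s)) \<noteq> 0"
      using g(6) unfolding g(4)[of t] \<phi>_def by simp
  qed
qed

lemma uce_simps:
  "carrier (uce L) = carrier U" "add (uce L) = add U" "smult (uce L) = smult U"
  "X \<otimes>\<^bsub>uce L\<^esub> Y = uce_pair L (u X) (u Y)"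
  "homog (uce L) p = lspan U {uce_pair L x y | x y q r. x \<in> homog L q \<and> y \<in> homog L r \<and> q + r = p}"
  by (simp_all add: uce_def)

lemma uce_homog_gens: "{uce_pair L x y | x y q r. x \<in> homog L q \<and> y \<in> homog L r \<and> q + r = p} \<subseteq> carrier U"
  by (auto intro: uce_pair_closed homog_carrier)

lemma uce_homog_subspace: "VectorSpace.subspace class_ring (homog (uce L) p) U"
  unfolding uce_simps by (rule lspan_subspace[OF U_vspace uce_homog_gens])

lemma uce_homog_closed:
  "\<zero>\<^bsub>U\<^esub> \<in> homog (uce L) p"
  "X \<in> homog (uce L) p \<Longrightarrow> X \<in> carrier U"
  "X \<in> homog (uce L) p \<Longrightarrow> Y \<in> homog (uce L) p \<Longrightarrow> X \<oplus>\<^bsub>U\<^esub> Y \<in> homog (uce L) p"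
  "X \<in> homog (uce L) p \<Longrightarrow> c \<odot>\<^bsub>U\<^esub> X \<in> homog (uce L) p"
  using uce_homog_subspace[of p] by (auto simp: subspace_iff[OF U_vspace])

lemma uce_pair_homog: "x \<in> homog L q \<Longrightarrow> y \<in> homog L r \<Longrightarrow> q + r = p \<Longrightarrow> uce_pair L x y \<in> homog (uce L) p"
  unfolding uce_simps using lspan_superset[OF U_vspace uce_homog_gens[of p]] by blast

lemma uce_map_homog: "X \<in> homog (uce L) p \<Longrightarrow> u X \<in> homog L p"
proof -
  have "{uce_pair L x y | x y q r. x \<in> homog L q \<and> y \<in> homog L r \<and> q + r = p} \<subseteq> {X \<in> carrier U. u X \<in> homog L p}"
  proof
    fix X assume "X \<in> {uce_pair L x y | x y q r. x \<in> homog L q \<and> y \<in> homog L r \<and> q + r = p}"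
    then obtain x y q r where X: "X = uce_pair L x y" and h: "x \<in> homog L q" "y \<in> homog L r" and p: "q + r = p"
      by blast
    show "X \<in> {X \<in> carrier U. u X \<in> homog L p}"
      using bracket_graded[OF h] h[THEN homog_carrier] unfolding X p by (simp add: uce_map_pair uce_pair_closed)
  qed
  from lspan_minimal[OF U_vspace lin_preimage_subspace[OF U_vspace L_vspace uce_map_linear homog_subspace] this]
  show "X \<in> homog (uce L) p \<Longrightarrow> u X \<in> homog L p" unfolding uce_simps by blast
qed

lemma add4_swap:
  assumes "a \<in> carrier L" "b \<in> carrier L" "c \<in> carrier L" "d \<in> carrier L"
  shows "(a \<oplus>\<^bsub>L\<^esub> b) \<oplus>\<^bsub>L\<^esub> (c \<oplus>\<^bsub>L\<^esub> d) = (a \<oplus>\<^bsub>L\<^esub> c) \<oplus>\<^bsub>L\<^esub> (b \<oplus>\<^bsub>L\<^esub> d)"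
  using assms by (simp add: M.a_ac)

text \<open>Splitting both factors of a bracket into homogeneous parts gives an even and an odd preimage.\<close>

lemma perfect_lift:
  assumes perf: "perfect L" and x: "x \<in> carrier L"
  obtains X0 X1 where "X0 \<in> homog (uce L) 0" "X1 \<in> homog (uce L) 1" "x = u X0 \<oplus>\<^bsub>L\<^esub> u X1"
proof -
  let ?H = "homog (uce L)"
  let ?D = "{x. \<exists>X0\<in>?H 0. \<exists>X1\<in>?H 1. x = u X0 \<oplus>\<^bsub>L\<^esub> u X1}"
  let ?B = "{x \<otimes>\<^bsub>L\<^esub> y | x y. x \<in> carrier L \<and> y \<in> carrier L}"
  have uc: "X \<in> ?H p \<Longrightarrow> u X \<in> carrier L" for X p
    using lin_closed[OF uce_map_linear] uce_homog_closed by blast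
  have sub: "VectorSpace.subspace class_ring ?D L"
    unfolding subspace_iff[OF L_vspace]
  proof (intro conjI ballI allI)
    show "?D \<subseteq> carrier L" using uc vs_add[OF L_vspace] by auto
    have "\<zero>\<^bsub>L\<^esub> = u \<zero>\<^bsub>U\<^esub> \<oplus>\<^bsub>L\<^esub> u \<zero>\<^bsub>U\<^esub>"
      using lin_zero[OF U_vspace L_vspace uce_map_linear] vs_r_zero[OF L_vspace vs_zero[OF L_vspace]] by simp
    then show "\<zero>\<^bsub>L\<^esub> \<in> ?D" using uce_homog_closed(1) by blast
  next
    fix x y assume "x \<in> ?D" "y \<in> ?D"
    then obtain X0 X1 Y0 Y1 where *: "X0 \<in> ?H 0" "X1 \<in> ?H 1" "Y0 \<in> ?H 0" "Y1 \<in> ?H 1"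
      "x = u X0 \<oplus>\<^bsub>L\<^esub> u X1" "y = u Y0 \<oplus>\<^bsub>L\<^esub> u Y1" by blast
    have "x \<oplus>\<^bsub>L\<^esub> y = u (X0 \<oplus>\<^bsub>U\<^esub> Y0) \<oplus>\<^bsub>L\<^esub> u (X1 \<oplus>\<^bsub>U\<^esub> Y1)"
      using * uc by (simp add: lin_add[OF uce_map_linear] uce_homog_closed(2) add4_swap)
    then show "x \<oplus>\<^bsub>L\<^esub> y \<in> ?D" using * uce_homog_closed(3) by blast
  next
    fix c x assume "x \<in> ?D"
    then obtain X0 X1 where *: "X0 \<in> ?H 0" "X1 \<in> ?H 1" "x = u X0 \<oplus>\<^bsub>L\<^esub> u X1" by blast
    have "c \<odot>\<^bsub>L\<^esub> x = u (c \<odot>\<^bsub>U\<^esub> X0) \<oplus>\<^bsub>L\<^esub> u (c \<odot>\<^bsub>U\<^esub> X1)"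
      using * uc by (simp add: lin_smult[OF uce_map_linear] uce_homog_closed(2) vs_r_distr[OF L_vspace])
    then show "c \<odot>\<^bsub>L\<^esub> x \<in> ?D" using * uce_homog_closed(4) by blast
  qed
  have "x \<otimes>\<^bsub>L\<^esub> y \<in> ?D" if xy: "x \<in> carrier L" "y \<in> carrier L" for x y
  proof -
    obtain x0 x1 where x: "x0 \<in> homog L 0" "x1 \<in> homog L 1" "x = x0 \<oplus>\<^bsub>L\<^esub> x1" using xy(1) by (rule homog_decomp)
    obtain y0 y1 where y: "y0 \<in> homog L 0" "y1 \<in> homog L 1" "y = y0 \<oplus>\<^bsub>L\<^esub> y1" using xy(2) by (rule homog_decomp)
    note c = x(1,2)[THEN homog_carrier] y(1,2)[THEN homog_carrier]
    let ?X0 = "uce_pair L x0 y0 \<oplus>\<^bsub>U\<^esub> uce_pair L x1 y1" and ?X1 = "uce_pair L x0 y1 \<oplus>\<^bsub>U\<^esub> uce_pair L x1 y0"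
    have "x \<otimes>\<^bsub>L\<^esub> y = ((x0 \<otimes>\<^bsub>L\<^esub> y0) \<oplus>\<^bsub>L\<^esub> (x1 \<otimes>\<^bsub>L\<^esub> y1)) \<oplus>\<^bsub>L\<^esub> ((x0 \<otimes>\<^bsub>L\<^esub> y1) \<oplus>\<^bsub>L\<^esub> (x1 \<otimes>\<^bsub>L\<^esub> y0))"
      unfolding x(3) y(3) using c
      by (simp add: bracket_add_left bracket_add_right bracket_closed vs_add[OF L_vspace] M.a_ac)
    also have "\<dots> = u ?X0 \<oplus>\<^bsub>L\<^esub> u ?X1"
      using c by (simp add: lin_add[OF uce_map_linear] uce_pair_closed uce_map_pair)
    finally have "x \<otimes>\<^bsub>L\<^esub> y = u ?X0 \<oplus>\<^bsub>L\<^esub> u ?X1" .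
    moreover have "?X0 \<in> ?H 0" "?X1 \<in> ?H 1"
      using x y by (auto intro!: uce_homog_closed(3) uce_pair_homog)
    ultimately show ?thesis by blast
  qed
  then have "?B \<subseteq> ?D" by blast
  then have "lspan L ?B \<subseteq> ?D" by (rule lspan_minimal[OF L_vspace sub])
  then have "x \<in> ?D" using x perf unfolding perfect_def by blast
  then show thesis using that by blast
qed

lemma homog_cancel:
  assumes "x \<in> homog L p" "a \<in> homog L p" "b \<in> homog L q" "p \<noteq> q" "x = a \<oplus>\<^bsub>L\<^esub> b"
  shows "x = a"
proof -
  note c = assms(1-3)[THEN homog_carrier]
  have na: "(- 1) \<odot>\<^bsub>L\<^esub> a \<in> carrier L" using c vs_smult[OF L_vspace] by simp
  have "x \<oplus>\<^bsub>L\<^esub> ((- 1) \<odot>\<^bsub>L\<^esub> a) = b \<oplus>\<^bsub>L\<^esub> (a \<oplus>\<^bsub>L\<^esub> ((- 1) \<odot>\<^bsub>L\<^esub> a))"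
    unfolding assms(5) using c na by (simp add: M.a_ac)
  also have "\<dots> = b" using c vs_neg[OF L_vspace] vs_r_zero[OF L_vspace] by simp
  finally have "b \<in> homog L p" using homog_closed assms(1,2) by metis
  then have "b \<in> homog L 0 \<inter> homog L 1" using assms(3,4) by (cases p; cases q) auto
  then have "b = \<zero>\<^bsub>L\<^esub>" using homog_inter by blast
  then show ?thesis using assms(5) vs_r_zero[OF L_vspace] c by simp
qed

text \<open>An isomorphism of superalgebras has a graded inverse, so a homogeneous element must have a
  homogeneous preimage: in \<open>x = u X0 + u X1\<close>, the summand whose degree is not that of \<open>x\<close> is zero.\<close>

lemma uce_map_homog_onto:
  assumes perf: "perfect L" and x: "x \<in> homog L p"
  shows "\<exists>X\<in>homog (uce L) p. x = u X"
proof -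
  obtain X0 X1 where X: "X0 \<in> homog (uce L) 0" "X1 \<in> homog (uce L) 1" "x = u X0 \<oplus>\<^bsub>L\<^esub> u X1"
    using perfect_lift[OF perf homog_carrier[OF x]] .
  note h = uce_map_homog[OF X(1)] uce_map_homog[OF X(2)]
  note c = h[THEN homog_carrier]
  show ?thesis
  proof (cases "p = 0")
    case True
    then show ?thesis using homog_cancel[OF _ h(1) h(2) _ X(3)] x X(1) by auto
  next
    case False
    then have 1: "p = 1" by simp
    have "x = u X1 \<oplus>\<^bsub>L\<^esub> u X0" using X(3) vs_comm[OF L_vspace c] by simp
    then show ?thesis using homog_cancel[OF _ h(2) h(1)] x X(2) 1 by auto
  qed
qed

text \<open>A nonzero element of the kernel of \<open>uce(L) \<rightarrow> L\<close> would be detected by a cocycle, so the hypothesis on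
  cocycles makes the map injective; perfectness makes it onto.\<close>

theorem centrally_closed_criterion:
  assumes perf: "perfect L"
    and vanish: "\<And>\<phi> t. super_cocycle L \<phi> \<Longrightarrow> t \<in> carrier pairs \<Longrightarrow> bracket_sum t = \<zero>\<^bsub>L\<^esub>
      \<Longrightarrow> (\<Sum>s\<in>Poly_Mapping.keys t. Poly_Mapping.lookup t s * \<phi> (fst s) (snd s)) = 0"
  shows "centrally_closed L"
proof -
  have lie: "lie_superalgebra L" by unfold_locales
  have inj: "inj_on u (carrier U)"
  proof (rule linear_inj_onI[OF U_vspace L_vspace uce_map_linear])
    fix X assume "X \<in> carrier U" and X: "u X = \<zero>\<^bsub>L\<^esub>"
    then obtain t where t: "t \<in> carrier pairs" "X = proj t" unfolding U_carrier by blast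
    have b: "bracket_sum t = \<zero>\<^bsub>L\<^esub>" using X uce_map_proj[OF t(1)] t(2) by simp
    show "X = \<zero>\<^bsub>U\<^esub>"
    proof (rule ccontr)
      assume "X \<noteq> \<zero>\<^bsub>U\<^esub>"
      then have "proj t \<noteq> \<zero>\<^bsub>U\<^esub>" using t(2) by simp
      then obtain \<phi> where "super_cocycle L \<phi>"
        "(\<Sum>s\<in>Poly_Mapping.keys t. Poly_Mapping.lookup t s * \<phi> (fst s) (snd s)) \<noteq> 0"
        by (rule cocycle_separation[OF t(1)])
      then show False using vanish[OF _ t(1) b] by blast
    qed
  qed
  have "carrier L \<subseteq> u ` carrier U"
  proof
    fix x assume "x \<in> carrier L"
    then obtain X0 X1 where X: "X0 \<in> homog (uce L) 0" "X1 \<in> homog (uce L) 1" "x = u X0 \<oplus>\<^bsub>L\<^esub> u X1"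
      by (rule perfect_lift[OF perf])
    then have "x = u (X0 \<oplus>\<^bsub>U\<^esub> X1)" by (simp add: lin_add[OF uce_map_linear] uce_homog_closed(2))
    moreover have "X0 \<oplus>\<^bsub>U\<^esub> X1 \<in> carrier U" using X uce_homog_closed(2) vs_add[OF U_vspace] by blast
    ultimately show "x \<in> u ` carrier U" by blast
  qed
  then have bij: "bij_betw u (carrier U) (carrier L)"
    using inj lin_closed[OF uce_map_linear] unfolding bij_betw_def by blast
  have hom: "u \<in> superalgebra_hom (uce L) L"
    unfolding superalgebra_hom_def
  proof (intro CollectI conjI ballI allI)
    show "u \<in> linear_maps (uce L) L"
      using uce_map_linear unfolding LinearCombinations.module_hom_def uce_simps .
    show "u (X \<otimes>\<^bsub>uce L\<^esub> Y) = u X \<otimes>\<^bsub>L\<^esub> u Y" if "X \<in> carrier (uce L)" "Y \<in> carrier (uce L)" for X Y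
      using that unfolding uce_simps by (intro uce_map_pair lin_closed[OF uce_map_linear])
  qed (rule uce_map_homog)
  let ?v = "inv_into (carrier (uce L)) u"
  have vu: "?v (u X) = X" if "X \<in> carrier U" for X
    using inj that unfolding uce_simps by simp
  have uv: "?v x \<in> carrier U" "u (?v x) = x" if "x \<in> carrier L" for x
    using bij that bij_betw_inv_into_right[OF bij that]
    unfolding uce_simps by (auto simp: bij_betw_def inv_into_into)
  have "?v \<in> superalgebra_hom L (uce L)"
    unfolding superalgebra_hom_def
  proof (intro CollectI conjI ballI allI)
    show "?v \<in> linear_maps L (uce L)"
      using inv_into_linear[OF U_vspace uce_map_linear bij]
      unfolding LinearCombinations.module_hom_def uce_simps .
    show "?v (x \<otimes>\<^bsub>L\<^esub> y) = ?v x \<otimes>\<^bsub>uce L\<^esub> ?v y" if xy: "x \<in> carrier L" "y \<in> carrier L" for x y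
    proof -
      have "?v (u (uce_pair L x y)) = uce_pair L x y" by (rule vu[OF uce_pair_closed[OF xy]])
      then show ?thesis unfolding uce_simps(4) uce_map_pair[OF xy] uv(2)[OF xy(1)] uv(2)[OF xy(2)] .
    qed
    fix p x assume "x \<in> homog L p"
    then obtain X where X: "X \<in> homog (uce L) p" "x = u X" using uce_map_homog_onto[OF perf] by blast
    then show "?v x \<in> homog (uce L) p" using vu[OF uce_homog_closed(2)[OF X(1)]] by simp
  qed
  then show ?thesis
    unfolding centrally_closed_def superalgebra_iso_def
    using lie perf hom bij by (simp add: uce_simps)
qed

end

section \<open>Direct limits of Lie superalgebras\<close>

lemma lin_free_eval:
  assumes M: "vspace M" and W: "vspace W" and f: "f \<in> linear_maps M W"
    and h: "h ` Poly_Mapping.keys t \<subseteq> carrier M"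
  shows "f (free_eval M h t) = free_eval W (\<lambda>s. f (h s)) t"
proof -
  interpret M: vectorspace class_ring M by (fact M)
  interpret W: vectorspace class_ring W by (fact W)
  have "(\<Oplus>\<^bsub>M\<^esub>s\<in>A. Poly_Mapping.lookup t s \<odot>\<^bsub>M\<^esub> h s) \<in> carrier M \<and>
      f (\<Oplus>\<^bsub>M\<^esub>s\<in>A. Poly_Mapping.lookup t s \<odot>\<^bsub>M\<^esub> h s) = (\<Oplus>\<^bsub>W\<^esub>s\<in>A. Poly_Mapping.lookup t s \<odot>\<^bsub>W\<^esub> f (h s))"
    if "finite A" "h ` A \<subseteq> carrier M" for A
    using that
  proof (induction A rule: finite_induct)
    case empty
    then show ?case by (simp add: lin_zero[OF M W f])
  next
    case (insert a A)
    have *: "Poly_Mapping.lookup t s \<odot>\<^bsub>M\<^esub> h s \<in> carrier M" "f (h s) \<in> carrier W"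
      "Poly_Mapping.lookup t s \<odot>\<^bsub>W\<^esub> f (h s) \<in> carrier W" if "s \<in> insert a A" for s
      using that insert.prems vs_smult[OF M] vs_smult[OF W] lin_closed[OF f] by auto
    show ?case using insert * by (simp add: lin_add[OF f] lin_smult[OF f] image_subset_iff)
  qed
  then show ?thesis using h unfolding free_eval_def by simp
qed

text \<open>The same for scalar-valued maps, whose codomain is the field itself and not a module record.\<close>

lemma functional_free_eval:
  fixes g :: "'m \<Rightarrow> 'k :: field"
  assumes M: "vspace M"
    and add: "\<And>x y. x \<in> carrier M \<Longrightarrow> y \<in> carrier M \<Longrightarrow> g (x \<oplus>\<^bsub>M\<^esub> y) = g x + g y"
    and smult: "\<And>c x. x \<in> carrier M \<Longrightarrow> g (c \<odot>\<^bsub>M\<^esub> x) = c * g x"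
    and h: "h ` Poly_Mapping.keys t \<subseteq> carrier M"
  shows "g (free_eval M h t) = (\<Sum>s\<in>Poly_Mapping.keys t. Poly_Mapping.lookup t s * g (h s))"
proof -
  interpret M: vectorspace class_ring M by (fact M)
  have g0: "g \<zero>\<^bsub>M\<^esub> = 0" using smult[OF vs_zero[OF M], of 0] vs_zero_smult[OF M vs_zero[OF M]] by simp
  have "(\<Oplus>\<^bsub>M\<^esub>s\<in>A. Poly_Mapping.lookup t s \<odot>\<^bsub>M\<^esub> h s) \<in> carrier M \<and>
      g (\<Oplus>\<^bsub>M\<^esub>s\<in>A. Poly_Mapping.lookup t s \<odot>\<^bsub>M\<^esub> h s) = (\<Sum>s\<in>A. Poly_Mapping.lookup t s * g (h s))"
    if "finite A" "h ` A \<subseteq> carrier M" for A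
    using that
  proof (induction A rule: finite_induct)
    case empty
    then show ?case by (simp add: g0)
  next
    case (insert a A)
    have *: "Poly_Mapping.lookup t s \<odot>\<^bsub>M\<^esub> h s \<in> carrier M" if "s \<in> insert a A" for s
      using that insert.prems vs_smult[OF M] by auto
    show ?case using insert * by (simp add: add smult image_subset_iff)
  qed
  then show ?thesis using h unfolding free_eval_def by simp
qed

locale lie_system =
  fixes s :: nat and L :: "nat \<Rightarrow> ('k :: field_char_0, 'a) superalgebra" and f :: "nat \<Rightarrow> 'a \<Rightarrow> 'a"
  assumes lie: "s \<le> i \<Longrightarrow> lie_superalgebra (L i)"
    and hom: "s \<le> i \<Longrightarrow> f i \<in> superalgebra_hom (L i) (L (Suc i))"
begin

abbreviation "tr i j \<equiv> fold f [i..<j]"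
abbreviation "cl \<equiv> limit_class s L f"
abbreviation "D \<equiv> direct_limit s L f"

lemma Lv: "s \<le> i \<Longrightarrow> vspace (L i)"
  using lie lie_superalgebra.L_vspace by blast

lemma tr_trans: "i \<le> j \<Longrightarrow> j \<le> l \<Longrightarrow> tr j l (tr i j x) = tr i l x"
  using upt_add_eq_append[of i j "l - j"] by simp

lemma tr_hom: "s \<le> i \<Longrightarrow> i \<le> j \<Longrightarrow> tr i j \<in> superalgebra_hom (L i) (L j)"
proof (induction j)
  case 0
  then show ?case by (simp add: superalgebra_hom_def LinearCombinations.module_hom_def)
next
  case (Suc j)
  show ?case
  proof (cases "i = Suc j")
    case True
    then show ?thesis by (simp add: superalgebra_hom_def LinearCombinations.module_hom_def)
  next
    case False
    then have ij: "i \<le> j" and sj: "s \<le> j" using Suc.prems by auto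
    from Suc.IH[OF Suc.prems(1) ij] hom[OF sj] show ?thesis
      unfolding superalgebra_hom_def LinearCombinations.module_hom_def
      using ij by (simp add: Pi_iff)
  qed
qed

lemma tr_linear: "s \<le> i \<Longrightarrow> i \<le> j \<Longrightarrow> tr i j \<in> linear_maps (L i) (L j)"
  using tr_hom by (simp add: superalgebra_hom_def)

lemma tr_facts:
  assumes "s \<le> i" "i \<le> j"
  shows tr_closed: "x \<in> carrier (L i) \<Longrightarrow> tr i j x \<in> carrier (L j)"
    and tr_add: "x \<in> carrier (L i) \<Longrightarrow> y \<in> carrier (L i) \<Longrightarrow> tr i j (x \<oplus>\<^bsub>L i\<^esub> y) = tr i j x \<oplus>\<^bsub>L j\<^esub> tr i j y"
    and tr_mult: "x \<in> carrier (L i) \<Longrightarrow> y \<in> carrier (L i) \<Longrightarrow> tr i j (x \<otimes>\<^bsub>L i\<^esub> y) = tr i j x \<otimes>\<^bsub>L j\<^esub> tr i j y"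
    and tr_smult: "x \<in> carrier (L i) \<Longrightarrow> tr i j (c \<odot>\<^bsub>L i\<^esub> x) = c \<odot>\<^bsub>L j\<^esub> tr i j x"
    and tr_homog: "x \<in> homog (L i) p \<Longrightarrow> tr i j x \<in> homog (L j) p"
    and tr_zero: "tr i j \<zero>\<^bsub>L i\<^esub> = \<zero>\<^bsub>L j\<^esub>"
  using tr_hom[OF assms] lin_zero[OF Lv[OF assms(1)] Lv[OF le_trans[OF assms]] tr_linear[OF assms]]
  by (auto simp: superalgebra_hom_def LinearCombinations.module_hom_def)

lemma homogL_carrier: "s \<le> i \<Longrightarrow> x \<in> homog (L i) p \<Longrightarrow> x \<in> carrier (L i)"
  using lie_superalgebra.homog_carrier[OF lie] .

lemma mem_cl:
  "s \<le> i \<Longrightarrow> x \<in> carrier (L i) \<Longrightarrow> (j, y) \<in> cl i x \<longleftrightarrow>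
    s \<le> j \<and> y \<in> carrier (L j) \<and> (\<exists>l\<ge>max i j. tr i l x = tr j l y)"
  by (auto simp: limit_class_def limit_rel_def)

lemma self_mem_cl: "s \<le> i \<Longrightarrow> x \<in> carrier (L i) \<Longrightarrow> (i, x) \<in> cl i x"
  by (auto simp: mem_cl)

lemma rel_equiv: "equiv (SIGMA i:{s..}. carrier (L i)) (limit_rel s L f)"
proof (rule equivI)
  show "limit_rel s L f \<subseteq> (SIGMA i:{s..}. carrier (L i)) \<times> (SIGMA i:{s..}. carrier (L i))"
    by (auto simp: limit_rel_def)
  show "refl_on (SIGMA i:{s..}. carrier (L i)) (limit_rel s L f)"
    by (auto simp: refl_on_def limit_rel_def)
  show "sym (limit_rel s L f)"
  proof (rule symI)
    fix X Y assume XY: "(X, Y) \<in> limit_rel s L f"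
    obtain i x where X: "X = (i, x)" by (cases X)
    obtain j y where Y: "Y = (j, y)" by (cases Y)
    from XY obtain a where "a \<ge> max i j" "tr j a y = tr i a x"
      unfolding X Y limit_rel_def by auto
    then show "(Y, X) \<in> limit_rel s L f" using XY unfolding X Y limit_rel_def by auto
  qed
  show "trans (limit_rel s L f)"
  proof (rule transI)
    fix X Y Z assume XY: "(X, Y) \<in> limit_rel s L f" and YZ: "(Y, Z) \<in> limit_rel s L f"
    obtain i x where X: "X = (i, x)" by (cases X)
    obtain j y where Y: "Y = (j, y)" by (cases Y)
    obtain k z where Z: "Z = (k, z)" by (cases Z)
    from XY obtain a where a: "a \<ge> max i j" "tr i a x = tr j a y" "s \<le> i" "x \<in> carrier (L i)"
      unfolding X Y limit_rel_def by auto
    from YZ obtain b where b: "b \<ge> max j k" "tr j b y = tr k b z" "s \<le> k" "z \<in> carrier (L k)"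
      unfolding Y Z limit_rel_def by auto
    define m where "m = max a b"
    have m: "a \<le> m" "b \<le> m" by (simp_all add: m_def)
    have "tr i m x = tr a m (tr i a x)" by (rule tr_trans[symmetric]) (use a m in auto)
    also have "\<dots> = tr j m y" unfolding a(2) using a m by (intro tr_trans) auto
    also have "\<dots> = tr b m (tr j b y)" by (rule tr_trans[symmetric]) (use b m in auto)
    also have "\<dots> = tr k m z" unfolding b(2) using b m by (intro tr_trans) auto
    finally have "tr i m x = tr k m z" .
    moreover have "m \<ge> max i k" using a b by (auto simp: m_def)
    ultimately show "(X, Z) \<in> limit_rel s L f" using a b unfolding X Z limit_rel_def by auto
  qed
qed

lemma cl_eq_iff:
  assumes "s \<le> i" "x \<in> carrier (L i)" "s \<le> j" "y \<in> carrier (L j)"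
  shows "cl i x = cl j y \<longleftrightarrow> (\<exists>l\<ge>max i j. tr i l x = tr j l y)"
  using eq_equiv_class_iff[OF rel_equiv, of "(i, x)" "(j, y)"] assms
  unfolding limit_class_def by (simp add: limit_rel_def)

lemma cl_up: "s \<le> i \<Longrightarrow> i \<le> j \<Longrightarrow> x \<in> carrier (L i) \<Longrightarrow> cl j (tr i j x) = cl i x"
  by (subst cl_eq_iff) (auto simp: tr_closed intro!: exI[of _ j])

lemma D_carrier: "carrier D = {cl i x | i x. s \<le> i \<and> x \<in> carrier (L i)}"
  by (auto simp: direct_limit_def quotient_def limit_class_def)

text \<open>The operations of the limit are unions over all representatives of the arguments; naturality of
  \<open>g\<close> makes all members of such a union equal.\<close>

lemma limit_op_cl:
  assumes i: "s \<le> i" "x \<in> carrier (L i)" "y \<in> carrier (L i)"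
    and closed: "\<And>j a b. s \<le> j \<Longrightarrow> a \<in> carrier (L j) \<Longrightarrow> b \<in> carrier (L j) \<Longrightarrow> g j a b \<in> carrier (L j)"
    and nat: "\<And>j l a b. s \<le> j \<Longrightarrow> j \<le> l \<Longrightarrow> a \<in> carrier (L j) \<Longrightarrow> b \<in> carrier (L j)
      \<Longrightarrow> tr j l (g j a b) = g l (tr j l a) (tr j l b)"
  shows "limit_op s L f g (cl i x) (cl i y) = cl i (g i x y)"
proof -
  have *: "(let l = max i' j' in cl l (g l (tr i' l x') (tr j' l y'))) = cl i (g i x y)"
    if xx: "(i', x') \<in> cl i x" and yy: "(j', y') \<in> cl i y" for i' x' j' y'
  proof -
    from xx i obtain a where a: "s \<le> i'" "x' \<in> carrier (L i')" "a \<ge> max i i'" "tr i a x = tr i' a x'"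
      by (auto simp: mem_cl)
    from yy i obtain b where b: "s \<le> j'" "y' \<in> carrier (L j')" "b \<ge> max i j'" "tr i b y = tr j' b y'"
      by (auto simp: mem_cl)
    define l m where "l = max i' j'" and "m = max a b"
    have m: "tr i m x = tr i' m x'" "tr i m y = tr j' m y'"
      using a b tr_trans[of i a m x] tr_trans[of i' a m x'] tr_trans[of i b m y] tr_trans[of j' b m y']
      by (simp_all add: m_def)
    have le: "i \<le> m" "i' \<le> l" "j' \<le> l" "l \<le> m" "s \<le> l" using a b by (auto simp: l_def m_def)
    have gl: "g l (tr i' l x') (tr j' l y') \<in> carrier (L l)"
      using le a b by (intro closed tr_closed) auto
    have "cl l (g l (tr i' l x') (tr j' l y')) = cl m (tr l m (g l (tr i' l x') (tr j' l y')))"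
      by (rule cl_up[symmetric]) (use le gl in auto)
    also have "tr l m (g l (tr i' l x') (tr j' l y')) = g m (tr i' m x') (tr j' m y')"
      using le a b by (subst nat) (auto intro: tr_closed simp: tr_trans)
    also have "\<dots> = tr i m (g i x y)" using i le by (simp add: nat m)
    also have "cl m \<dots> = cl i (g i x y)" by (rule cl_up) (use i le closed in auto)
    finally show ?thesis by (simp add: l_def Let_def)
  qed
  have "limit_op s L f g (cl i x) (cl i y) = (\<Union>X\<in>cl i x. \<Union>Y\<in>cl i y. cl i (g i x y))"
    unfolding limit_op_def
  proof (intro SUP_cong refl)
    fix X assume X': "X \<in> cl i x"
    obtain i' x' where X: "X = (i', x')" by (cases X)
    have "(\<Union>(j', y')\<in>cl i y. let l = max i' j' in cl l (g l (tr i' l x') (tr j' l y'))) = (\<Union>Y\<in>cl i y. cl i (g i x y))"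
    proof (intro SUP_cong refl)
      fix Y assume Y': "Y \<in> cl i y"
      obtain j' y' where Y: "Y = (j', y')" by (cases Y)
      show "(case Y of (j', y') \<Rightarrow> let l = max i' j' in cl l (g l (tr i' l x') (tr j' l y'))) = cl i (g i x y)"
        using *[of i' x' j' y'] X' Y' unfolding X Y by simp
    qed
    then show "(case X of (i', x') \<Rightarrow> \<Union>(j', y')\<in>cl i y. let l = max i' j' in cl l (g l (tr i' l x') (tr j' l y')))
        = (\<Union>Y\<in>cl i y. cl i (g i x y))"
      unfolding X by simp
  qed
  moreover have "cl i x \<noteq> {}" "cl i y \<noteq> {}" using self_mem_cl i by blast+
  ultimately show ?thesis by simp
qed

lemma cl_add: "s \<le> i \<Longrightarrow> x \<in> carrier (L i) \<Longrightarrow> y \<in> carrier (L i) \<Longrightarrow> cl i x \<oplus>\<^bsub>D\<^esub> cl i y = cl i (x \<oplus>\<^bsub>L i\<^esub> y)"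
  unfolding direct_limit_def by simp (rule limit_op_cl; simp add: vs_add[OF Lv] tr_add)

lemma cl_mult: "s \<le> i \<Longrightarrow> x \<in> carrier (L i) \<Longrightarrow> y \<in> carrier (L i) \<Longrightarrow> cl i x \<otimes>\<^bsub>D\<^esub> cl i y = cl i (x \<otimes>\<^bsub>L i\<^esub> y)"
  unfolding direct_limit_def
  by simp (rule limit_op_cl; simp add: lie_superalgebra.bracket_closed[OF lie] tr_mult)

lemma cl_smult:
  assumes i: "s \<le> i" "x \<in> carrier (L i)"
  shows "c \<odot>\<^bsub>D\<^esub> cl i x = cl i (c \<odot>\<^bsub>L i\<^esub> x)"
proof -
  have "(case X of (j, y) \<Rightarrow> cl j (c \<odot>\<^bsub>L j\<^esub> y)) = cl i (c \<odot>\<^bsub>L i\<^esub> x)" if Xi: "X \<in> cl i x" for X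
  proof -
    obtain j y where X: "X = (j, y)" by (cases X)
    then obtain l where l: "s \<le> j" "y \<in> carrier (L j)" "l \<ge> max i j" "tr i l x = tr j l y"
      using Xi i by (auto simp: mem_cl)
    have "tr i l (c \<odot>\<^bsub>L i\<^esub> x) = tr j l (c \<odot>\<^bsub>L j\<^esub> y)" using i l by (simp add: tr_smult)
    then have "cl i (c \<odot>\<^bsub>L i\<^esub> x) = cl j (c \<odot>\<^bsub>L j\<^esub> y)"
      using i l vs_smult[OF Lv] by (subst cl_eq_iff) auto
    then show ?thesis by (simp add: X)
  qed
  then have "(\<Union>X\<in>cl i x. (case X of (j, y) \<Rightarrow> cl j (c \<odot>\<^bsub>L j\<^esub> y))) = (\<Union>X\<in>cl i x. cl i (c \<odot>\<^bsub>L i\<^esub> x))"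
    by (intro SUP_cong refl)
  moreover have "cl i x \<noteq> {}" using self_mem_cl i by blast
  ultimately show ?thesis by (simp add: direct_limit_def)
qed

lemma cl_zero: "s \<le> i \<Longrightarrow> cl i \<zero>\<^bsub>L i\<^esub> = \<zero>\<^bsub>D\<^esub>"
  using cl_up[of s i "\<zero>\<^bsub>L s\<^esub>"] tr_zero[of s i] vs_zero[OF Lv, of s] by (simp add: direct_limit_def)

lemma cl_homog: "homog D p = {cl i x | i x. s \<le> i \<and> x \<in> homog (L i) p}"
  by (simp add: direct_limit_def)

lemma cl_closed: "s \<le> i \<Longrightarrow> x \<in> carrier (L i) \<Longrightarrow> cl i x \<in> carrier D"
  unfolding D_carrier by blast

lemma cl_homog_closed: "s \<le> i \<Longrightarrow> x \<in> homog (L i) p \<Longrightarrow> cl i x \<in> homog D p"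
  unfolding cl_homog by blast

text \<open>The axioms of the limit are inherited from the stages: the elements that occur in an axiom are
  represented at one common stage.\<close>

lemma stage2:
  assumes "X \<in> carrier D" "Y \<in> carrier D"
  obtains i x y where "s \<le> i" "x \<in> carrier (L i)" "y \<in> carrier (L i)" "X = cl i x" "Y = cl i y"
proof -
  from assms obtain i x j y where *: "s \<le> i" "x \<in> carrier (L i)" "X = cl i x"
    "s \<le> j" "y \<in> carrier (L j)" "Y = cl j y" unfolding D_carrier by blast
  let ?l = "max i j"
  show thesis
    by (rule that[of ?l "tr i ?l x" "tr j ?l y"]) (use * in \<open>auto simp: cl_up intro: tr_closed\<close>)
qed

lemma stage3:
  assumes "X \<in> carrier D" "Y \<in> carrier D" "Z \<in> carrier D"
  obtains i x y z where "s \<le> i" "x \<in> carrier (L i)" "y \<in> carrier (L i)" "z \<in> carrier (L i)"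
    "X = cl i x" "Y = cl i y" "Z = cl i z"
proof -
  obtain i x y where *: "s \<le> i" "x \<in> carrier (L i)" "y \<in> carrier (L i)" "X = cl i x" "Y = cl i y"
    using stage2[OF assms(1,2)] .
  from assms obtain j z where **: "s \<le> j" "z \<in> carrier (L j)" "Z = cl j z" unfolding D_carrier by blast
  let ?l = "max i j"
  show thesis
    by (rule that[of ?l "tr i ?l x" "tr i ?l y" "tr j ?l z"]) (use * ** in \<open>auto simp: cl_up intro: tr_closed\<close>)
qed

lemma stage3_homog:
  assumes "X \<in> homog D p" "Y \<in> homog D q" "Z \<in> homog D r"
  obtains i x y z where "s \<le> i" "x \<in> homog (L i) p" "y \<in> homog (L i) q" "z \<in> homog (L i) r"
    "X = cl i x" "Y = cl i y" "Z = cl i z"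
proof -
  from assms obtain a x b y c z where *: "s \<le> a" "x \<in> homog (L a) p" "X = cl a x"
    "s \<le> b" "y \<in> homog (L b) q" "Y = cl b y" "s \<le> c" "z \<in> homog (L c) r" "Z = cl c z"
    unfolding cl_homog by blast
  let ?l = "max a (max b c)"
  show thesis
    by (rule that[of ?l "tr a ?l x" "tr b ?l y" "tr c ?l z"])
      (use * in \<open>auto simp: cl_up homogL_carrier intro: tr_homog\<close>)
qed

lemma D_vspace: "vspace D"
proof (rule vspaceI, goal_cases)
  case 1
  show ?case using cl_zero[of s] cl_closed[OF _ vs_zero[OF Lv], of s] by simp
next
  case (2 X Y)
  then show ?case by (rule stage2) (simp add: cl_add cl_closed vs_add[OF Lv])
next
  case (3 c X)
  \<comment> \<open>a single element is treated as a pair of equal elements\<close>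
  from 3 3 show ?case by (rule stage2) (simp add: cl_smult cl_closed vs_smult[OF Lv])
next
  case (4 X Y)
  then show ?case
  proof (rule stage2)
    fix i x y assume *: "s \<le> i" "x \<in> carrier (L i)" "y \<in> carrier (L i)" "X = cl i x" "Y = cl i y"
    then show ?thesis using vs_comm[OF Lv[OF *(1)] *(2,3)] by (simp add: cl_add)
  qed
next
  case (5 X Y Z)
  then show ?case by (rule stage3) (simp add: cl_add vs_add[OF Lv] vs_assoc[OF Lv])
next
  case (6 X)
  from 6 6 show ?case
  proof (rule stage2)
    fix i x y assume *: "s \<le> i" "x \<in> carrier (L i)" "X = cl i x"
    then show ?thesis unfolding cl_zero[OF *(1), symmetric]
      by (simp add: cl_add vs_zero[OF Lv] vs_r_zero[OF Lv])
  qed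
next
  case (7 X)
  from 7 7 show ?case
  proof (rule stage2)
    fix i x y assume *: "s \<le> i" "x \<in> carrier (L i)" "X = cl i x"
    then show ?thesis unfolding cl_zero[OF *(1), symmetric]
      by (simp add: cl_add cl_smult vs_smult[OF Lv] vs_neg[OF Lv])
  qed
next
  case (8 a b X)
  from 8 8 show ?case by (rule stage2) (simp add: cl_smult vs_smult[OF Lv] vs_smult_assoc[OF Lv])
next
  case (9 X)
  from 9 9 show ?case by (rule stage2) (simp add: cl_smult vs_one[OF Lv])
next
  case (10 a b X)
  from 10 10 show ?case by (rule stage2) (simp add: cl_smult cl_add vs_smult[OF Lv] vs_l_distr[OF Lv])
next
  case (11 a X Y)
  then show ?case by (rule stage2) (simp add: cl_smult cl_add vs_smult[OF Lv] vs_add[OF Lv] vs_r_distr[OF Lv])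
qed

lemma D_homog_carrier: "X \<in> homog D p \<Longrightarrow> X \<in> carrier D"
  unfolding cl_homog using homogL_carrier cl_closed by auto

lemmas [simp] = cl_add cl_mult cl_smult

theorem limit_lie: "lie_superalgebra D"
proof (rule lie_superalgebra.intro[OF D_vspace], rule lie_superalgebra_axioms.intro, goal_cases)
  case (1 p)
  show ?case unfolding subspace_iff[OF D_vspace]
  proof (intro conjI ballI allI)
    show "homog D p \<subseteq> carrier D" using D_homog_carrier by blast
    show "\<zero>\<^bsub>D\<^esub> \<in> homog D p"
      using cl_homog_closed[of s "\<zero>\<^bsub>L s\<^esub>" p] lie_superalgebra.homog_closed(1)[OF lie, of s p] cl_zero[of s] by simp
    show "X \<oplus>\<^bsub>D\<^esub> Y \<in> homog D p" if "X \<in> homog D p" "Y \<in> homog D p" for X Y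
      using that(1,2,2)
      by (rule stage3_homog)
        (simp add: homogL_carrier cl_homog_closed lie_superalgebra.homog_closed(2)[OF lie])
    show "c \<odot>\<^bsub>D\<^esub> X \<in> homog D p" if "X \<in> homog D p" for c X
      using that that that
      by (rule stage3_homog)
        (simp add: homogL_carrier cl_homog_closed lie_superalgebra.homog_closed(3)[OF lie])
  qed
next
  case 2
  show ?case
  proof (intro equalityI subsetI)
    fix X assume "X \<in> carrier D"
    then obtain i x where i: "s \<le> i" "x \<in> carrier (L i)" "X = cl i x" unfolding D_carrier by blast
    interpret Li: lie_superalgebra "L i" using lie i by blast
    obtain x0 x1 where x: "x0 \<in> homog (L i) 0" "x1 \<in> homog (L i) 1" "x = x0 \<oplus>\<^bsub>L i\<^esub> x1"
      using i(2) by (rule Li.homog_decomp)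
    have "X = cl i x0 \<oplus>\<^bsub>D\<^esub> cl i x1" using i x Li.homog_carrier by simp
    moreover have "cl i x0 \<in> homog D 0" "cl i x1 \<in> homog D 1" using i x cl_homog_closed by auto
    ultimately show "X \<in> homog D 0 <+>\<^bsub>D\<^esub> homog D 1" unfolding set_add_def' by blast
  next
    fix X assume "X \<in> homog D 0 <+>\<^bsub>D\<^esub> homog D 1"
    then obtain A B where "A \<in> homog D 0" "B \<in> homog D 1" "X = A \<oplus>\<^bsub>D\<^esub> B" unfolding set_add_def' by blast
    then show "X \<in> carrier D" using D_homog_carrier vs_add[OF D_vspace] by blast
  qed
next
  case 3
  show ?case
  proof (intro equalityI subsetI)
    fix X assume X: "X \<in> homog D 0 \<inter> homog D 1"
    then have "X \<in> homog D 0" "X \<in> homog D 1" by auto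
    then obtain i x j y where *: "s \<le> i" "x \<in> homog (L i) 0" "X = cl i x"
      "s \<le> j" "y \<in> homog (L j) 1" "X = cl j y" unfolding cl_homog by auto
    then obtain l where l: "l \<ge> max i j" "tr i l x = tr j l y"
      using cl_eq_iff[of i x j y] homogL_carrier by auto
    interpret Ll: lie_superalgebra "L l" using lie l * by auto
    have "tr i l x \<in> homog (L l) 0" by (rule tr_homog) (use l * in auto)
    moreover have "tr j l y \<in> homog (L l) 1" by (rule tr_homog) (use l * in auto)
    ultimately have "tr i l x \<in> homog (L l) 0 \<inter> homog (L l) 1" using l by simp
    then have "tr i l x = \<zero>\<^bsub>L l\<^esub>" unfolding Ll.homog_inter by simp
    moreover have "X = cl l (tr i l x)" using * l by (simp add: cl_up homogL_carrier)
    ultimately show "X \<in> {\<zero>\<^bsub>D\<^esub>}" using cl_zero[of l] * l by simp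
  next
    fix X assume "X \<in> {\<zero>\<^bsub>D\<^esub>}"
    then have "X = cl s \<zero>\<^bsub>L s\<^esub>" using cl_zero[of s] by simp
    moreover have "\<zero>\<^bsub>L s\<^esub> \<in> homog (L s) p" for p using lie_superalgebra.homog_closed(1)[OF lie, of s p] by simp
    ultimately show "X \<in> homog D 0 \<inter> homog D 1" using cl_homog_closed[of s] by simp
  qed
next
  case (4 X Y)
  then show ?case by (rule stage2) (simp add: cl_closed lie_superalgebra.bracket_closed[OF lie])
next
  case (5 X Y Z)
  then show ?case
    by (rule stage3) (simp add: vs_add[OF Lv] lie_superalgebra.bracket_closed[OF lie]
        lie_superalgebra.bracket_add_left[OF lie])
next
  case (6 X Y Z)
  then show ?case
    by (rule stage3) (simp add: vs_add[OF Lv] lie_superalgebra.bracket_closed[OF lie]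
        lie_superalgebra.bracket_add_right[OF lie])
next
  case (7 X Y c)
  then show ?case
    by (rule stage2) (simp add: vs_smult[OF Lv] lie_superalgebra.bracket_closed[OF lie]
        lie_superalgebra.bracket_smult_left[OF lie])
next
  case (8 X Y c)
  then show ?case
    by (rule stage2) (simp add: vs_smult[OF Lv] lie_superalgebra.bracket_closed[OF lie]
        lie_superalgebra.bracket_smult_right[OF lie])
next
  case (9 X p Y q)
  from 9(1,2,2) show ?case
  proof (rule stage3_homog)
    fix i x y assume *: "s \<le> i" "x \<in> homog (L i) p" "y \<in> homog (L i) q" "X = cl i x" "Y = cl i y"
    have "X \<otimes>\<^bsub>D\<^esub> Y = cl i (x \<otimes>\<^bsub>L i\<^esub> y)" using * by (simp add: homogL_carrier)
    then show ?thesis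
      using cl_homog_closed[OF *(1) lie_superalgebra.bracket_graded[OF lie[OF *(1)] *(2,3)]] by metis
  qed
next
  case (10 X p Y q)
  from 10(1,2,2) show ?case
  proof (rule stage3_homog)
    fix i x y z assume *: "s \<le> i" "x \<in> homog (L i) p" "y \<in> homog (L i) q" "X = cl i x" "Y = cl i y"
    then show ?thesis unfolding cl_zero[OF *(1), symmetric]
      by (simp add: homogL_carrier vs_smult[OF Lv] lie_superalgebra.bracket_closed[OF lie]
          lie_superalgebra.bracket_antisym[OF lie])
  qed
next
  case (11 X p Y q Z r)
  then show ?case
  proof (rule stage3_homog)
    fix i x y z assume *: "s \<le> i" "x \<in> homog (L i) p" "y \<in> homog (L i) q" "z \<in> homog (L i) r"
      "X = cl i x" "Y = cl i y" "Z = cl i z"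
    then show ?thesis unfolding cl_zero[OF *(1), symmetric]
      by (simp add: homogL_carrier vs_add[OF Lv] vs_smult[OF Lv] lie_superalgebra.bracket_closed[OF lie]
          lie_superalgebra.bracket_jacobi[OF lie])
  qed
qed

lemma cl_linear: "s \<le> i \<Longrightarrow> cl i \<in> linear_maps (L i) D"
  by (rule linear_mapsI) (auto simp: cl_closed)

lemma pullback_cocycle:
  assumes "super_cocycle D \<phi>" "s \<le> i"
  shows "super_cocycle (L i) (\<lambda>x y. \<phi> (cl i x) (cl i y))"
proof -
  have b: "\<phi> (X \<oplus>\<^bsub>D\<^esub> Y) Z = \<phi> X Z + \<phi> Y Z" "\<phi> Z (X \<oplus>\<^bsub>D\<^esub> Y) = \<phi> Z X + \<phi> Z Y"
    "\<phi> (c \<odot>\<^bsub>D\<^esub> X) Y = c * \<phi> X Y" "\<phi> X (c \<odot>\<^bsub>D\<^esub> Y) = c * \<phi> X Y"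
    if "X \<in> carrier D" "Y \<in> carrier D" "Z \<in> carrier D" for X Y Z c
    using assms(1) that unfolding super_cocycle_def by blast+
  have h: "\<phi> X Y + ksign p q * \<phi> Y X = 0"
    "ksign p r * \<phi> X (Y \<otimes>\<^bsub>D\<^esub> Z) + ksign q p * \<phi> Y (Z \<otimes>\<^bsub>D\<^esub> X) + ksign r q * \<phi> Z (X \<otimes>\<^bsub>D\<^esub> Y) = 0"
    if "X \<in> homog D p" "Y \<in> homog D q" "Z \<in> homog D r" for X Y Z p q r
    using assms(1) that unfolding super_cocycle_def by blast+
  show ?thesis
    unfolding super_cocycle_def
  proof (intro conjI ballI allI)
    fix x y z assume c: "x \<in> carrier (L i)" "y \<in> carrier (L i)" "z \<in> carrier (L i)"
    note C = c[THEN cl_closed[OF assms(2)]]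
    show "\<phi> (cl i (x \<oplus>\<^bsub>L i\<^esub> y)) (cl i z) = \<phi> (cl i x) (cl i z) + \<phi> (cl i y) (cl i z)"
      using b(1)[OF C] c assms(2) by simp
    show "\<phi> (cl i z) (cl i (x \<oplus>\<^bsub>L i\<^esub> y)) = \<phi> (cl i z) (cl i x) + \<phi> (cl i z) (cl i y)"
      using b(2)[OF C] c assms(2) by simp
  next
    fix c x y assume c: "x \<in> carrier (L i)" "y \<in> carrier (L i)"
    note C = c[THEN cl_closed[OF assms(2)]]
    show "\<phi> (cl i (c \<odot>\<^bsub>L i\<^esub> x)) (cl i y) = c * \<phi> (cl i x) (cl i y)"
      using b(3)[OF C C(2), of c] c assms(2) by simp
    show "\<phi> (cl i x) (cl i (c \<odot>\<^bsub>L i\<^esub> y)) = c * \<phi> (cl i x) (cl i y)"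
      using b(4)[OF C C(2), of c] c assms(2) by simp
  next
    fix p q x y assume c: "x \<in> homog (L i) p" "y \<in> homog (L i) q"
    note C = c[THEN cl_homog_closed[OF assms(2)]]
    show "\<phi> (cl i x) (cl i y) + ksign p q * \<phi> (cl i y) (cl i x) = 0"
      by (rule h(1)[OF C C(2)])
  next
    fix p q r x y z assume c: "x \<in> homog (L i) p" "y \<in> homog (L i) q" "z \<in> homog (L i) r"
    note C = c[THEN cl_homog_closed[OF assms(2)]]
    show "ksign p r * \<phi> (cl i x) (cl i (y \<otimes>\<^bsub>L i\<^esub> z)) + ksign q p * \<phi> (cl i y) (cl i (z \<otimes>\<^bsub>L i\<^esub> x))
        + ksign r q * \<phi> (cl i z) (cl i (x \<otimes>\<^bsub>L i\<^esub> y)) = 0"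
      using h(2)[OF C] c[THEN homogL_carrier[OF assms(2)]] assms(2) by simp
  qed
qed

lemma finite_stage:
  assumes "finite A" "A \<subseteq> carrier D"
  shows "\<exists>i\<ge>s. A \<subseteq> cl i ` carrier (L i)"
  using assms
proof (induction A rule: finite_induct)
  case empty
  then show ?case by auto
next
  case (insert X A)
  then obtain i where i: "i \<ge> s" "A \<subseteq> cl i ` carrier (L i)" by auto
  from insert obtain j x where j: "s \<le> j" "x \<in> carrier (L j)" "X = cl j x" unfolding D_carrier by auto
  let ?l = "max i j"
  have up: "cl m ` carrier (L m) \<subseteq> cl ?l ` carrier (L ?l)" if "s \<le> m" "m \<le> ?l" for m
  proof
    fix Z assume "Z \<in> cl m ` carrier (L m)"
    then obtain z where z: "z \<in> carrier (L m)" "Z = cl m z" by blast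
    then have "Z = cl ?l (tr m ?l z)" using cl_up[OF that z(1)] by simp
    then show "Z \<in> cl ?l ` carrier (L ?l)" using tr_closed[OF that z(1)] by blast
  qed
  have "X \<in> cl ?l ` carrier (L ?l)" using up[of j] j by auto
  moreover have "A \<subseteq> cl ?l ` carrier (L ?l)" using up[of i] i by auto
  ultimately show ?case using i by (intro exI[of _ ?l]) auto
qed

text \<open>An element \<open>t\<close> of the kernel of \<open>uce(D) \<rightarrow> D\<close> involves finitely many elements of \<open>D\<close>, which are
  represented at a stage \<open>i\<close>, and the sum of their brackets, being zero in \<open>D\<close>, is zero at some
  later stage \<open>l\<close>. On the image of \<open>L l\<close> in \<open>L (l + 1)\<close> the cocycle is the coboundary of some \<open>g\<close>,
  so its value on \<open>t\<close> is \<open>g\<close> applied to the sum of brackets.\<close>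

theorem limit_centrally_closed:
  assumes perf: "\<And>i x. s \<le> i \<Longrightarrow> x \<in> carrier (L i) \<Longrightarrow> f i x \<in> lspan (L (Suc i))
      {a \<otimes>\<^bsub>L (Suc i)\<^esub> b | a b. a \<in> carrier (L (Suc i)) \<and> b \<in> carrier (L (Suc i))}"
    and cob: "\<And>i \<phi>. s \<le> i \<Longrightarrow> super_cocycle (L (Suc i)) \<phi> \<Longrightarrow> \<exists>g.
      (\<forall>x\<in>carrier (L i). \<forall>y\<in>carrier (L i). g (x \<oplus>\<^bsub>L i\<^esub> y) = g x + g y) \<and>
      (\<forall>c. \<forall>x\<in>carrier (L i). g (c \<odot>\<^bsub>L i\<^esub> x) = c * g x) \<and>
      (\<forall>x\<in>carrier (L i). \<forall>y\<in>carrier (L i). \<phi> (f i x) (f i y) = g (x \<otimes>\<^bsub>L i\<^esub> y))"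
  shows "centrally_closed D"
proof (rule lie_superalgebra.centrally_closed_criterion[OF limit_lie])
  let ?B = "{X \<otimes>\<^bsub>D\<^esub> Y | X Y. X \<in> carrier D \<and> Y \<in> carrier D}"
  have B: "?B \<subseteq> carrier D" using lie_superalgebra.bracket_closed[OF limit_lie] by blast
  have "X \<in> lspan D ?B" if X: "X \<in> carrier D" for X
  proof -
    obtain i x where i: "s \<le> i" "x \<in> carrier (L i)" "X = cl i x" using X unfolding D_carrier by blast
    let ?j = "Suc i"
    let ?Bj = "{a \<otimes>\<^bsub>L ?j\<^esub> b | a b. a \<in> carrier (L ?j) \<and> b \<in> carrier (L ?j)}"
    have j: "s \<le> ?j" using i by simp
    have "?Bj \<subseteq> {z \<in> carrier (L ?j). cl ?j z \<in> lspan D ?B}"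
    proof
      fix z assume "z \<in> ?Bj"
      then obtain a b where ab: "a \<in> carrier (L ?j)" "b \<in> carrier (L ?j)" "z = a \<otimes>\<^bsub>L ?j\<^esub> b" by blast
      have "cl ?j z = cl ?j a \<otimes>\<^bsub>D\<^esub> cl ?j b" using ab j by simp
      then have "cl ?j z \<in> ?B" using ab cl_closed[OF j] by blast
      then show "z \<in> {z \<in> carrier (L ?j). cl ?j z \<in> lspan D ?B}"
        using lspan_superset[OF D_vspace B] ab lie_superalgebra.bracket_closed[OF lie[OF j]] by blast
    qed
    from lspan_minimal[OF Lv[OF j] lin_preimage_subspace[OF Lv[OF j] D_vspace cl_linear[OF j]
        lspan_subspace[OF D_vspace B]] this] perf[OF i(1,2)]
    have "cl ?j (f i x) \<in> lspan D ?B" by blast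
    then show ?thesis using cl_up[of i ?j x] i by simp
  qed
  then show "perfect D" unfolding perfect_def using lspan_carrier[OF D_vspace B] by blast
next
  fix \<phi> t
  assume phi: "super_cocycle D \<phi>" and t: "t \<in> carrier (free_space (carrier D \<times> carrier D))"
    and z: "free_eval D (\<lambda>s. fst s \<otimes>\<^bsub>D\<^esub> snd s) t = \<zero>\<^bsub>D\<^esub>"
  let ?K = "Poly_Mapping.keys t"
  have K: "fst ` ?K \<union> snd ` ?K \<subseteq> carrier D" using t by auto
  obtain i where i: "s \<le> i" "fst ` ?K \<union> snd ` ?K \<subseteq> cl i ` carrier (L i)"
    using finite_stage[OF _ K] by auto
  \<comment> \<open>a choice of representatives at stage \<open>i\<close>\<close>
  define r where "r = inv_into (carrier (L i)) (cl i)"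
  have r: "r X \<in> carrier (L i)" "cl i (r X) = X" if "X \<in> fst ` ?K \<union> snd ` ?K" for X
  proof -
    have "X \<in> cl i ` carrier (L i)" using i(2) that by (rule subsetD)
    then show "r X \<in> carrier (L i)" "cl i (r X) = X"
      unfolding r_def by (rule inv_into_into, rule f_inv_into_f)
  qed
  have rc: "r (fst q) \<in> carrier (L i)" "r (snd q) \<in> carrier (L i)"
    "cl i (r (fst q)) = fst q" "cl i (r (snd q)) = snd q" if "q \<in> ?K" for q
    using r[of "fst q"] r[of "snd q"] that by auto
  define b where "b q = r (fst q) \<otimes>\<^bsub>L i\<^esub> r (snd q)" for q
  have bc: "b q \<in> carrier (L i)" if "q \<in> ?K" for q
    unfolding b_def using rc[OF that] lie_superalgebra.bracket_closed[OF lie[OF i(1)]] by simp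
  \<comment> \<open>the sum of brackets, computed at stage \<open>i\<close>, where it need not vanish yet\<close>
  define w where "w = free_eval (L i) b t"
  have wc: "w \<in> carrier (L i)" unfolding w_def
    by (rule lin_closed[OF free_eval_linear[OF Lv[OF i(1)], of b ?K]]) (use bc in auto)
  have "cl i w = free_eval D (\<lambda>q. cl i (b q)) t"
    unfolding w_def by (rule lin_free_eval[OF Lv[OF i(1)] D_vspace cl_linear[OF i(1)]]) (use bc in auto)
  also have "\<dots> = \<zero>\<^bsub>D\<^esub>"
  proof -
    have eq: "cl i (b q) = fst q \<otimes>\<^bsub>D\<^esub> snd q" if "q \<in> ?K" for q
      using cl_mult[OF i(1) rc(1,2)[OF that]] rc(3,4)[OF that] unfolding b_def by simp
    interpret DD: vectorspace class_ring D by (rule D_vspace)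
    have "free_eval D (\<lambda>q. cl i (b q)) t = free_eval D (\<lambda>s. fst s \<otimes>\<^bsub>D\<^esub> snd s) t"
      unfolding free_eval_def
    proof (rule DD.M.finsum_cong')
      show "(\<lambda>q. Poly_Mapping.lookup t q \<odot>\<^bsub>D\<^esub> (fst q \<otimes>\<^bsub>D\<^esub> snd q)) \<in> ?K \<rightarrow> carrier D"
        using K by (auto intro!: vs_smult[OF D_vspace] lie_superalgebra.bracket_closed[OF limit_lie])
    qed (simp_all add: eq)
    then show ?thesis using z by simp
  qed
  finally have "cl i w = cl i \<zero>\<^bsub>L i\<^esub>" using cl_zero[OF i(1)] by simp
  then obtain l where l: "i \<le> l" "tr i l w = \<zero>\<^bsub>L l\<^esub>"
    using cl_eq_iff[OF i(1) wc i(1) vs_zero[OF Lv[OF i(1)]]] tr_zero[OF i(1)] by auto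
  have sl: "s \<le> l" "s \<le> Suc l" using i l by auto
  obtain g where g: "\<forall>x\<in>carrier (L l). \<forall>y\<in>carrier (L l). g (x \<oplus>\<^bsub>L l\<^esub> y) = g x + g y"
      "\<forall>c. \<forall>x\<in>carrier (L l). g (c \<odot>\<^bsub>L l\<^esub> x) = c * g x"
      "\<forall>x\<in>carrier (L l). \<forall>y\<in>carrier (L l). \<phi> (cl (Suc l) (f l x)) (cl (Suc l) (f l y)) = g (x \<otimes>\<^bsub>L l\<^esub> y)"
    using cob[OF sl(1) pullback_cocycle[OF phi sl(2)]] by blast
  have phig: "\<phi> (fst q) (snd q) = g (tr i l (b q))" if "q \<in> ?K" for q
  proof -
    have c: "tr i l (r (fst q)) \<in> carrier (L l)" "tr i l (r (snd q)) \<in> carrier (L l)"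
      using rc[OF that] tr_closed[OF i(1) l(1)] by auto
    have up: "cl (Suc l) (f l (tr i l x)) = cl i x" if "x \<in> carrier (L i)" for x
      using cl_up[of i "Suc l" x] that i l by simp
    have "\<phi> (fst q) (snd q) = g (tr i l (r (fst q)) \<otimes>\<^bsub>L l\<^esub> tr i l (r (snd q)))"
      using g(3)[rule_format, OF c] up rc[OF that] by simp
    then show ?thesis unfolding b_def using tr_mult[OF i(1) l(1)] rc[OF that] by simp
  qed
  have "(\<Sum>q\<in>?K. Poly_Mapping.lookup t q * \<phi> (fst q) (snd q)) = (\<Sum>q\<in>?K. Poly_Mapping.lookup t q * g (tr i l (b q)))"
    by (rule sum.cong) (simp_all add: phig)
  also have "\<dots> = g (free_eval (L l) (\<lambda>q. tr i l (b q)) t)"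
    by (rule functional_free_eval[OF Lv[OF sl(1)], symmetric])
      (use g bc tr_closed[OF i(1) l(1)] in auto)
  also have "free_eval (L l) (\<lambda>q. tr i l (b q)) t = tr i l w"
    unfolding w_def
    by (rule lin_free_eval[OF Lv[OF i(1)] Lv[OF sl(1)] tr_linear[OF i(1) l(1)], symmetric]) (use bc in auto)
  also have "g (tr i l w) = 0"
    using g(2)[rule_format, OF vs_zero[OF Lv[OF sl(1)]], of 0] vs_zero_smult[OF Lv[OF sl(1)] vs_zero[OF Lv[OF sl(1)]]] l(2)
    by simp
  finally show "(\<Sum>s\<in>?K. Poly_Mapping.lookup t s * \<phi> (fst s) (snd s)) = 0" .
qed

end

section \<open>Subalgebras of the general linear superalgebra\<close>

lemma bit_cases [case_names zero one]: "(p = (0 :: bit) \<Longrightarrow> P) \<Longrightarrow> (p = 1 \<Longrightarrow> P) \<Longrightarrow> P"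
  by (metis bit_not_zero_iff)

lemma ksign_commute: "ksign p q = ksign q p"
  by (auto simp: ksign_def)

lemma ksign_add_left: "ksign (p + q) r = (ksign p r * ksign q r :: 'k :: ring_1)"
  by (cases p rule: bit_cases; cases q rule: bit_cases; cases r rule: bit_cases) (simp_all add: ksign_def)

lemma ksign_add_right: "ksign r (p + q) = (ksign r p * ksign r q :: 'k :: ring_1)"
  using ksign_add_left[of p q r] by (simp only: ksign_commute[of r])

lemma ksign_square [simp]: "ksign p q * ksign p q = (1 :: 'k :: ring_1)"
  "ksign p q * (ksign p q * z) = (z :: 'k)"
  by (simp_all add: ksign_def)

lemma bit_add_self: "p + p = (0 :: bit)" "p + (p + q) = q"
  by (cases p rule: bit_cases; cases q rule: bit_cases; simp)+

context
  fixes m n :: nat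
begin

private abbreviation (input) "gd \<equiv> m + n"
private abbreviation (input) "gg \<equiv> coord_degree m"

lemma mat_component_entry:
  "x \<in> carrier_mat gd gd \<Longrightarrow> a < gd \<Longrightarrow> b < gd \<Longrightarrow>
    mat_component m p x $$ (a, b) = (if gg a + gg b = p then x $$ (a, b) else 0)"
  by (auto simp: mat_component_def)

lemma mat_component_carrier: "x \<in> carrier_mat gd gd \<Longrightarrow> mat_component m p x \<in> carrier_mat gd gd"
  by (auto simp: mat_component_def)

lemma mat_component_homog: "x \<in> carrier_mat gd gd \<Longrightarrow> mat_component m p x \<in> homog_mat m n p"
  unfolding homog_mat_def by (auto simp: mat_component_entry mat_component_carrier)

lemma mat_component_sum:
  assumes "x \<in> carrier_mat gd gd"
  shows "x = mat_component m 0 x + mat_component m 1 x"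
proof (rule eq_matI)
  show "dim_row x = dim_row (mat_component m 0 x + mat_component m 1 x)"
    "dim_col x = dim_col (mat_component m 0 x + mat_component m 1 x)"
    using mat_component_carrier[OF assms, of 1] assms by auto
  fix a b assume "a < dim_row (mat_component m 0 x + mat_component m 1 x)"
    "b < dim_col (mat_component m 0 x + mat_component m 1 x)"
  then have ab: "a < gd" "b < gd" using mat_component_carrier[OF assms, of 1] by auto
  then show "x $$ (a, b) = (mat_component m 0 x + mat_component m 1 x) $$ (a, b)"
    using mat_component_carrier[OF assms, of 1] assms
    by (cases "gg a + gg b" rule: bit_cases) (simp_all add: mat_component_entry)
qed

lemma homog_mat_carrier: "x \<in> homog_mat m n p \<Longrightarrow> x \<in> carrier_mat gd gd"
  by (simp add: homog_mat_def)

lemma homog_mat_entry: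
  "x \<in> homog_mat m n p \<Longrightarrow> a < gd \<Longrightarrow> b < gd \<Longrightarrow> gg a + gg b \<noteq> p \<Longrightarrow> x $$ (a, b) = 0"
  by (simp add: homog_mat_def)

text \<open>A homogeneous matrix has a nonzero entry at \<open>(a, b)\<close> only if its degree is the sum of the degrees of
  \<open>a\<close> and \<open>b\<close>. So the sign in the supercommutator can be read off from the coordinates, which gives
  one formula for all matrices, homogeneous or not.\<close>

lemma supercommutator_entry:
  fixes x y :: "'k :: field mat"
  assumes x: "x \<in> carrier_mat gd gd" and y: "y \<in> carrier_mat gd gd" and a: "a < gd" and b: "b < gd"
  shows "supercommutator m x y $$ (a, b) = (\<Sum>r<gd. x $$ (a, r) * y $$ (r, b)
    - ksign (gg a + gg r) (gg r + gg b) * y $$ (a, r) * x $$ (r, b))"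
proof -
  note cx = mat_component_carrier[OF x] and cy = mat_component_carrier[OF y]
  have prod: "(u * v) $$ (a, b) = (\<Sum>r<gd. u $$ (a, r) * v $$ (r, b))"
    if "u \<in> carrier_mat gd gd" "v \<in> carrier_mat gd gd" for u v :: "'k mat"
    using that a b by (auto simp: scalar_prod_def lessThan_atLeast0)
  have e: "supercommutator m x y $$ (a, b) =
    (\<Sum>r<gd. mat_component m 0 x $$ (a, r) * mat_component m 0 y $$ (r, b))
    - (\<Sum>r<gd. mat_component m 0 y $$ (a, r) * mat_component m 0 x $$ (r, b))
    + ((\<Sum>r<gd. mat_component m 0 x $$ (a, r) * mat_component m 1 y $$ (r, b))
    - (\<Sum>r<gd. mat_component m 1 y $$ (a, r) * mat_component m 0 x $$ (r, b)))
    + ((\<Sum>r<gd. mat_component m 1 x $$ (a, r) * mat_component m 0 y $$ (r, b))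
    - (\<Sum>r<gd. mat_component m 0 y $$ (a, r) * mat_component m 1 x $$ (r, b)))
    + ((\<Sum>r<gd. mat_component m 1 x $$ (a, r) * mat_component m 1 y $$ (r, b))
    + (\<Sum>r<gd. mat_component m 1 y $$ (a, r) * mat_component m 1 x $$ (r, b)))"
    using a b cx[of 0] cx[of 1] cy[of 0] cy[of 1]
    unfolding supercommutator_def Let_def
    by (simp add: prod del: index_mult_mat(1))
  show ?thesis
    unfolding e sum_subtractf[symmetric] sum.distrib[symmetric]
  proof (rule sum.cong[OF refl])
    fix r assume "r \<in> {..<gd}"
    then show "mat_component m 0 x $$ (a, r) * mat_component m 0 y $$ (r, b)
      - mat_component m 0 y $$ (a, r) * mat_component m 0 x $$ (r, b)
      + (mat_component m 0 x $$ (a, r) * mat_component m 1 y $$ (r, b)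
      - mat_component m 1 y $$ (a, r) * mat_component m 0 x $$ (r, b))
      + (mat_component m 1 x $$ (a, r) * mat_component m 0 y $$ (r, b)
      - mat_component m 0 y $$ (a, r) * mat_component m 1 x $$ (r, b))
      + (mat_component m 1 x $$ (a, r) * mat_component m 1 y $$ (r, b)
      + mat_component m 1 y $$ (a, r) * mat_component m 1 x $$ (r, b))
      = x $$ (a, r) * y $$ (r, b) - ksign (gg a + gg r) (gg r + gg b) * y $$ (a, r) * x $$ (r, b)"
      using a b x y
      by (cases "gg a" rule: bit_cases; cases "gg r" rule: bit_cases; cases "gg b" rule: bit_cases)
        (simp_all add: mat_component_entry)
  qed
qed

lemma supercommutator_carrier:
  "x \<in> carrier_mat gd gd \<Longrightarrow> y \<in> carrier_mat gd gd \<Longrightarrow> supercommutator m x y \<in> carrier_mat gd gd"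
  using mat_component_carrier[of x 0] mat_component_carrier[of x 1]
    mat_component_carrier[of y 0] mat_component_carrier[of y 1]
  unfolding supercommutator_def Let_def by auto

lemma supercommutator_homog:
  fixes x y :: "'k :: field mat"
  assumes x: "x \<in> homog_mat m n p" and y: "y \<in> homog_mat m n q"
  shows "supercommutator m x y = x * y + (- ksign p q) \<cdot>\<^sub>m (y * x)"
proof (rule eq_matI)
  note c = homog_mat_carrier[OF x] homog_mat_carrier[OF y]
  show "dim_row (supercommutator m x y) = dim_row (x * y + (- ksign p q) \<cdot>\<^sub>m (y * x))"
    "dim_col (supercommutator m x y) = dim_col (x * y + (- ksign p q) \<cdot>\<^sub>m (y * x))"
    using c supercommutator_carrier[OF c] by auto
  fix a b assume "a < dim_row (x * y + (- ksign p q) \<cdot>\<^sub>m (y * x))" "b < dim_col (x * y + (- ksign p q) \<cdot>\<^sub>m (y * x))"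
  then have ab: "a < gd" "b < gd" using c by auto
  have "supercommutator m x y $$ (a, b) = (\<Sum>r<gd. x $$ (a, r) * y $$ (r, b) - ksign p q * (y $$ (a, r) * x $$ (r, b)))"
    unfolding supercommutator_entry[OF c ab]
  proof (rule sum.cong[OF refl])
    fix r assume r: "r \<in> {..<gd}"
    show "x $$ (a, r) * y $$ (r, b) - ksign (gg a + gg r) (gg r + gg b) * y $$ (a, r) * x $$ (r, b)
      = x $$ (a, r) * y $$ (r, b) - ksign p q * (y $$ (a, r) * x $$ (r, b))"
    proof (cases "gg a + gg r = q \<and> gg r + gg b = p")
      case True
      then show ?thesis by (simp add: ksign_commute[of q p])
    next
      case False
      then have "y $$ (a, r) * x $$ (r, b) = 0"
        using homog_mat_entry[OF y ab(1)] homog_mat_entry[OF x _ ab(2)] r by auto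
      then show ?thesis by (simp add: mult.assoc)
    qed
  qed
  also have "\<dots> = (x * y + (- ksign p q) \<cdot>\<^sub>m (y * x)) $$ (a, b)"
    using c ab by (simp add: scalar_prod_def lessThan_atLeast0 sum_subtractf sum_distrib_left sum_negf)
  finally show "supercommutator m x y $$ (a, b) = (x * y + (- ksign p q) \<cdot>\<^sub>m (y * x)) $$ (a, b)" .
qed

lemma homog_mat_supercommutator:
  fixes x y :: "'k :: field mat"
  assumes x: "x \<in> homog_mat m n p" and y: "y \<in> homog_mat m n q"
  shows "supercommutator m x y \<in> homog_mat m n (p + q)"
  unfolding homog_mat_def
proof (intro CollectI conjI allI impI)
  note c = homog_mat_carrier[OF x] homog_mat_carrier[OF y]
  show "supercommutator m x y \<in> carrier_mat gd gd" by (rule supercommutator_carrier[OF c])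
  fix a b assume ab: "a < gd" "b < gd" and ne: "gg a + gg b \<noteq> p + q"
  have "x $$ (a, r) * y $$ (r, b) - ksign (gg a + gg r) (gg r + gg b) * y $$ (a, r) * x $$ (r, b) = 0"
    if r: "r < gd" for r
  proof -
    have "gg a + gg b = (gg a + gg r) + (gg r + gg b)"
      using bit_add_self(2)[of "gg r" "gg b"] by (simp only: add.assoc)
    then have "\<not> (gg a + gg r = p \<and> gg r + gg b = q)" "\<not> (gg a + gg r = q \<and> gg r + gg b = p)"
      using ne by (metis, metis add.commute)
    then have "x $$ (a, r) * y $$ (r, b) = 0" "y $$ (a, r) * x $$ (r, b) = 0"
      using homog_mat_entry[OF x ab(1) r] homog_mat_entry[OF x r ab(2)]
        homog_mat_entry[OF y ab(1) r] homog_mat_entry[OF y r ab(2)] by auto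
    then show ?thesis by (simp only: mult.assoc mult_zero_right diff_zero)
  qed
  then show "supercommutator m x y $$ (a, b) = 0"
    unfolding supercommutator_entry[OF c ab] by simp
qed

lemma jacobi_expand:
  fixes x y z :: "'k :: field mat"
  assumes "x \<in> carrier_mat d d" "y \<in> carrier_mat d d" "z \<in> carrier_mat d d" "a < d" "b < d"
  shows "(x * (y * z + c \<cdot>\<^sub>m (z * y)) + e \<cdot>\<^sub>m ((y * z + c \<cdot>\<^sub>m (z * y)) * x)) $$ (a, b)
    = (x * y * z) $$ (a, b) + c * (x * z * y) $$ (a, b) + e * (y * z * x) $$ (a, b) + e * c * (z * y * x) $$ (a, b)"
proof -
  have 1: "x * (y * z + c \<cdot>\<^sub>m (z * y)) = x * y * z + c \<cdot>\<^sub>m (x * z * y)"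
    using assms by (subst mult_add_distrib_mat[of _ d d _ d])
      (auto simp: mult_smult_distrib[of _ d d _ d] assoc_mult_mat[of _ d d _ d _ d])
  have 2: "(y * z + c \<cdot>\<^sub>m (z * y)) * x = y * z * x + c \<cdot>\<^sub>m (z * y * x)"
    using assms by (subst add_mult_distrib_mat[of _ d d _ _ d])
      (auto simp: mult_smult_assoc_mat[of _ d d _ d])
  have c: "x * y * z \<in> carrier_mat d d" "x * z * y \<in> carrier_mat d d" "y * z * x \<in> carrier_mat d d"
    "z * y * x \<in> carrier_mat d d" using assms by auto
  show ?thesis unfolding 1 2 using c assms by (simp del: index_mult_mat(1) add: distrib_left mult.assoc)
qed

text \<open>Each of the six products of \<open>x\<close>, \<open>y\<close>, \<open>z\<close> occurs twice, with opposite signs.\<close>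

lemma gl_jacobi:
  fixes x y z :: "'k :: field mat"
  assumes x: "x \<in> homog_mat m n p" and y: "y \<in> homog_mat m n q" and z: "z \<in> homog_mat m n r"
  shows "ksign p r \<cdot>\<^sub>m supercommutator m x (supercommutator m y z)
    + ksign q p \<cdot>\<^sub>m supercommutator m y (supercommutator m z x)
    + ksign r q \<cdot>\<^sub>m supercommutator m z (supercommutator m x y) = 0\<^sub>m gd gd" (is "?l = _")
proof (rule eq_matI)
  note c = x[THEN homog_mat_carrier] y[THEN homog_mat_carrier] z[THEN homog_mat_carrier]
  have e: "supercommutator m u (supercommutator m v w) $$ (a, b)
    = (u * v * w) $$ (a, b) - ksign s t * (u * w * v) $$ (a, b)
      - ksign o' s * ksign o' t * (v * w * u) $$ (a, b) + ksign o' s * ksign o' t * ksign s t * (w * v * u) $$ (a, b)"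
    if "u \<in> homog_mat m n o'" "v \<in> homog_mat m n s" "w \<in> homog_mat m n t" "a < gd" "b < gd"
    for u v w :: "'k mat" and o' s t a b
  proof -
    note cc = that(1-3)[THEN homog_mat_carrier]
    show ?thesis
      unfolding supercommutator_homog[OF that(1) homog_mat_supercommutator[OF that(2,3)]]
      unfolding supercommutator_homog[OF that(2,3)]
      unfolding jacobi_expand[OF cc that(4,5)] ksign_add_right by (simp add: algebra_simps del: index_mult_mat)
  qed
  have cl: "supercommutator m u (supercommutator m v w) \<in> carrier_mat gd gd"
    if "u \<in> carrier_mat gd gd" "v \<in> carrier_mat gd gd" "w \<in> carrier_mat gd gd" for u v w :: "'k mat"
    using that by (intro supercommutator_carrier)
  note C = cl[OF c] cl[OF c(2,3,1)] cl[OF c(3,1,2)]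
  show "dim_row ?l = dim_row (0\<^sub>m gd gd :: 'k mat)" "dim_col ?l = dim_col (0\<^sub>m gd gd :: 'k mat)"
    using C(3) by auto
  fix a b assume "a < dim_row (0\<^sub>m gd gd :: 'k mat)" "b < dim_col (0\<^sub>m gd gd :: 'k mat)"
  then have ab: "a < gd" "b < gd" by auto
  have "?l $$ (a, b) = ksign p r * supercommutator m x (supercommutator m y z) $$ (a, b)
    + ksign q p * supercommutator m y (supercommutator m z x) $$ (a, b)
    + ksign r q * supercommutator m z (supercommutator m x y) $$ (a, b)"
    using C ab by simp
  also have "\<dots> = 0"
    unfolding e[OF x y z ab] e[OF y z x ab] e[OF z x y ab]
    by (cases p rule: bit_cases; cases q rule: bit_cases; cases r rule: bit_cases) simp_all
  finally show "?l $$ (a, b) = 0\<^sub>m gd gd $$ (a, b)" using ab by simp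
qed

lemma gl_antisym:
  fixes x y :: "'k :: field mat"
  assumes x: "x \<in> homog_mat m n p" and y: "y \<in> homog_mat m n q"
  shows "supercommutator m x y + ksign p q \<cdot>\<^sub>m supercommutator m y x = 0\<^sub>m gd gd"
  unfolding supercommutator_homog[OF x y] supercommutator_homog[OF y x]
  by (rule eq_matI)
    (use homog_mat_carrier[OF x] homog_mat_carrier[OF y] in \<open>auto simp: ksign_commute[of q p] algebra_simps\<close>)

lemma supercommutator_add:
  fixes x y z :: "'k :: field mat"
  assumes "x \<in> carrier_mat gd gd" "y \<in> carrier_mat gd gd" "z \<in> carrier_mat gd gd"
  shows "supercommutator m (x + y) z = supercommutator m x z + supercommutator m y z"
    and "supercommutator m z (x + y) = supercommutator m z x + supercommutator m z y"
proof -
  have xy: "x + y \<in> carrier_mat gd gd" using assms by simp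
  note C = supercommutator_carrier[OF xy assms(3)] supercommutator_carrier[OF assms(3) xy]
    supercommutator_carrier[OF assms(1,3)] supercommutator_carrier[OF assms(2,3)]
    supercommutator_carrier[OF assms(3,1)] supercommutator_carrier[OF assms(3,2)]
  show "supercommutator m (x + y) z = supercommutator m x z + supercommutator m y z"
    by (rule eq_matI) (use C assms in \<open>auto simp: supercommutator_entry xy sum.distrib[symmetric]
      algebra_simps intro!: sum.cong\<close>)
  show "supercommutator m z (x + y) = supercommutator m z x + supercommutator m z y"
    by (rule eq_matI) (use C assms in \<open>auto simp: supercommutator_entry xy sum.distrib[symmetric]
      algebra_simps intro!: sum.cong\<close>)
qed

lemma supercommutator_smult:
  fixes x y :: "'k :: field mat"
  assumes "x \<in> carrier_mat gd gd" "y \<in> carrier_mat gd gd"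
  shows "supercommutator m (c \<cdot>\<^sub>m x) y = c \<cdot>\<^sub>m supercommutator m x y"
    and "supercommutator m x (c \<cdot>\<^sub>m y) = c \<cdot>\<^sub>m supercommutator m x y"
proof -
  have sc: "c \<cdot>\<^sub>m x \<in> carrier_mat gd gd" "c \<cdot>\<^sub>m y \<in> carrier_mat gd gd" using assms by auto
  note C = supercommutator_carrier[OF sc(1) assms(2)] supercommutator_carrier[OF assms(1) sc(2)]
    supercommutator_carrier[OF assms]
  show "supercommutator m (c \<cdot>\<^sub>m x) y = c \<cdot>\<^sub>m supercommutator m x y"
    by (rule eq_matI) (use C assms in \<open>auto simp: supercommutator_entry sc sum_distrib_left
      algebra_simps intro!: sum.cong\<close>)
  show "supercommutator m x (c \<cdot>\<^sub>m y) = c \<cdot>\<^sub>m supercommutator m x y"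
    by (rule eq_matI) (use C assms in \<open>auto simp: supercommutator_entry sc sum_distrib_left
      algebra_simps intro!: sum.cong\<close>)
qed

lemma gl_simps [simp]:
  "carrier (gl m n) = carrier_mat gd gd" "mult (gl m n) = supercommutator m"
  "add (gl m n) = (+)" "smult (gl m n) = (\<cdot>\<^sub>m)" "zero (gl m n) = 0\<^sub>m gd gd"
  "homog (gl m n) = homog_mat m n"
  by (simp_all add: gl_def)

end

lemma subsuperalgebra_simps [simp]:
  "carrier (subsuperalgebra L S) = S" "mult (subsuperalgebra L S) = mult L"
  "add (subsuperalgebra L S) = add L" "smult (subsuperalgebra L S) = smult L"
  "zero (subsuperalgebra L S) = zero L" "homog (subsuperalgebra L S) p = homog L p \<inter> S"
  by (simp_all add: subsuperalgebra_def)

lemma subsuperalgebra_twice: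
  "S' \<subseteq> S \<Longrightarrow> subsuperalgebra (subsuperalgebra L S) S' = subsuperalgebra L S'"
  unfolding subsuperalgebra_def by (auto intro!: superalgebra.equality ext)

text \<open>The sets of matrices that are sub-Lie-superalgebras of \<open>gl(m,n)\<close>; as \<open>S\<close> contains the
  homogeneous components of its elements, closure under the product may be checked on
  homogeneous elements.\<close>

locale matrix_superalgebra =
  fixes m n :: nat and S :: "'k :: field_char_0 mat set"
  assumes S_carrier: "x \<in> S \<Longrightarrow> x \<in> carrier_mat (m + n) (m + n)"
    and S_zero: "0\<^sub>m (m + n) (m + n) \<in> S"
    and S_add: "x \<in> S \<Longrightarrow> y \<in> S \<Longrightarrow> x + y \<in> S"
    and S_smult: "x \<in> S \<Longrightarrow> c \<cdot>\<^sub>m x \<in> S"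
    and S_component: "x \<in> S \<Longrightarrow> mat_component m p x \<in> S"
    and S_bracket_homog: "x \<in> S \<Longrightarrow> y \<in> S \<Longrightarrow> x \<in> homog_mat m n p \<Longrightarrow> y \<in> homog_mat m n q \<Longrightarrow> supercommutator m x y \<in> S"
begin

abbreviation "G \<equiv> subsuperalgebra (gl m n) S"

lemma S_bracket:
  assumes "x \<in> S" "y \<in> S"
  shows "supercommutator m x y \<in> S"
proof -
  let ?c = "mat_component m"
  note cx = S_carrier[OF assms(1)] and cy = S_carrier[OF assms(2)]
  note C = mat_component_carrier[of _ m n]
  have "supercommutator m x y = supercommutator m (?c 0 x + ?c 1 x) (?c 0 y + ?c 1 y)"
    using mat_component_sum[OF cx] mat_component_sum[OF cy] by simp
  also have "\<dots> = supercommutator m (?c 0 x) (?c 0 y) + supercommutator m (?c 1 x) (?c 0 y)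
    + (supercommutator m (?c 0 x) (?c 1 y) + supercommutator m (?c 1 x) (?c 1 y))"
    using C[OF cx, of 0] C[OF cx, of 1] C[OF cy, of 0] C[OF cy, of 1]
    by (simp add: supercommutator_add[where n = n])
  also have "\<dots> \<in> S"
    by (intro S_add S_bracket_homog[OF _ _ mat_component_homog[OF cx] mat_component_homog[OF cy]]
        S_component assms)
  finally show ?thesis .
qed

lemma G_vspace: "vspace G"
proof (rule vspaceI, goal_cases)
  case (4 x y)
  then show ?case using comm_add_mat[OF S_carrier[of x] S_carrier[of y]] by simp
next
  case (5 x y z)
  then show ?case using assoc_add_mat[OF S_carrier[of x] S_carrier[of y] S_carrier[of z]] by simp
next
  case (6 x)
  then show ?case using S_carrier[of x] by (intro eq_matI) auto
next
  case (7 x)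
  then show ?case using S_carrier[of x] by (intro eq_matI) auto
next
  case (8 a b x)
  then show ?case using S_carrier[of x] by (intro eq_matI) auto
next
  case (9 x)
  then show ?case using S_carrier[of x] by (intro eq_matI) auto
next
  case (10 a b x)
  then show ?case using S_carrier[of x] by (intro eq_matI) (auto simp: algebra_simps)
next
  case (11 a x y)
  then show ?case using S_carrier[of x] S_carrier[of y] by (intro eq_matI) (auto simp: algebra_simps)
qed (simp_all add: S_zero S_add S_smult)

theorem G_lie: "lie_superalgebra G"
proof (rule lie_superalgebra.intro[OF G_vspace], rule lie_superalgebra_axioms.intro, goal_cases)
  case (1 p)
  show ?case unfolding subspace_iff[OF G_vspace]
    using S_carrier by (auto simp: homog_mat_def S_zero S_add S_smult dest!: S_carrier)
next
  case 2
  show ?case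
  proof (intro equalityI subsetI)
    fix x assume "x \<in> carrier G"
    then have x: "x \<in> S" by simp
    have "x = mat_component m 0 x \<oplus>\<^bsub>G\<^esub> mat_component m 1 x"
      using mat_component_sum[OF S_carrier[OF x]] by simp
    moreover have "mat_component m p x \<in> homog G p" for p
      using x by (simp add: S_component mat_component_homog S_carrier)
    ultimately show "x \<in> homog G 0 <+>\<^bsub>G\<^esub> homog G 1" unfolding set_add_def' by blast
  next
    fix x assume "x \<in> homog G 0 <+>\<^bsub>G\<^esub> homog G 1"
    then show "x \<in> carrier G" unfolding set_add_def' by (auto intro: S_add)
  qed
next
  case 3
  have "x = 0\<^sub>m (m + n) (m + n)" if "x \<in> homog_mat m n 0" "x \<in> homog_mat m n 1" for x :: "'k mat"
  proof (rule eq_matI)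
    fix a b assume "a < dim_row (0\<^sub>m (m + n) (m + n) :: 'k mat)" "b < dim_col (0\<^sub>m (m + n) (m + n) :: 'k mat)"
    then show "x $$ (a, b) = 0\<^sub>m (m + n) (m + n) $$ (a, b)"
      using homog_mat_entry[OF that(1), of a b] homog_mat_entry[OF that(2), of a b] by force
  qed (use homog_mat_carrier[OF that(1)] in auto)
  moreover have "0\<^sub>m (m + n) (m + n) \<in> homog_mat m n p" for p by (simp add: homog_mat_def)
  ultimately show ?case using S_zero by auto
next
  case (4 x y)
  then show ?case by (simp add: S_bracket)
next
  case (5 x y z)
  then show ?case using S_carrier by (simp add: supercommutator_add[where n = n])
next
  case (6 x y z)
  then show ?case using S_carrier by (simp add: supercommutator_add[where n = n])
next
  case (7 x y c)
  then show ?case using S_carrier by (simp add: supercommutator_smult[where n = n])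
next
  case (8 x y c)
  then show ?case using S_carrier by (simp add: supercommutator_smult[where n = n])
next
  case (9 x p y q)
  then have "x \<in> S" "y \<in> S" "x \<in> homog_mat m n p" "y \<in> homog_mat m n q" by auto
  then show ?case using homog_mat_supercommutator[of x m n p y q] S_bracket[of x y]
    unfolding subsuperalgebra_simps gl_simps by blast
next
  case (10 x p y q)
  then show ?case using gl_antisym[of x m n p y q] by simp
next
  case (11 x p y q z r)
  then show ?case using gl_jacobi[of x m n p y q z r] by simp
qed

end

section \<open>Cocycles are coboundaries one step later\<close>

text \<open>The cocycle identity, solved for its first term: \<open>y\<close> acts on \<open>c \<otimes> e\<close> as a superderivation.\<close>

lemma (in lie_superalgebra) cocycle_derivation:
  assumes coc: "super_cocycle L \<phi>" and h: "y \<in> homog L s" "c \<in> homog L p" "e \<in> homog L q"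
  shows "\<phi> y (c \<otimes>\<^bsub>L\<^esub> e) = \<phi> (y \<otimes>\<^bsub>L\<^esub> c) e + ksign s p * \<phi> c (y \<otimes>\<^bsub>L\<^esub> e)"
proof -
  note cc = h[THEN homog_carrier]
  have sm: "\<phi> x (r \<odot>\<^bsub>L\<^esub> z) = r * \<phi> x z" if "x \<in> carrier L" "z \<in> carrier L" for x z r
    using coc that unfolding super_cocycle_def by blast
  have ad: "\<phi> x (u \<oplus>\<^bsub>L\<^esub> v) = \<phi> x u + \<phi> x v" if "x \<in> carrier L" "u \<in> carrier L" "v \<in> carrier L" for x u v
    using coc that unfolding super_cocycle_def by blast
  have an: "\<phi> x z + ksign a b * \<phi> z x = 0" if "x \<in> homog L a" "z \<in> homog L b" for x z a b
    using coc that unfolding super_cocycle_def by blast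
  have ja: "ksign s q * \<phi> y (c \<otimes>\<^bsub>L\<^esub> e) + ksign p s * \<phi> c (e \<otimes>\<^bsub>L\<^esub> y) + ksign q p * \<phi> e (y \<otimes>\<^bsub>L\<^esub> c) = 0"
    using coc h unfolding super_cocycle_def by blast
  have ey: "\<phi> c (e \<otimes>\<^bsub>L\<^esub> y) + ksign q s * \<phi> c (y \<otimes>\<^bsub>L\<^esub> e) = 0"
  proof -
    have "\<phi> c ((e \<otimes>\<^bsub>L\<^esub> y) \<oplus>\<^bsub>L\<^esub> (ksign q s \<odot>\<^bsub>L\<^esub> (y \<otimes>\<^bsub>L\<^esub> e))) = \<phi> c \<zero>\<^bsub>L\<^esub>"
      using bracket_antisym[OF h(3,1)] by simp
    moreover have "\<phi> c \<zero>\<^bsub>L\<^esub> = 0"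
      using sm[OF cc(2) vs_zero[OF L_vspace], of 0] vs_zero_smult[OF L_vspace vs_zero[OF L_vspace]] by simp
    ultimately show ?thesis using cc by (simp add: ad sm bracket_closed vs_smult[OF L_vspace])
  qed
  have ye: "\<phi> e (y \<otimes>\<^bsub>L\<^esub> c) + ksign q (s + p) * \<phi> (y \<otimes>\<^bsub>L\<^esub> c) e = 0"
    by (rule an[OF h(3) bracket_graded[OF h(1,2)]])
  have 1: "\<phi> c (e \<otimes>\<^bsub>L\<^esub> y) = - (ksign q s * \<phi> c (y \<otimes>\<^bsub>L\<^esub> e))" using ey by (simp add: eq_neg_iff_add_eq_0)
  have 2: "\<phi> e (y \<otimes>\<^bsub>L\<^esub> c) = - (ksign q s * ksign q p * \<phi> (y \<otimes>\<^bsub>L\<^esub> c) e)"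
    using ye[unfolded ksign_add_right] by (simp add: eq_neg_iff_add_eq_0)
  have "ksign s q * \<phi> y (c \<otimes>\<^bsub>L\<^esub> e)
    = ksign p s * (ksign q s * \<phi> c (y \<otimes>\<^bsub>L\<^esub> e)) + ksign q p * (ksign q s * ksign q p * \<phi> (y \<otimes>\<^bsub>L\<^esub> c) e)"
    using ja unfolding 1 2 by (simp add: algebra_simps)
  then have "ksign s q * (ksign s q * \<phi> y (c \<otimes>\<^bsub>L\<^esub> e))
    = ksign s q * (ksign p s * (ksign q s * \<phi> c (y \<otimes>\<^bsub>L\<^esub> e)) + ksign q p * (ksign q s * ksign q p * \<phi> (y \<otimes>\<^bsub>L\<^esub> c) e))"
    by simp
  then show ?thesis
    by (cases s rule: bit_cases; cases p rule: bit_cases; cases q rule: bit_cases) simp_all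
qed

text \<open>Matrices of all sizes share one type, which therefore has no zero; the dimension has to be given
  for the empty sum.\<close>

definition mat_sum :: "nat \<Rightarrow> ('i \<Rightarrow> 'k :: field mat) \<Rightarrow> 'i set \<Rightarrow> 'k mat" where
  "mat_sum d F A = mat d d (\<lambda>(a, b). \<Sum>p\<in>A. F p $$ (a, b))"

definition supported :: "nat set \<Rightarrow> 'k :: field mat \<Rightarrow> bool" where
  "supported I x \<longleftrightarrow> (\<forall>a<dim_row x. \<forall>b<dim_col x. x $$ (a, b) \<noteq> 0 \<longrightarrow> a \<in> I \<and> b \<in> I)"

context matrix_superalgebra
begin

abbreviation (input) "dm \<equiv> m + n"
abbreviation (input) "dg \<equiv> coord_degree m"

lemma mat_sum_induct:
  assumes "finite A" "\<And>p. p \<in> A \<Longrightarrow> F p \<in> S"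
    and add: "\<And>x y. x \<in> S \<Longrightarrow> y \<in> S \<Longrightarrow> g (x + y) = g x + (g y :: 'k)"
    and zero: "g (0\<^sub>m dm dm) = 0"
  shows "mat_sum dm F A \<in> S \<and> g (mat_sum dm F A) = (\<Sum>p\<in>A. g (F p))"
  using assms(1,2)
proof (induction A rule: finite_induct)
  case empty
  have "mat_sum dm F {} = 0\<^sub>m dm dm" by (rule eq_matI) (auto simp: mat_sum_def)
  then show ?case using S_zero zero by simp
next
  case (insert p A)
  have "mat_sum dm F (insert p A) = F p + mat_sum dm F A"
    using insert S_carrier[of "F p"] by (intro eq_matI) (auto simp: mat_sum_def)
  then show ?case using insert by (simp add: S_add add)
qed

lemma S_smult_entry: "z \<in> S \<Longrightarrow> a < dm \<Longrightarrow> b < dm \<Longrightarrow> (r \<cdot>\<^sub>m z) $$ (a, b) = r * z $$ (a, b)"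
  using S_carrier[of z] by simp

lemma component_supported: "x \<in> S \<Longrightarrow> supported I x \<Longrightarrow> supported I (mat_component m p x)"
  unfolding supported_def mat_component_def by (auto split: if_splits)

end

text \<open>An equivariant section of the product: for the matrices \<open>x\<close> of \<open>S\<close> that are supported on
  the coordinates in \<open>I\<close>, the tensor \<open>\<Sum> x\<^bsub>p q\<^esub> c p \<otimes> e q\<close> is mapped to \<open>\<lambda> x\<close> by the product, and
  the \<open>c p\<close> and \<open>e q\<close> transform under such matrices like the columns and rows of a matrix. The
  coordinate \<open>w\<close> enters only through its degree.\<close>

locale equivariant_section = matrix_superalgebra m n S
  for m n :: nat and S :: "'k :: field_char_0 mat set" +
  fixes I :: "nat set" and w :: nat and c e :: "nat \<Rightarrow> 'k mat" and lam :: 'k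
  assumes I: "I \<subseteq> {..<m + n}"
    and c: "p \<in> I \<Longrightarrow> c p \<in> S" "p \<in> I \<Longrightarrow> c p \<in> homog_mat m n (coord_degree m p + coord_degree m w)"
    and e: "q \<in> I \<Longrightarrow> e q \<in> S" "q \<in> I \<Longrightarrow> e q \<in> homog_mat m n (coord_degree m w + coord_degree m q)"
    and yc: "y \<in> S \<Longrightarrow> supported I y \<Longrightarrow> p \<in> I \<Longrightarrow> a < m + n \<Longrightarrow> b < m + n
      \<Longrightarrow> supercommutator m y (c p) $$ (a, b) = (\<Sum>r\<in>I. y $$ (r, p) * c r $$ (a, b))"
    and ye: "y \<in> S \<Longrightarrow> supported I y \<Longrightarrow> q \<in> I \<Longrightarrow> a < m + n \<Longrightarrow> b < m + n
      \<Longrightarrow> supercommutator m y (e q) $$ (a, b) = - (\<Sum>r\<in>I.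
        ksign (coord_degree m q + coord_degree m r) (coord_degree m w + coord_degree m q) * y $$ (q, r) * e r $$ (a, b))"
    and section_eq: "x \<in> S \<Longrightarrow> supported I x \<Longrightarrow> a < m + n \<Longrightarrow> b < m + n
      \<Longrightarrow> (\<Sum>p\<in>I. \<Sum>q\<in>I. x $$ (p, q) * supercommutator m (c p) (e q) $$ (a, b)) = lam * x $$ (a, b)"
    and lam: "lam \<noteq> 0"
begin

lemma finI: "finite I" using I finite_subset by blast

lemma section_sum:
  assumes x: "x \<in> S" "supported I x"
  shows "lam \<cdot>\<^sub>m x = mat_sum dm (\<lambda>(p, q). x $$ (p, q) \<cdot>\<^sub>m supercommutator m (c p) (e q)) (I \<times> I)"
proof (rule eq_matI)
  let ?F = "\<lambda>(p, q). x $$ (p, q) \<cdot>\<^sub>m supercommutator m (c p) (e q)"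
  fix a b assume "a < dim_row (mat_sum dm ?F (I \<times> I))" "b < dim_col (mat_sum dm ?F (I \<times> I))"
  then have ab: "a < dm" "b < dm" by (auto simp: mat_sum_def)
  have "mat_sum dm ?F (I \<times> I) $$ (a, b) = (\<Sum>(p, q)\<in>I \<times> I. x $$ (p, q) * supercommutator m (c p) (e q) $$ (a, b))"
    using ab by (auto simp: mat_sum_def S_smult_entry S_bracket c(1) e(1) intro!: sum.cong)
  also have "\<dots> = lam * x $$ (a, b)"
    using section_eq[OF x ab] by (simp add: sum.cartesian_product)
  finally show "(lam \<cdot>\<^sub>m x) $$ (a, b) = mat_sum dm ?F (I \<times> I) $$ (a, b)"
    using S_carrier[OF x(1)] ab by simp
qed (use S_carrier[OF x(1)] in \<open>auto simp: mat_sum_def\<close>)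

lemma span_mat_sum:
  assumes N: "VectorSpace.subspace class_ring N G" and A: "finite A" "\<And>p. p \<in> A \<Longrightarrow> F p \<in> N"
  shows "mat_sum dm F A \<in> N"
  using A
proof (induction A rule: finite_induct)
  case empty
  have "mat_sum dm F {} = 0\<^sub>m dm dm" by (rule eq_matI) (auto simp: mat_sum_def)
  then show ?case using N by (simp add: subspace_iff[OF G_vspace])
next
  case (insert p A)
  have "F p \<in> S" using N insert.prems by (auto simp: subspace_iff[OF G_vspace])
  then have "mat_sum dm F (insert p A) = F p + mat_sum dm F A"
    using insert S_carrier[of "F p"] by (intro eq_matI) (auto simp: mat_sum_def)
  then show ?case using insert N by (simp add: subspace_iff[OF G_vspace])
qed

theorem image_in_brackets:
  assumes x: "x \<in> S" "supported I x"
  shows "x \<in> lspan G {a \<otimes>\<^bsub>G\<^esub> b | a b. a \<in> carrier G \<and> b \<in> carrier G}" (is "_ \<in> lspan G ?B")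
proof -
  have B: "?B \<subseteq> carrier G" by (auto intro: S_bracket)
  note N = lspan_subspace[OF G_vspace B]
  have sm: "r \<cdot>\<^sub>m z \<in> lspan G ?B" if "z \<in> lspan G ?B" for r z
    using N that by (simp add: subspace_iff[OF G_vspace])
  have "lam \<cdot>\<^sub>m x \<in> lspan G ?B"
    unfolding section_sum[OF x]
  proof (rule span_mat_sum[OF N])
    show "finite (I \<times> I)" using finI by simp
    fix pq assume "pq \<in> I \<times> I"
    then obtain p q where pq: "pq = (p, q)" "p \<in> I" "q \<in> I" by blast
    have "supercommutator m (c p) (e q) = c p \<otimes>\<^bsub>G\<^esub> e q" by simp
    then have "supercommutator m (c p) (e q) \<in> ?B" using c(1)[OF pq(2)] e(1)[OF pq(3)] by auto
    then have "supercommutator m (c p) (e q) \<in> lspan G ?B" using lspan_superset[OF G_vspace B] by blast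
    then show "(case pq of (p, q) \<Rightarrow> x $$ (p, q) \<cdot>\<^sub>m supercommutator m (c p) (e q)) \<in> lspan G ?B"
      using sm pq by simp
  qed
  then have "inverse lam \<cdot>\<^sub>m (lam \<cdot>\<^sub>m x) \<in> lspan G ?B" by (rule sm)
  moreover have "inverse lam \<cdot>\<^sub>m (lam \<cdot>\<^sub>m x) = x" by (rule eq_matI) (use lam in auto)
  ultimately show ?thesis by simp
qed

text \<open>Contracting a cocycle with the section gives a linear functional \<open>g\<close>. The cocycle identity says
  that \<open>\<phi>(y, [c, e]) = \<phi>([y, c], e) \<plusminus> \<phi>(c, [y, e])\<close>, and by equivariance the sum of these terms over
  the tensor belonging to \<open>x\<close> is the contraction with the tensor belonging to \<open>[y, x]\<close>.\<close>

theorem cocycle_is_coboundary: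
  assumes coc: "super_cocycle G \<phi>"
  obtains g :: "'k mat \<Rightarrow> 'k" where
    "\<And>x y. x \<in> carrier_mat dm dm \<Longrightarrow> y \<in> carrier_mat dm dm \<Longrightarrow> g (x + y) = g x + g y"
    "\<And>r x. x \<in> carrier_mat dm dm \<Longrightarrow> g (r \<cdot>\<^sub>m x) = r * g x"
    "\<And>y x. y \<in> S \<Longrightarrow> supported I y \<Longrightarrow> x \<in> S \<Longrightarrow> supported I x \<Longrightarrow> \<phi> y x = g (supercommutator m y x)"
proof -
  interpret L: lie_superalgebra G by (rule G_lie)
  define B where "B p q = \<phi> (c p) (e q)" for p q
  define g where "g x = inverse lam * (\<Sum>p\<in>I. \<Sum>q\<in>I. x $$ (p, q) * B p q)" for x :: "'k mat"
  have lt: "p < dm" if "p \<in> I" for p using I that by auto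
  have g_add: "g (x + y) = g x + g y" if "x \<in> carrier_mat dm dm" "y \<in> carrier_mat dm dm" for x y
    using that lt by (simp add: g_def distrib_left[symmetric] sum.distrib[symmetric] distrib_right[symmetric])
  have g_smult: "g (r \<cdot>\<^sub>m x) = r * g x" if "x \<in> carrier_mat dm dm" for r x
    using that lt by (simp add: g_def sum_distrib_left mult.left_commute mult.assoc)
  have ad1: "\<phi> (x + y) z = \<phi> x z + \<phi> y z" and ad2: "\<phi> z (x + y) = \<phi> z x + \<phi> z y"
    if "x \<in> S" "y \<in> S" "z \<in> S" for x y z
    using coc that unfolding super_cocycle_def by simp_all
  have sm1: "\<phi> (r \<cdot>\<^sub>m x) y = r * \<phi> x y" and sm2: "\<phi> x (r \<cdot>\<^sub>m y) = r * \<phi> x y"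
    if "x \<in> S" "y \<in> S" for x y r
    using coc that unfolding super_cocycle_def by simp_all
  have z0: "0 \<cdot>\<^sub>m (0\<^sub>m dm dm) = (0\<^sub>m dm dm :: 'k mat)" by (rule eq_matI) auto
  have z1: "\<phi> (0\<^sub>m dm dm) y = 0" and z2: "\<phi> y (0\<^sub>m dm dm) = 0" if "y \<in> S" for y
    using sm1[OF S_zero that, of 0] sm2[OF that S_zero, of 0] by (simp_all add: z0)
  \<comment> \<open>the sign in the derivation rule depends on the degree of \<open>y\<close>\<close>
  have key: "\<phi> y x = g (supercommutator m y x)"
    if y: "y \<in> S" "supported I y" "y \<in> homog_mat m n s" and x: "x \<in> S" "supported I x" for x y s
  proof -
    have cy: "y \<in> carrier_mat dm dm" and cx: "x \<in> carrier_mat dm dm" using x y S_carrier by auto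
    have y0: "y $$ (a, b) = 0" if "a < dm" "b < dm" "a \<notin> I \<or> b \<notin> I" for a b
      using y(2) cy that unfolding supported_def by auto
    have x0: "x $$ (a, b) = 0" if "a < dm" "b < dm" "a \<notin> I \<or> b \<notin> I" for a b
      using x(2) cx that unfolding supported_def by auto
    have bc: "supercommutator m (c p) (e q) \<in> S" if "p \<in> I" "q \<in> I" for p q
      using c(1) e(1) that S_bracket by blast
    have yc': "supercommutator m y (c p) = mat_sum dm (\<lambda>r. y $$ (r, p) \<cdot>\<^sub>m c r) I" if p: "p \<in> I" for p
      by (rule eq_matI) (use p lt cy S_carrier[OF S_bracket[OF y(1) c(1)[OF p]]] in
          \<open>auto simp: mat_sum_def S_smult_entry c(1) yc[OF y(1,2)] intro!: sum.cong\<close>)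
    have ye': "supercommutator m y (e q) = mat_sum dm (\<lambda>r. (- (ksign (dg q + dg r) (dg w + dg q) * y $$ (q, r))) \<cdot>\<^sub>m e r) I"
      if q: "q \<in> I" for q
      by (rule eq_matI) (use q lt cy S_carrier[OF S_bracket[OF y(1) e(1)[OF q]]] in
          \<open>auto simp: mat_sum_def S_smult_entry e(1) ye[OF y(1,2)] sum_negf[symmetric] intro!: sum.cong\<close>)
    have 1: "\<phi> (supercommutator m y (c p)) (e q) = (\<Sum>r\<in>I. y $$ (r, p) * B r q)" if "p \<in> I" "q \<in> I" for p q
      using mat_sum_induct[OF finI, of "\<lambda>r. y $$ (r, p) \<cdot>\<^sub>m c r" "\<lambda>z. \<phi> z (e q)"] c(1) e(1) that
      by (simp add: yc' S_smult ad1 z1 sm1 B_def)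
    have 2: "\<phi> (c p) (supercommutator m y (e q))
      = - (\<Sum>r\<in>I. ksign (dg q + dg r) (dg w + dg q) * y $$ (q, r) * B p r)" if "p \<in> I" "q \<in> I" for p q
      using mat_sum_induct[OF finI, of "\<lambda>r. (- (ksign (dg q + dg r) (dg w + dg q) * y $$ (q, r))) \<cdot>\<^sub>m e r" "\<lambda>z. \<phi> (c p) z"]
        c(1) e(1) that
      by (simp add: ye' S_smult ad2 z2 sm2 B_def sum_negf)
    have 3: "\<phi> y (supercommutator m (c p) (e q)) = (\<Sum>r\<in>I. y $$ (r, p) * B r q)
      - (\<Sum>r\<in>I. ksign (dg q + dg r) (dg p + dg q) * y $$ (q, r) * B p r)" if p: "p \<in> I" and q: "q \<in> I" for p q
    proof -
      have "\<phi> y (c p \<otimes>\<^bsub>G\<^esub> e q) = \<phi> (y \<otimes>\<^bsub>G\<^esub> c p) (e q) + ksign s (dg p + dg w) * \<phi> (c p) (y \<otimes>\<^bsub>G\<^esub> e q)"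
        by (rule L.cocycle_derivation[OF coc, of y s "c p" "dg p + dg w" "e q" "dg w + dg q"])
          (unfold subsuperalgebra_simps gl_simps, (intro IntI c[OF p] e[OF q] y)+)
      then have "\<phi> y (supercommutator m (c p) (e q)) = (\<Sum>r\<in>I. y $$ (r, p) * B r q)
        - ksign s (dg p + dg w) * (\<Sum>r\<in>I. ksign (dg q + dg r) (dg w + dg q) * y $$ (q, r) * B p r)"
        by (simp add: 1[OF p q] 2[OF p q])
      \<comment> \<open>the degree of \<open>w\<close> occurs twice in the sign and cancels\<close>
      moreover have "ksign s (dg p + dg w) * (\<Sum>r\<in>I. ksign (dg q + dg r) (dg w + dg q) * y $$ (q, r) * B p r)
        = (\<Sum>r\<in>I. ksign (dg q + dg r) (dg p + dg q) * y $$ (q, r) * B p r)"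
        unfolding sum_distrib_left
      proof (rule sum.cong[OF refl])
        fix r assume r: "r \<in> I"
        show "ksign s (dg p + dg w) * (ksign (dg q + dg r) (dg w + dg q) * y $$ (q, r) * B p r)
          = ksign (dg q + dg r) (dg p + dg q) * y $$ (q, r) * B p r"
        proof (cases "dg q + dg r = s")
          case True
          have "ksign s (dg p + dg w) * ksign s (dg w + dg q) = (ksign s (dg p + dg q) :: 'k)"
            by (simp only: ksign_add_right mult.assoc ksign_square)
          then show ?thesis unfolding True by (simp only: mult.assoc[symmetric])
        next
          case False
          then have "y $$ (q, r) = 0" using homog_mat_entry[OF y(3) lt[OF q] lt[OF r]] by simp
          then show ?thesis by simp
        qed
      qed
      ultimately show ?thesis by simp
    qed
    have "lam * \<phi> y x = \<phi> y (lam \<cdot>\<^sub>m x)" using sm2[OF y(1) x(1)] by simp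
    also have "\<dots> = (\<Sum>pq\<in>I \<times> I. \<phi> y ((\<lambda>(p, q). x $$ (p, q) \<cdot>\<^sub>m supercommutator m (c p) (e q)) pq))"
      unfolding section_sum[OF x]
      using mat_sum_induct[of "I \<times> I" "\<lambda>(p, q). x $$ (p, q) \<cdot>\<^sub>m supercommutator m (c p) (e q)" "\<phi> y"]
        finI bc S_smult ad2[OF _ _ y(1)] z2[OF y(1)] by auto
    also have "\<dots> = (\<Sum>(p, q)\<in>I \<times> I. x $$ (p, q) * \<phi> y (supercommutator m (c p) (e q)))"
      by (rule sum.cong) (auto simp: sm2[OF y(1) bc])
    also have "\<dots> = (\<Sum>p\<in>I. \<Sum>q\<in>I. x $$ (p, q) * \<phi> y (supercommutator m (c p) (e q)))"
      by (simp add: sum.cartesian_product)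
    also have "\<dots> = (\<Sum>p\<in>I. \<Sum>q\<in>I. \<Sum>r\<in>I. x $$ (p, q) * (y $$ (r, p) * B r q))
      - (\<Sum>p\<in>I. \<Sum>q\<in>I. \<Sum>r\<in>I. x $$ (p, q) * (ksign (dg q + dg r) (dg p + dg q) * y $$ (q, r) * B p r))"
      unfolding sum_subtractf[symmetric]
      by (intro sum.cong refl) (simp add: 3 right_diff_distrib sum_distrib_left sum_subtractf)
    \<comment> \<open>renaming the indices such that \<open>B p q\<close> becomes a common factor\<close>
    also have "(\<Sum>p\<in>I. \<Sum>q\<in>I. \<Sum>r\<in>I. x $$ (p, q) * (y $$ (r, p) * B r q))
      = (\<Sum>r\<in>I. \<Sum>q\<in>I. \<Sum>p\<in>I. x $$ (p, q) * (y $$ (r, p) * B r q))"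
    proof -
      have "(\<Sum>p\<in>I. \<Sum>q\<in>I. \<Sum>r\<in>I. x $$ (p, q) * (y $$ (r, p) * B r q))
        = (\<Sum>p\<in>I. \<Sum>r\<in>I. \<Sum>q\<in>I. x $$ (p, q) * (y $$ (r, p) * B r q))"
        by (intro sum.cong refl sum.swap)
      also have "\<dots> = (\<Sum>r\<in>I. \<Sum>p\<in>I. \<Sum>q\<in>I. x $$ (p, q) * (y $$ (r, p) * B r q))" by (rule sum.swap)
      also have "\<dots> = (\<Sum>r\<in>I. \<Sum>q\<in>I. \<Sum>p\<in>I. x $$ (p, q) * (y $$ (r, p) * B r q))"
        by (intro sum.cong refl sum.swap)
      finally show ?thesis .
    qed
    also have "(\<Sum>p\<in>I. \<Sum>q\<in>I. \<Sum>r\<in>I. x $$ (p, q) * (ksign (dg q + dg r) (dg p + dg q) * y $$ (q, r) * B p r))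
      = (\<Sum>p\<in>I. \<Sum>r\<in>I. \<Sum>q\<in>I. x $$ (p, q) * (ksign (dg q + dg r) (dg p + dg q) * y $$ (q, r) * B p r))"
      by (intro sum.cong refl sum.swap)
    also have "(\<Sum>r\<in>I. \<Sum>q\<in>I. \<Sum>p\<in>I. x $$ (p, q) * (y $$ (r, p) * B r q))
      - (\<Sum>p\<in>I. \<Sum>r\<in>I. \<Sum>q\<in>I. x $$ (p, q) * (ksign (dg q + dg r) (dg p + dg q) * y $$ (q, r) * B p r))
      = (\<Sum>p\<in>I. \<Sum>q\<in>I. supercommutator m y x $$ (p, q) * B p q)"
      unfolding sum_subtractf[symmetric]
    proof (intro sum.cong refl)
      fix p q assume p: "p \<in> I" and q: "q \<in> I"
      have "supercommutator m y x $$ (p, q) = (\<Sum>r<dm. y $$ (p, r) * x $$ (r, q)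
        - ksign (dg p + dg r) (dg r + dg q) * x $$ (p, r) * y $$ (r, q))"
        by (rule supercommutator_entry[OF cy cx lt[OF p] lt[OF q]])
      also have "\<dots> = (\<Sum>r\<in>I. y $$ (p, r) * x $$ (r, q) - ksign (dg p + dg r) (dg r + dg q) * x $$ (p, r) * y $$ (r, q))"
        by (rule sum.mono_neutral_right) (use I p q lt x0 y0 in auto)
      finally have "supercommutator m y x $$ (p, q) * B p q
        = (\<Sum>r\<in>I. (y $$ (p, r) * x $$ (r, q) - ksign (dg p + dg r) (dg r + dg q) * x $$ (p, r) * y $$ (r, q)) * B p q)"
        by (simp only: sum_distrib_right)
      also have "\<dots> = (\<Sum>r\<in>I. x $$ (r, q) * (y $$ (p, r) * B p q)
        - x $$ (p, r) * (ksign (dg r + dg q) (dg p + dg r) * y $$ (r, q) * B p q))"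
        by (intro sum.cong refl) (subst ksign_commute, simp only: algebra_simps)
      finally show "(\<Sum>r\<in>I. x $$ (r, q) * (y $$ (p, r) * B p q)
        - x $$ (p, r) * (ksign (dg r + dg q) (dg p + dg r) * y $$ (r, q) * B p q))
        = supercommutator m y x $$ (p, q) * B p q" by (rule sym)
    qed
    finally have "lam * \<phi> y x = (\<Sum>p\<in>I. \<Sum>q\<in>I. supercommutator m y x $$ (p, q) * B p q)" .
    then show ?thesis using lam by (simp add: g_def field_simps)
  qed
  show thesis
  proof (rule that[of g])
    show "g (x + y) = g x + g y" if "x \<in> carrier_mat dm dm" "y \<in> carrier_mat dm dm" for x y
      using that by (rule g_add)
    show "g (r \<cdot>\<^sub>m x) = r * g x" if "x \<in> carrier_mat dm dm" for r x
      using that by (rule g_smult)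
    fix y x assume y: "y \<in> S" "supported I y" and x: "x \<in> S" "supported I x"
    \<comment> \<open>a general \<open>y\<close> is the sum of its homogeneous components\<close>
    let ?y = "\<lambda>p. mat_component m p y"
    have Y: "?y p \<in> S" "supported I (?y p)" "?y p \<in> homog_mat m n p" "?y p \<in> carrier_mat dm dm" for p
      using y S_component component_supported mat_component_homog[OF S_carrier] S_carrier by auto
    have eq: "y = ?y 0 + ?y 1" by (rule mat_component_sum[OF S_carrier[OF y(1)]])
    have "\<phi> y x = \<phi> (?y 0) x + \<phi> (?y 1) x" by (subst eq) (rule ad1[OF Y(1) Y(1) x(1)])
    also have "\<dots> = g (supercommutator m (?y 0) x) + g (supercommutator m (?y 1) x)"
      by (simp only: key[OF Y(1-3) x])
    also have "\<dots> = g (supercommutator m (?y 0) x + supercommutator m (?y 1) x)"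
      by (rule g_add[symmetric]) (rule S_carrier[OF S_bracket[OF Y(1) x(1)]])+
    also have "supercommutator m (?y 0) x + supercommutator m (?y 1) x = supercommutator m (?y 0 + ?y 1) x"
      by (rule supercommutator_add(1)[OF Y(4) Y(4) S_carrier[OF x(1)], symmetric])
    finally show "\<phi> y x = g (supercommutator m y x)" using eq by simp
  qed
qed

end

section \<open>Sections built from matrix units\<close>

text \<open>Matrix units as functions of the indices, to be combined with \<open>super_prod\<close> below.\<close>

definition mat_unit :: "nat \<Rightarrow> nat \<Rightarrow> nat \<Rightarrow> nat \<Rightarrow> 'k :: field" where
  "mat_unit i j a b = (if a = i \<and> b = j then 1 else 0)"

context
  fixes m n :: nat
begin

private abbreviation (input) "dm \<equiv> m + n"
private abbreviation (input) "dg \<equiv> coord_degree m"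

text \<open>The supercommutator on the level of entries, without conditions on carriers.\<close>

definition super_prod :: "(nat \<Rightarrow> nat \<Rightarrow> 'k :: field) \<Rightarrow> (nat \<Rightarrow> nat \<Rightarrow> 'k) \<Rightarrow> nat \<Rightarrow> nat \<Rightarrow> 'k" where
  "super_prod x y a b = (\<Sum>r<dm. x a r * y r b - ksign (dg a + dg r) (dg r + dg b) * y a r * x r b)"

lemma super_prod_add:
  "super_prod (\<lambda>a b. x a b + x' a b) y a b = super_prod x y a b + super_prod x' y a b"
  "super_prod y (\<lambda>a b. x a b + x' a b) a b = super_prod y x a b + super_prod y x' a b"
  unfolding super_prod_def sum.distrib[symmetric]
  by (intro sum.cong refl; simp add: algebra_simps)+

lemma supercommutator_super_prod:
  assumes "x \<in> carrier_mat dm dm" "y \<in> carrier_mat dm dm" "a < dm" "b < dm"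
    "\<And>a b. a < dm \<Longrightarrow> b < dm \<Longrightarrow> x $$ (a, b) = x' a b" "\<And>a b. a < dm \<Longrightarrow> b < dm \<Longrightarrow> y $$ (a, b) = y' a b"
  shows "supercommutator m x y $$ (a, b) = super_prod x' y' a b"
  unfolding supercommutator_entry[OF assms(1-4)] super_prod_def
  by (intro sum.cong refl) (simp add: assms)

lemma sum_mat_unit:
  assumes "i < dm" "j < dm"
  shows "(\<Sum>r<dm. f r * mat_unit i j r b) = (if b = j then f i else 0)"
    and "(\<Sum>r<dm. f r * mat_unit i j a r * h r) = (if a = i then f j * h j else (0 :: 'k :: field))"
proof -
  have "(\<Sum>r<dm. f r * mat_unit i j r b) = (\<Sum>r<dm. if r = i then (if b = j then f i else 0) else 0)"
    by (intro sum.cong) (auto simp: mat_unit_def)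
  then show "(\<Sum>r<dm. f r * mat_unit i j r b) = (if b = j then f i else 0)" using assms by simp
  have "(\<Sum>r<dm. f r * mat_unit i j a r * h r) = (\<Sum>r<dm. if r = j then (if a = i then f j * h j else 0) else 0)"
    by (intro sum.cong) (auto simp: mat_unit_def)
  then show "(\<Sum>r<dm. f r * mat_unit i j a r * h r) = (if a = i then f j * h j else 0)" using assms by simp
qed

lemma super_prod_mat_unit_right:
  assumes "i < dm" "j < dm"
  shows "super_prod y (mat_unit i j) a b = (if b = j then y a i else 0)
    - (if a = i then ksign (dg a + dg j) (dg j + dg b) * y j b else (0 :: 'k :: field))"
  unfolding super_prod_def sum_subtractf
  using sum_mat_unit(1)[OF assms, of "y a"] sum_mat_unit(2)[OF assms, of "\<lambda>r. ksign (dg a + dg r) (dg r + dg b)" a "\<lambda>r. y r b"]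
  by simp

lemma super_prod_mat_unit_left:
  assumes "i < dm" "j < dm"
  shows "super_prod (mat_unit i j) y a b = (if a = i then y j b else 0)
    - (if b = j then ksign (dg a + dg i) (dg i + dg b) * y a i else (0 :: 'k :: field))"
  unfolding super_prod_def sum_subtractf
  using sum_mat_unit(1)[OF assms, of "\<lambda>r. ksign (dg a + dg r) (dg r + dg b) * y a r" b]
    sum_mat_unit(2)[OF assms, of "\<lambda>r. 1" a "\<lambda>r. y r b"]
  by simp

definition supertrace :: "'k :: field mat \<Rightarrow> 'k" where
  "supertrace x = (\<Sum>p<dm. ksign (dg p) (dg p) * x $$ (p, p))"

lemma ksign_self_add: "ksign (p + q) (p + q) = (ksign p p * ksign q q :: 'k :: field)"
  by (cases p rule: bit_cases; cases q rule: bit_cases) simp_all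

text \<open>Exchanging the two summation indices turns the second half of the sum into the first.\<close>

lemma supertrace_supercommutator:
  assumes "x \<in> carrier_mat dm dm" "y \<in> carrier_mat dm dm"
  shows "supertrace (supercommutator m x y) = (0 :: 'k :: field)"
proof -
  have "supertrace (supercommutator m x y) = (\<Sum>a<dm. \<Sum>r<dm. ksign (dg a) (dg a) * (x $$ (a, r) * y $$ (r, a)))
    - (\<Sum>a<dm. \<Sum>r<dm. ksign (dg a) (dg a) * (ksign (dg a + dg r) (dg r + dg a) * (y $$ (a, r) * x $$ (r, a))))"
    unfolding supertrace_def sum_subtractf[symmetric]
    by (intro sum.cong refl)
      (simp add: supercommutator_entry[OF assms] sum_distrib_left right_diff_distrib mult.assoc)
  also have "(\<Sum>a<dm. \<Sum>r<dm. ksign (dg a) (dg a) * (ksign (dg a + dg r) (dg r + dg a) * (y $$ (a, r) * x $$ (r, a))))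
    = (\<Sum>r<dm. \<Sum>a<dm. ksign (dg r) (dg r) * (x $$ (r, a) * y $$ (a, r)))"
  proof (subst sum.swap, intro sum.cong refl)
    fix r a
    have "ksign (dg a) (dg a) * ksign (dg a + dg r) (dg r + dg a) = (ksign (dg r) (dg r) :: 'k)"
      unfolding add.commute[of "dg r" "dg a"] ksign_self_add by simp
    then show "ksign (dg a) (dg a) * (ksign (dg a + dg r) (dg r + dg a) * (y $$ (a, r) * x $$ (r, a)))
      = ksign (dg r) (dg r) * (x $$ (r, a) * y $$ (a, r))"
      by (simp only: mult.assoc[symmetric] mult.commute[of "y $$ (a, r)"])
  qed
  finally show ?thesis by simp
qed

end

text \<open>With \<open>w\<close> outside \<open>I\<close>, the choice \<open>c p = E\<^bsub>p w\<^esub>\<close>, \<open>e q = E\<^bsub>w q\<^esub>\<close> is an equivariant section for the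
  matrices of supertrace zero, as \<open>\<Sum> x\<^bsub>p q\<^esub> [E\<^bsub>p w\<^esub>, E\<^bsub>w q\<^esub>]\<close> differs from \<open>x\<close> by the supertrace of \<open>x\<close> times
  \<open>E\<^bsub>w w\<^esub>\<close>. When \<open>S\<close> is a proper subalgebra, correction terms \<open>T\<close> are needed to end up in \<open>S\<close>.\<close>

locale corrected_units = matrix_superalgebra m n S
  for m n :: nat and S :: "'k :: field_char_0 mat set" +
  fixes I :: "nat set" and w :: nat and T :: "nat \<Rightarrow> nat \<Rightarrow> nat \<Rightarrow> nat \<Rightarrow> 'k" and lam :: 'k
  assumes I: "I \<subseteq> {..<m + n}" and w: "w < m + n" "w \<notin> I" and lam: "lam \<noteq> 0"
    and supertrace0: "x \<in> S \<Longrightarrow> supertrace m n x = 0"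
    and T_homog: "\<lbrakk>i < m + n; j < m + n; a < m + n; b < m + n; T i j a b \<noteq> 0\<rbrakk>
      \<Longrightarrow> coord_degree m a + coord_degree m b = coord_degree m i + coord_degree m j"
    and D_in: "p \<in> I \<Longrightarrow> mat (m + n) (m + n) (\<lambda>(a, b). mat_unit p w a b + T p w a b) \<in> S"
      "p \<in> I \<Longrightarrow> mat (m + n) (m + n) (\<lambda>(a, b). mat_unit w p a b + T w p a b) \<in> S"
    and T_c: "\<lbrakk>y \<in> S; supported I y; p \<in> I; a < m + n; b < m + n\<rbrakk> \<Longrightarrow>
      super_prod m n (\<lambda>a b. y $$ (a, b)) (T p w) a b = (\<Sum>r\<in>I. y $$ (r, p) * T r w a b)"
    and T_e: "\<lbrakk>y \<in> S; supported I y; q \<in> I; a < m + n; b < m + n\<rbrakk> \<Longrightarrow>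
      super_prod m n (\<lambda>a b. y $$ (a, b)) (T w q) a b = - (\<Sum>r\<in>I.
        ksign (coord_degree m q + coord_degree m r) (coord_degree m w + coord_degree m q) * y $$ (q, r) * T w r a b)"
    and T_section: "\<lbrakk>x \<in> S; supported I x; a < m + n; b < m + n\<rbrakk> \<Longrightarrow>
      (\<Sum>p\<in>I. \<Sum>q\<in>I. x $$ (p, q) * (super_prod m n (mat_unit p w) (T w q) a b
        + super_prod m n (T p w) (mat_unit w q) a b + super_prod m n (T p w) (T w q) a b)) = (lam - 1) * x $$ (a, b)"
begin

definition D :: "nat \<Rightarrow> nat \<Rightarrow> 'k mat" where
  "D i j = mat dm dm (\<lambda>(a, b). mat_unit i j a b + T i j a b)"

lemma D_carrier: "D i j \<in> carrier_mat dm dm"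
  by (simp add: D_def)

lemma D_entry: "a < dm \<Longrightarrow> b < dm \<Longrightarrow> D i j $$ (a, b) = mat_unit i j a b + T i j a b"
  by (simp add: D_def)

lemma I_less: "p \<in> I \<Longrightarrow> p < dm"
  using I by auto

lemma fin: "finite I"
  using I finite_subset by blast

lemma D_homog: "i < dm \<Longrightarrow> j < dm \<Longrightarrow> D i j \<in> homog_mat m n (dg i + dg j)"
  unfolding homog_mat_def
proof (intro CollectI conjI allI impI D_carrier)
  fix a b assume ij: "i < dm" "j < dm" and ab: "a < dm" "b < dm" and ne: "dg a + dg b \<noteq> dg i + dg j"
  then have "T i j a b = 0" "mat_unit i j a b = (0 :: 'k)" using T_homog by (auto simp: mat_unit_def)
  then show "D i j $$ (a, b) = 0" by (simp add: D_entry ab)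
qed

lemma outside:
  assumes "x \<in> S" "supported I x" "a < dm" "b < dm" "a \<notin> I \<or> b \<notin> I"
  shows "x $$ (a, b) = 0"
  using assms S_carrier[OF assms(1)] unfolding supported_def by auto

lemma unit_c:
  assumes y: "y \<in> S" "supported I y" and p: "p \<in> I" and ab: "a < dm" "b < dm"
  shows "super_prod m n (\<lambda>a b. y $$ (a, b)) (mat_unit p w) a b = (\<Sum>r\<in>I. y $$ (r, p) * mat_unit r w a b)"
proof -
  have "(\<Sum>r\<in>I. y $$ (r, p) * mat_unit r w a b) = (\<Sum>r\<in>I. if r = a then (if b = w then y $$ (a, p) else 0) else 0)"
    by (intro sum.cong refl) (auto simp: mat_unit_def)
  also have "\<dots> = (if b = w then y $$ (a, p) else 0)"
    using fin outside[OF y ab(1) I_less[OF p]] by simp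
  finally show ?thesis
    using outside[OF y w(1) ab(2)] w(2) by (simp add: super_prod_mat_unit_right[OF I_less[OF p] w(1)])
qed

lemma unit_e:
  assumes y: "y \<in> S" "supported I y" and q: "q \<in> I" and ab: "a < dm" "b < dm"
  shows "super_prod m n (\<lambda>a b. y $$ (a, b)) (mat_unit w q) a b
    = - (\<Sum>r\<in>I. ksign (dg q + dg r) (dg w + dg q) * y $$ (q, r) * mat_unit w r a b)"
proof -
  have "(\<Sum>r\<in>I. ksign (dg q + dg r) (dg w + dg q) * y $$ (q, r) * mat_unit w r a b)
    = (\<Sum>r\<in>I. if r = b then (if a = w then ksign (dg q + dg b) (dg w + dg q) * y $$ (q, b) else 0) else 0)"
    by (intro sum.cong refl) (auto simp: mat_unit_def)
  also have "\<dots> = (if a = w then ksign (dg q + dg b) (dg w + dg q) * y $$ (q, b) else 0)"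
    using fin outside[OF y I_less[OF q] ab(2)] by simp
  finally have rhs: "(\<Sum>r\<in>I. ksign (dg q + dg r) (dg w + dg q) * y $$ (q, r) * mat_unit w r a b)
    = (if a = w then ksign (dg q + dg b) (dg w + dg q) * y $$ (q, b) else 0)" .
  show ?thesis
    unfolding rhs super_prod_mat_unit_right[OF w(1) I_less[OF q]] ksign_commute[of "dg q + dg b"]
    using outside[OF y ab(1) w(1)] w(2) by (cases "a = w") (simp_all del: add_bit_eq_xor)
qed

lemma unit_section:
  assumes x: "x \<in> S" "supported I x" and ab: "a < dm" "b < dm"
  shows "(\<Sum>p\<in>I. \<Sum>q\<in>I. x $$ (p, q) * super_prod m n (mat_unit p w) (mat_unit w q) a b) = x $$ (a, b)"
proof -
  have "(\<Sum>p\<in>I. \<Sum>q\<in>I. x $$ (p, q) * super_prod m n (mat_unit p w) (mat_unit w q) a b)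
    = (\<Sum>p\<in>I. \<Sum>q\<in>I. (if q = b then (if p = a then x $$ (a, b) else 0) else 0)
      - (if q = p then (if a = w \<and> b = w then ksign (dg w) (dg w) * (ksign (dg p) (dg p) * x $$ (p, p)) else 0) else 0))"
  proof (intro sum.cong refl)
    fix p q assume p: "p \<in> I" and q: "q \<in> I"
    have e: "super_prod m n (mat_unit p w) (mat_unit w q) a b = (if p = a \<and> q = b then 1 else 0)
      - (if q = p \<and> a = w \<and> b = w then ksign (dg w) (dg w) * ksign (dg p) (dg p) else (0 :: 'k))"
    proof -
      have s: "ksign (dg w + dg q) (dg q + dg w) = (ksign (dg w) (dg w) * ksign (dg q) (dg q) :: 'k)"
        unfolding add.commute[of "dg q" "dg w"] by (rule ksign_self_add)
      show ?thesis
        unfolding super_prod_mat_unit_right[OF w(1) I_less[OF q]]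
        using s by (cases "a = w"; cases "b = w"; cases "q = p"; cases "b = q"; simp del: add_bit_eq_xor add: mat_unit_def)
    qed
    show "x $$ (p, q) * super_prod m n (mat_unit p w) (mat_unit w q) a b
      = (if q = b then (if p = a then x $$ (a, b) else 0) else 0)
      - (if q = p then (if a = w \<and> b = w then ksign (dg w) (dg w) * (ksign (dg p) (dg p) * x $$ (p, p)) else 0) else 0)"
      unfolding e using p q w(2) by (cases "q = p"; cases "q = b"; cases "p = a"; cases "a = w"; cases "b = w"; auto)
  qed
  also have "\<dots> = (\<Sum>p\<in>I. \<Sum>q\<in>I. if q = b then (if p = a then x $$ (a, b) else 0) else 0)
    - (\<Sum>p\<in>I. \<Sum>q\<in>I. if q = p then (if a = w \<and> b = w then ksign (dg w) (dg w) * (ksign (dg p) (dg p) * x $$ (p, p)) else 0) else 0)"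
    by (simp only: sum_subtractf)
  also have "(\<Sum>p\<in>I. \<Sum>q\<in>I. if q = b then (if p = a then x $$ (a, b) else 0) else 0) = x $$ (a, b)"
    using fin outside[OF x ab] by (cases "b \<in> I") (auto cong: if_cong)
  also have "(\<Sum>p\<in>I. \<Sum>q\<in>I. if q = p then (if a = w \<and> b = w then ksign (dg w) (dg w) * (ksign (dg p) (dg p) * x $$ (p, p)) else 0) else 0)
    = (if a = w \<and> b = w then ksign (dg w) (dg w) * (\<Sum>p\<in>I. ksign (dg p) (dg p) * x $$ (p, p)) else 0)"
  proof (cases "a = w \<and> b = w")
    case True
    then show ?thesis using fin by (simp add: sum_distrib_left)
  next
    case False
    show ?thesis unfolding if_not_P[OF False] using fin by simp
  qed
  also have "(\<Sum>p\<in>I. ksign (dg p) (dg p) * x $$ (p, p)) = supertrace m n x"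
    unfolding supertrace_def by (rule sum.mono_neutral_left) (use I outside[OF x] in auto)
  finally show ?thesis using supertrace0[OF x(1)] by simp
qed

theorem equivariant_section: "equivariant_section m n S I w (\<lambda>p. D p w) (\<lambda>q. D w q) lam"
proof (unfold_locales, goal_cases)
  case 1
  show ?case by (rule I)
next
  case (2 p)
  then show ?case using D_in(1) by (simp add: D_def)
next
  case (3 p)
  then show ?case by (intro D_homog I_less w)
next
  case (4 q)
  then show ?case using D_in(2) by (simp add: D_def)
next
  case (5 q)
  then show ?case by (intro D_homog I_less w)
next
  case (6 y p a b)
  have "supercommutator m y (D p w) $$ (a, b)
    = super_prod m n (\<lambda>a b. y $$ (a, b)) (\<lambda>a b. mat_unit p w a b + T p w a b) a b"
    by (rule supercommutator_super_prod) (use 6 S_carrier D_carrier D_entry in auto)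
  also have "\<dots> = (\<Sum>r\<in>I. y $$ (r, p) * mat_unit r w a b) + (\<Sum>r\<in>I. y $$ (r, p) * T r w a b)"
    unfolding super_prod_add unit_c[OF 6] T_c[OF 6] ..
  also have "\<dots> = (\<Sum>r\<in>I. y $$ (r, p) * D r w $$ (a, b))"
    unfolding sum.distrib[symmetric] by (simp add: D_entry 6 distrib_left)
  finally show ?case .
next
  case (7 y q a b)
  have "supercommutator m y (D w q) $$ (a, b)
    = super_prod m n (\<lambda>a b. y $$ (a, b)) (\<lambda>a b. mat_unit w q a b + T w q a b) a b"
    by (rule supercommutator_super_prod) (use 7 S_carrier D_carrier D_entry in auto)
  also have "\<dots> = - (\<Sum>r\<in>I. ksign (dg q + dg r) (dg w + dg q) * y $$ (q, r) * mat_unit w r a b)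
    + - (\<Sum>r\<in>I. ksign (dg q + dg r) (dg w + dg q) * y $$ (q, r) * T w r a b)"
    unfolding super_prod_add unit_e[OF 7] T_e[OF 7] ..
  also have "\<dots> = - (\<Sum>r\<in>I. ksign (dg q + dg r) (dg w + dg q) * y $$ (q, r) * D w r $$ (a, b))"
    by (simp add: D_entry 7 distrib_left sum.distrib del: add_bit_eq_xor)
  finally show ?case .
next
  case (8 x a b)
  have "(\<Sum>p\<in>I. \<Sum>q\<in>I. x $$ (p, q) * supercommutator m (D p w) (D w q) $$ (a, b))
    = (\<Sum>p\<in>I. \<Sum>q\<in>I. x $$ (p, q) * super_prod m n (mat_unit p w) (mat_unit w q) a b
      + x $$ (p, q) * (super_prod m n (mat_unit p w) (T w q) a b
        + super_prod m n (T p w) (mat_unit w q) a b + super_prod m n (T p w) (T w q) a b))"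
  proof (intro sum.cong refl)
    fix p q
    have "supercommutator m (D p w) (D w q) $$ (a, b)
      = super_prod m n (\<lambda>a b. mat_unit p w a b + T p w a b) (\<lambda>a b. mat_unit w q a b + T w q a b) a b"
      by (rule supercommutator_super_prod) (use 8 D_carrier D_entry in auto)
    then show "x $$ (p, q) * supercommutator m (D p w) (D w q) $$ (a, b)
      = x $$ (p, q) * super_prod m n (mat_unit p w) (mat_unit w q) a b
      + x $$ (p, q) * (super_prod m n (mat_unit p w) (T w q) a b
        + super_prod m n (T p w) (mat_unit w q) a b + super_prod m n (T p w) (T w q) a b)"
      by (simp add: super_prod_add algebra_simps)
  qed
  also have "\<dots> = x $$ (a, b) + (lam - 1) * x $$ (a, b)"
    unfolding sum.distrib unit_section[OF 8] T_section[OF 8] ..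
  finally show ?case by (simp add: algebra_simps)
next
  case 9
  show ?case by (rule lam)
qed

end

section \<open>The special linear superalgebra\<close>

definition sl_set :: "nat \<Rightarrow> nat \<Rightarrow> 'k :: field mat set" where
  "sl_set m n = {x \<in> carrier_mat (m + n) (m + n). supertrace m n x = 0}"

lemma supertrace_linear:
  assumes "x \<in> carrier_mat (m + n) (m + n)"
  shows "y \<in> carrier_mat (m + n) (m + n) \<Longrightarrow> supertrace m n (x + y) = supertrace m n x + supertrace m n y"
    and "supertrace m n (c \<cdot>\<^sub>m x) = c * supertrace m n x"
  using assms by (simp_all add: supertrace_def distrib_left sum.distrib sum_distrib_left mult.left_commute)

lemma supertrace_component:
  assumes "x \<in> carrier_mat (m + n) (m + n)" "supertrace m n x = 0"
  shows "supertrace m n (mat_component m p x) = 0"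
  using assms by (cases p rule: bit_cases) (simp_all add: supertrace_def mat_component_def bit_add_self(1) del: add_bit_eq_xor)

lemma sl_set_superalgebra: "matrix_superalgebra m n (sl_set m n :: 'k :: field_char_0 mat set)"
  by unfold_locales
    (auto simp: sl_set_def supertrace_linear supertrace_component mat_component_carrier
      supercommutator_carrier supertrace_supercommutator, simp add: supertrace_def)

lemma sl_eq: "sl m n = subsuperalgebra (gl m n) (sl_set m n)"
proof -
  have "(case split_block x m m of (x1, x2, x3, x4) \<Rightarrow> trace x1 = trace x4) \<longleftrightarrow> supertrace m n x = 0"
    if x: "x \<in> carrier_mat (m + n) (m + n)" for x :: "'a mat"
  proof -
    have "supertrace m n x = (\<Sum>p<m. x $$ (p, p)) + (\<Sum>p=m..<m + n. - x $$ (p, p))"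
      unfolding supertrace_def lessThan_atLeast0
      by (subst sum.atLeastLessThan_concat[symmetric, of 0 m]) (auto simp: coord_degree_def)
    also have "(\<Sum>p=m..<m + n. - x $$ (p, p)) = - (\<Sum>p<n. x $$ (p + m, p + m))"
      using sum.shift_bounds_nat_ivl[of "\<lambda>p. x $$ (p, p)" 0 m n]
      by (simp add: sum_negf lessThan_atLeast0 add.commute)
    finally show ?thesis using x by (simp add: split_block_def Let_def trace_def)
  qed
  then show ?thesis unfolding sl_def sl_set_def by (simp cong: conj_cong)
qed

text \<open>Sections for \<open>sl\<close> need no correction: a matrix unit off the diagonal has supertrace zero.\<close>

lemma sl_section:
  assumes "I \<subseteq> {..<m + n}" "w < m + n" "w \<notin> I"
  shows "\<exists>c e lam. equivariant_section m n (sl_set m n :: 'k :: field_char_0 mat set) I w c e lam"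
proof -
  interpret matrix_superalgebra m n "sl_set m n :: 'k mat set" by (rule sl_set_superalgebra)
  have st: "mat (m + n) (m + n) (\<lambda>(a, b). mat_unit i j a b) \<in> (sl_set m n :: 'k mat set)" if "i \<noteq> j" for i j
    using that by (auto simp: sl_set_def supertrace_def mat_unit_def intro!: sum.neutral)
  have "corrected_units m n (sl_set m n) I w (\<lambda>i j a b. 0 :: 'k) 1"
  proof (unfold_locales, goal_cases)
    case (7 p)
    then show ?case using st[of p w] assms(3) by auto
  next
    case (8 p)
    then show ?case using st[of w p] assms(3) by auto
  qed (use assms in \<open>auto simp: super_prod_def sl_set_def\<close>)
  then interpret corrected_units m n "sl_set m n" I w "\<lambda>i j a b. 0 :: 'k" 1 .
  show ?thesis using equivariant_section by blast
qed

section \<open>The queer superalgebra\<close>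

context
  fixes m :: nat
begin

private abbreviation (input) "d2 \<equiv> m + m"
private abbreviation (input) "gr \<equiv> coord_degree m"

text \<open>The parity change \<open>J\<close> of \<open>k\<^sup>m\<^sup>|\<^sup>m\<close> permutes the coordinates; the matrices with equal diagonal and
  equal off-diagonal blocks are those that commute with it.\<close>

definition parity_swap :: "nat \<Rightarrow> nat" where
  "parity_swap i = (if i < m then i + m else i - m)"

private abbreviation "J \<equiv> parity_swap"

lemma parity_swap_facts:
  assumes "i < d2"
  shows "J i < d2" "J (J i) = i" "gr (J i) = gr i + 1" "J i \<noteq> i"
  using assms by (auto simp: parity_swap_def coord_degree_def)

lemma parity_swap_eq_iff: "i < d2 \<Longrightarrow> j < d2 \<Longrightarrow> J i = j \<longleftrightarrow> i = J j"
  using parity_swap_facts by metis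

lemma sum_parity_swap: "(\<Sum>r<d2. f (J r)) = (\<Sum>r<d2. f r)"
  by (rule sum.reindex_bij_witness[of _ J J]) (auto simp: parity_swap_facts)

text \<open>The sum is the trace of \<open>x\<^sub>2\<close> plus the trace of \<open>x\<^sub>3\<close>, that is, twice the trace of \<open>x\<^sub>2\<close>.\<close>

definition sq_set :: "'k :: field mat set" where
  "sq_set = {x \<in> carrier_mat d2 d2. (\<forall>a<d2. \<forall>b<d2. x $$ (J a, J b) = x $$ (a, b)) \<and> (\<Sum>p<d2. x $$ (p, J p)) = 0}"

text \<open>The parity change leaves the diagonal entries of \<open>x\<close> fixed and reverses their signs in the
  supertrace.\<close>

lemma sq_set_supertrace:
  assumes "x \<in> sq_set"
  shows "supertrace m m x = (0 :: 'k :: field_char_0)"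
proof -
  have "supertrace m m x = (\<Sum>p<d2. ksign (gr (J p)) (gr (J p)) * x $$ (J p, J p))"
    unfolding supertrace_def by (rule sum_parity_swap[symmetric])
  also have "\<dots> = (\<Sum>p<d2. - (ksign (gr p) (gr p) * x $$ (p, p)))"
  proof (rule sum.cong[OF refl])
    fix p assume "p \<in> {..<d2}"
    then show "ksign (gr (J p)) (gr (J p)) * x $$ (J p, J p) = - (ksign (gr p) (gr p) * x $$ (p, p))"
      using assms by (cases "gr p" rule: bit_cases) (simp_all add: sq_set_def parity_swap_facts)
  qed
  also have "\<dots> = - supertrace m m x" by (simp add: supertrace_def sum_negf)
  finally show ?thesis by simp
qed

lemma sq_bracket:
  assumes x: "x \<in> sq_set" and y: "y \<in> sq_set"
  shows "supercommutator m x y \<in> (sq_set :: 'k :: field mat set)"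
proof -
  have c: "x \<in> carrier_mat d2 d2" "y \<in> carrier_mat d2 d2" using x y by (auto simp: sq_set_def)
  have xJ: "x $$ (J a, J b) = x $$ (a, b)" and yJ: "y $$ (J a, J b) = y $$ (a, b)" if "a < d2" "b < d2" for a b
    using x y that by (auto simp: sq_set_def)
  have "supercommutator m x y $$ (J a, J b) = supercommutator m x y $$ (a, b)" if ab: "a < d2" "b < d2" for a b
  proof -
    have "supercommutator m x y $$ (J a, J b) = (\<Sum>r<d2. x $$ (J a, J r) * y $$ (J r, J b)
      - ksign (gr (J a) + gr (J r)) (gr (J r) + gr (J b)) * y $$ (J a, J r) * x $$ (J r, J b))"
      unfolding supercommutator_entry[OF c parity_swap_facts(1)[OF ab(1)] parity_swap_facts(1)[OF ab(2)]]
      by (rule sum_parity_swap[symmetric])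
    also have "\<dots> = (\<Sum>r<d2. x $$ (a, r) * y $$ (r, b) - ksign (gr a + gr r) (gr r + gr b) * y $$ (a, r) * x $$ (r, b))"
    proof (rule sum.cong[OF refl])
      fix r assume "r \<in> {..<d2}"
      then have r: "r < d2" by simp
      have "ksign (gr (J a) + gr (J r)) (gr (J r) + gr (J b)) = (ksign (gr a + gr r) (gr r + gr b) :: 'k)"
        unfolding parity_swap_facts(3)[OF ab(1)] parity_swap_facts(3)[OF ab(2)] parity_swap_facts(3)[OF r]
        by (cases "gr a" rule: bit_cases; cases "gr r" rule: bit_cases; cases "gr b" rule: bit_cases) simp_all
      then show "x $$ (J a, J r) * y $$ (J r, J b) - ksign (gr (J a) + gr (J r)) (gr (J r) + gr (J b)) * y $$ (J a, J r) * x $$ (J r, J b)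
        = x $$ (a, r) * y $$ (r, b) - ksign (gr a + gr r) (gr r + gr b) * y $$ (a, r) * x $$ (r, b)"
        by (simp only: xJ[OF ab(1) r] xJ[OF r ab(2)] yJ[OF ab(1) r] yJ[OF r ab(2)])
    qed
    also have "\<dots> = supercommutator m x y $$ (a, b)" unfolding supercommutator_entry[OF c ab] ..
    finally show ?thesis .
  qed
  moreover have "(\<Sum>p<d2. supercommutator m x y $$ (p, J p)) = 0"
  proof -
    have "(\<Sum>p<d2. supercommutator m x y $$ (p, J p))
      = (\<Sum>p<d2. (\<Sum>r<d2. x $$ (p, r) * y $$ (r, J p)) - (\<Sum>r<d2. x $$ (r, J p) * y $$ (J p, J r)))"
    proof (rule sum.cong[OF refl])
      fix p assume "p \<in> {..<d2}"
      then have p: "p < d2" by simp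
      show "supercommutator m x y $$ (p, J p) = (\<Sum>r<d2. x $$ (p, r) * y $$ (r, J p)) - (\<Sum>r<d2. x $$ (r, J p) * y $$ (J p, J r))"
        unfolding supercommutator_entry[OF c p parity_swap_facts(1)[OF p]] sum_subtractf[symmetric]
      proof (rule sum.cong[OF refl])
        fix r assume "r \<in> {..<d2}"
        then have r: "r < d2" by simp
        have "ksign (gr p + gr r) (gr r + gr (J p)) = (1 :: 'k)"
          unfolding parity_swap_facts(3)[OF p]
          by (cases "gr p" rule: bit_cases; cases "gr r" rule: bit_cases) simp_all
        then show "x $$ (p, r) * y $$ (r, J p) - ksign (gr p + gr r) (gr r + gr (J p)) * y $$ (p, r) * x $$ (r, J p)
          = x $$ (p, r) * y $$ (r, J p) - x $$ (r, J p) * y $$ (J p, J r)"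
          by (simp add: yJ[OF p r])
      qed
    qed
    also have "\<dots> = (\<Sum>p<d2. \<Sum>r<d2. x $$ (p, r) * y $$ (r, J p)) - (\<Sum>p<d2. \<Sum>r<d2. x $$ (r, J p) * y $$ (J p, J r))"
      by (simp only: sum_subtractf)
    also have "(\<Sum>p<d2. \<Sum>r<d2. x $$ (r, J p) * y $$ (J p, J r)) = (\<Sum>p<d2. \<Sum>r<d2. x $$ (r, p) * y $$ (p, J r))"
      by (rule sum_parity_swap)
    also have "\<dots> = (\<Sum>p<d2. \<Sum>r<d2. x $$ (p, r) * y $$ (r, J p))" by (rule sum.swap)
    finally show ?thesis by simp
  qed
  ultimately show ?thesis using supercommutator_carrier[OF c] by (simp add: sq_set_def)
qed

lemma sq_set_superalgebra: "matrix_superalgebra m m (sq_set :: 'k :: field_char_0 mat set)"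
proof (unfold_locales, goal_cases)
  case (5 x p)
  then have cx: "x \<in> carrier_mat d2 d2" by (simp add: sq_set_def)
  have "mat_component m p x $$ (J a, J b) = mat_component m p x $$ (a, b)" if "a < d2" "b < d2" for a b
  proof -
    have "gr (J a) + gr (J b) = gr a + gr b"
      unfolding parity_swap_facts(3)[OF that(1)] parity_swap_facts(3)[OF that(2)]
      by (cases "gr a" rule: bit_cases; cases "gr b" rule: bit_cases) simp_all
    moreover have "x $$ (J a, J b) = x $$ (a, b)" using 5 that by (simp add: sq_set_def)
    ultimately show ?thesis
      using mat_component_entry[OF cx parity_swap_facts(1)[OF that(1)] parity_swap_facts(1)[OF that(2)], of p]
        mat_component_entry[OF cx that, of p] by (simp del: add_bit_eq_xor)
  qed
  moreover have "(\<Sum>a<d2. mat_component m p x $$ (a, J a)) = (if p = 1 then (\<Sum>a<d2. x $$ (a, J a)) else 0)"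
  proof -
    have "mat_component m p x $$ (a, J a) = (if p = 1 then x $$ (a, J a) else 0)" if a: "a < d2" for a
    proof -
      have "gr a + gr (J a) = 1" unfolding parity_swap_facts(3)[OF a]
        by (cases "gr a" rule: bit_cases) simp_all
      then show ?thesis using mat_component_entry[OF cx a parity_swap_facts(1)[OF a], of p]
        by (auto simp del: add_bit_eq_xor)
    qed
    then show ?thesis by simp
  qed
  ultimately show ?case using 5 by (simp add: sq_set_def mat_component_carrier)
next
  case (6 x y p q)
  then show ?case by (intro sq_bracket)
qed (auto simp: sq_set_def parity_swap_facts sum.distrib sum_distrib_left[symmetric])

text \<open>The elements are \<open>E\<^bsub>i j\<^esub> + E\<^bsub>J i, J j\<^esub>\<close>. Apart from \<open>x\<^bsub>J a, J b\<^esub> = x\<^bsub>a b\<^esub>\<close>, which is the second copy of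
  \<open>x\<close>, the corrections contribute the supertrace at \<open>(J w, J w)\<close> and the odd trace \<open>\<Sum> x\<^bsub>p, J p\<^esub>\<close> at
  \<open>(w, J w)\<close> and \<open>(J w, w)\<close>; both traces vanish on \<open>sq\<close>.\<close>

lemma sq_section:
  assumes "I \<subseteq> {..<d2}" "w < d2" "w \<notin> I" and JI: "\<And>p. p \<in> I \<Longrightarrow> J p \<in> I"
  shows "\<exists>c e lam. equivariant_section m m (sq_set :: 'k :: field_char_0 mat set) I w c e lam"
proof -
  interpret matrix_superalgebra m m "sq_set :: 'k mat set" by (rule sq_set_superalgebra)
  note Jf = parity_swap_facts
  have lt: "p < d2" if "p \<in> I" for p using assms(1) that by auto
  have fin: "finite I" using assms(1) finite_subset by blast
  have Jw: "J w < d2" "J w \<notin> I" "J w \<noteq> w" using Jf[OF assms(2)] JI[of "J w"] assms(3) by auto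
  have out: "x $$ (a, b) = 0" if "x \<in> sq_set" "supported I x" "a < d2" "b < d2" "a \<notin> I \<or> b \<notin> I" for x :: "'k mat" and a b
  proof (rule ccontr)
    assume "x $$ (a, b) \<noteq> 0"
    moreover have "a < dim_row x" "b < dim_col x" using that by (auto simp: sq_set_def)
    ultimately show False using that(2,5) unfolding supported_def by blast
  qed
  have xJ: "x $$ (J a, J b) = x $$ (a, b)" if "x \<in> sq_set" "a < d2" "b < d2" for x :: "'k mat" and a b
    using that by (auto simp: sq_set_def)
  have D: "mat d2 d2 (\<lambda>(a, b). mat_unit i j a b + mat_unit (J i) (J j) a b) \<in> (sq_set :: 'k mat set)"
    if ij: "i < d2" "j < d2" and ne: "J i \<noteq> j" for i j
  proof -
    have ne': "i \<noteq> J j" using ne ij Jf(2)[of j] by auto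
    show ?thesis using ij ne ne'
      unfolding sq_set_def
      by (auto simp: Jf mat_unit_def parity_swap_eq_iff intro!: sum.neutral)
  qed
  have "corrected_units m m sq_set I w (\<lambda>i j. mat_unit (J i) (J j) :: nat \<Rightarrow> nat \<Rightarrow> 'k) 2"
  proof (unfold_locales, goal_cases)
    case 1
    show ?case by (rule assms(1))
  next
    case 2
    show ?case by (rule assms(2))
  next
    case 3
    show ?case by (rule assms(3))
  next
    case 4
    show ?case by simp
  next
    case (5 x)
    then show ?case by (rule sq_set_supertrace)
  next
    case (6 i j a b)
    then have "a = J i" "b = J j" by (auto simp: mat_unit_def split: if_splits)
    then show ?case using 6 unfolding Jf(3)[OF 6(1)] Jf(3)[OF 6(2)]
      by (cases "gr i" rule: bit_cases; cases "gr j" rule: bit_cases) (simp_all add: Jf)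
  next
    case (7 p)
    have "J p \<noteq> w" using JI[OF 7] assms(3) by auto
    then show ?case by (intro D lt 7 assms(2))
  next
    case (8 p)
    have "J w \<noteq> p" using Jw(2) 8 by auto
    then show ?case by (intro D lt 8 assms(2))
  next
    case (9 y p a b)
    note p = lt[OF 9(3)]
    have "(\<Sum>r\<in>I. y $$ (r, p) * mat_unit (J r) (J w) a b) = (\<Sum>r\<in>I. if r = J a then (if b = J w then y $$ (J a, p) else 0) else 0)"
    proof (intro sum.cong refl)
      fix r assume r: "r \<in> I"
      have "a = J r \<longleftrightarrow> r = J a" using parity_swap_eq_iff[OF 9(4) lt[OF r]] by auto
      then show "y $$ (r, p) * mat_unit (J r) (J w) a b = (if r = J a then (if b = J w then y $$ (J a, p) else 0) else 0)"
        by (simp add: mat_unit_def)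
    qed
    also have "\<dots> = (if b = J w then y $$ (J a, p) else 0)"
      using fin out[OF 9(1,2) Jf(1)[OF 9(4)] p] by simp
    also have "y $$ (J a, p) = y $$ (a, J p)"
      using xJ[OF 9(1) 9(4) Jf(1)[OF p]] Jf(2)[OF p] by simp
    finally show ?case
      unfolding super_prod_mat_unit_right[OF Jf(1)[OF p] Jw(1)]
      using out[OF 9(1,2) Jw(1) 9(5)] Jw(2) by simp
  next
    case (10 y q a b)
    note q = lt[OF 10(3)]
    have "(\<Sum>r\<in>I. ksign (gr q + gr r) (gr w + gr q) * y $$ (q, r) * mat_unit (J w) (J r) a b)
      = (\<Sum>r\<in>I. if r = J b then (if a = J w then ksign (gr q + gr (J b)) (gr w + gr q) * y $$ (q, J b) else 0) else 0)"
    proof (intro sum.cong refl)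
      fix r assume r: "r \<in> I"
      have "b = J r \<longleftrightarrow> r = J b" using parity_swap_eq_iff[OF 10(5) lt[OF r]] by auto
      then show "ksign (gr q + gr r) (gr w + gr q) * y $$ (q, r) * mat_unit (J w) (J r) a b
        = (if r = J b then (if a = J w then ksign (gr q + gr (J b)) (gr w + gr q) * y $$ (q, J b) else 0) else 0)"
        by (simp add: mat_unit_def del: add_bit_eq_xor)
    qed
    also have "\<dots> = (if a = J w then ksign (gr q + gr (J b)) (gr w + gr q) * y $$ (q, J b) else 0)"
      using fin out[OF 10(1,2) q Jf(1)[OF 10(5)]] by simp
    also have "y $$ (q, J b) = y $$ (J q, b)"
      using xJ[OF 10(1) Jf(1)[OF q] 10(5)] Jf(2)[OF q] by simp
    finally have rhs: "(\<Sum>r\<in>I. ksign (gr q + gr r) (gr w + gr q) * y $$ (q, r) * mat_unit (J w) (J r) a b)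
      = (if a = J w then ksign (gr q + gr (J b)) (gr w + gr q) * y $$ (J q, b) else 0)" .
    have "ksign (gr (J w) + gr (J q)) (gr (J q) + gr b) = (ksign (gr q + gr (J b)) (gr w + gr q) :: 'k)"
      unfolding Jf(3)[OF assms(2)] Jf(3)[OF q] Jf(3)[OF 10(5)]
      by (cases "gr w" rule: bit_cases; cases "gr q" rule: bit_cases; cases "gr b" rule: bit_cases) simp_all
    then show ?case
      unfolding rhs super_prod_mat_unit_right[OF Jw(1) Jf(1)[OF q]]
      using out[OF 10(1,2) 10(4) Jw(1)] Jw(2) by (cases "a = J w") (simp_all del: add_bit_eq_xor)
  next
    case (11 x a b)
    \<comment> \<open>the second copy of \<open>x\<close>, the supertrace and the odd trace\<close>
    let ?X = "\<lambda>p q. (if q = J b then (if p = J a then x $$ (J a, J b) else 0) else 0)"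
    let ?Y = "\<lambda>p q. (if q = p then (if a = J w \<and> b = J w then ksign (gr w) (gr w) * (ksign (gr p) (gr p) * x $$ (p, p)) else 0) else 0)"
    let ?Z = "\<lambda>p q. (if q = J p then (if a = J w \<and> b = w \<or> a = w \<and> b = J w then x $$ (p, J p) else 0) else 0)"
    have "(\<Sum>p\<in>I. \<Sum>q\<in>I. x $$ (p, q) * (super_prod m m (mat_unit p w) (mat_unit (J w) (J q)) a b
        + super_prod m m (mat_unit (J p) (J w)) (mat_unit w q) a b
        + super_prod m m (mat_unit (J p) (J w)) (mat_unit (J w) (J q)) a b))
      = (\<Sum>p\<in>I. \<Sum>q\<in>I. ?X p q - ?Y p q - ?Z p q)"
    proof (intro sum.cong refl)
      fix p q assume p: "p \<in> I" and q: "q \<in> I"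
      have s1: "ksign (gr (J w) + gr (J q)) (gr (J q) + gr w) = (1 :: 'k)"
        unfolding Jf(3)[OF assms(2)] Jf(3)[OF lt[OF q]]
        by (cases "gr w" rule: bit_cases; cases "gr q" rule: bit_cases) simp_all
      have s2: "ksign (gr w + gr q) (gr q + gr (J w)) = (1 :: 'k)"
        unfolding Jf(3)[OF assms(2)]
        by (cases "gr w" rule: bit_cases; cases "gr q" rule: bit_cases) simp_all
      have s3: "ksign (gr (J w) + gr (J q)) (gr (J q) + gr (J w)) = (ksign (gr w) (gr w) * ksign (gr q) (gr q) :: 'k)"
        unfolding Jf(3)[OF assms(2)] Jf(3)[OF lt[OF q]]
        by (cases "gr w" rule: bit_cases; cases "gr q" rule: bit_cases) simp_all
      have J1: "J q = p \<longleftrightarrow> q = J p" "J p = q \<longleftrightarrow> q = J p" "J q = J p \<longleftrightarrow> q = p" "b = J q \<longleftrightarrow> q = J b" "a = J p \<longleftrightarrow> p = J a"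
        using parity_swap_eq_iff lt[OF p] lt[OF q] 11(3,4) Jf(1,2) by metis+
      have z: "mat_unit p w a (J w) = (0 :: 'k)" "mat_unit (J p) (J w) a w = (0 :: 'k)"
        using Jw(3) by (simp_all add: mat_unit_def)
      have 1: "super_prod m m (mat_unit p w) (mat_unit (J w) (J q)) a b = (if q = J p \<and> a = J w \<and> b = w then - 1 else (0 :: 'k))"
        unfolding super_prod_mat_unit_right[OF Jw(1) Jf(1)[OF lt[OF q]]]
        unfolding z(1) unfolding mat_unit_def J1(1)
        using s1 by (cases "a = J w"; cases "b = w"; cases "q = J p"; simp del: add_bit_eq_xor)
      have 2: "super_prod m m (mat_unit (J p) (J w)) (mat_unit w q) a b = (if q = J p \<and> a = w \<and> b = J w then - 1 else (0 :: 'k))"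
        unfolding super_prod_mat_unit_right[OF assms(2) lt[OF q]]
        unfolding z(2) unfolding mat_unit_def
        using s2 by (cases "a = w"; cases "b = J w"; cases "q = J p"; simp del: add_bit_eq_xor)
      have 3: "super_prod m m (mat_unit (J p) (J w)) (mat_unit (J w) (J q)) a b = (if q = J b \<and> p = J a then 1 else 0)
        - (if q = p \<and> a = J w \<and> b = J w then ksign (gr w) (gr w) * ksign (gr q) (gr q) else (0 :: 'k))"
        unfolding super_prod_mat_unit_right[OF Jw(1) Jf(1)[OF lt[OF q]]]
        unfolding mat_unit_def J1(3-5)
        using s3 by (cases "a = J w"; cases "b = J w"; cases "q = p"; simp del: add_bit_eq_xor)
      show "x $$ (p, q) * (super_prod m m (mat_unit p w) (mat_unit (J w) (J q)) a b
        + super_prod m m (mat_unit (J p) (J w)) (mat_unit w q) a b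
        + super_prod m m (mat_unit (J p) (J w)) (mat_unit (J w) (J q)) a b) = ?X p q - ?Y p q - ?Z p q"
      proof -
        have X: "x $$ (p, q) * (if q = J b \<and> p = J a then 1 else 0) = ?X p q"
          by (cases "q = J b \<and> p = J a") auto
        have Y: "x $$ (p, q) * (if q = p \<and> a = J w \<and> b = J w then ksign (gr w) (gr w) * ksign (gr q) (gr q) else 0) = ?Y p q"
          by (cases "q = p"; cases "a = J w"; cases "b = J w") simp_all
        have ne: "\<not> ((a = J w \<and> b = w) \<and> (a = w \<and> b = J w))" using Jw(3) by metis
        have Z: "x $$ (p, q) * (if q = J p \<and> a = J w \<and> b = w then - 1 else 0)
          + x $$ (p, q) * (if q = J p \<and> a = w \<and> b = J w then - 1 else 0) = - ?Z p q"
        proof (cases "q = J p")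
          case True
          show ?thesis unfolding True using ne by (simp only: simp_thms if_True split: if_split) auto
        qed simp
        show ?thesis unfolding 1 2 3 distrib_left right_diff_distrib X Y using Z by simp
      qed
    qed
    also have "\<dots> = (\<Sum>p\<in>I. \<Sum>q\<in>I. ?X p q) - (\<Sum>p\<in>I. \<Sum>q\<in>I. ?Y p q) - (\<Sum>p\<in>I. \<Sum>q\<in>I. ?Z p q)"
      by (simp only: sum_subtractf)
    also have "(\<Sum>p\<in>I. \<Sum>q\<in>I. ?X p q) = x $$ (J a, J b)"
      using fin out[OF 11(1,2) Jf(1)[OF 11(3)] Jf(1)[OF 11(4)]] by (cases "J b \<in> I") (auto cong: if_cong)
    also have "x $$ (J a, J b) = x $$ (a, b)" by (rule xJ[OF 11(1,3,4)])
    also have "(\<Sum>p\<in>I. \<Sum>q\<in>I. ?Y p q) = 0"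
    proof (cases "a = J w \<and> b = J w")
      case True
      have "(\<Sum>p\<in>I. ksign (gr p) (gr p) * x $$ (p, p)) = supertrace m m x"
        unfolding supertrace_def by (rule sum.mono_neutral_left) (use assms(1) out[OF 11(1,2)] in auto)
      then show ?thesis using True fin sq_set_supertrace[OF 11(1)] by (simp add: sum_distrib_left[symmetric])
    next
      case False
      show ?thesis unfolding if_not_P[OF False] using fin by simp
    qed
    also have "(\<Sum>p\<in>I. \<Sum>q\<in>I. ?Z p q) = 0"
    proof (cases "a = J w \<and> b = w \<or> a = w \<and> b = J w")
      case True
      have "(\<Sum>p\<in>I. x $$ (p, J p)) = (\<Sum>p<d2. x $$ (p, J p))"
        by (rule sum.mono_neutral_left) (use assms(1) out[OF 11(1,2)] Jf(1) in auto)
      then have "(\<Sum>p\<in>I. x $$ (p, J p)) = 0" using 11(1) by (simp add: sq_set_def)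
      then show ?thesis unfolding if_P[OF True] using fin JI by simp
    next
      case False
      show ?thesis unfolding if_not_P[OF False] using fin by simp
    qed
    finally show ?case by simp
  qed
  then interpret corrected_units m m sq_set I w "\<lambda>i j. mat_unit (J i) (J j) :: nat \<Rightarrow> nat \<Rightarrow> 'k" 2 .
  show ?thesis using equivariant_section by blast
qed

lemma sq_eq: "sq m = subsuperalgebra (gl m m) (sq_set :: 'k :: field_char_0 mat set)"
proof -
  have eq: "x \<in> {x \<in> carrier (sl m m). case split_block x m m of (x1, x2, x3, x4) \<Rightarrow> x1 = x4 \<and> x2 = x3 \<and> trace x2 = 0}
    \<longleftrightarrow> x \<in> sq_set" for x :: "'k mat"
  proof (cases "x \<in> carrier_mat d2 d2")
    case False
    then show ?thesis by (auto simp: sq_set_def sl_eq sl_set_def)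
  next
    case x: True
    have blocks: "(case split_block x m m of (x1, x2, x3, x4) \<Rightarrow> x1 = x4 \<and> x2 = x3 \<and> trace x2 = 0)
      \<longleftrightarrow> (\<forall>i<m. \<forall>j<m. x $$ (i, j) = x $$ (i + m, j + m)) \<and> (\<forall>i<m. \<forall>j<m. x $$ (i, j + m) = x $$ (i + m, j))
        \<and> (\<Sum>i<m. x $$ (i, i + m)) = 0"
      using x by (simp add: split_block_def Let_def trace_def mat_eq_iff)
    have J1: "J i = i + m" "J (i + m) = i" if "i < m" for i using that by (auto simp: parity_swap_def)
    have all: "(\<forall>a<d2. P a) \<longleftrightarrow> (\<forall>i<m. P i \<and> P (i + m))" for P
    proof (intro iffI allI impI)
      fix a assume *: "\<forall>i<m. P i \<and> P (i + m)" and a: "a < d2"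
      show "P a"
      proof (cases "a < m")
        case False
        then have "a = (a - m) + m" "a - m < m" using a by auto
        then show ?thesis using * by metis
      qed (use * in auto)
    qed auto
    have inv: "(\<forall>a<d2. \<forall>b<d2. x $$ (J a, J b) = x $$ (a, b)) \<longleftrightarrow>
      (\<forall>i<m. \<forall>j<m. x $$ (i, j) = x $$ (i + m, j + m)) \<and> (\<forall>i<m. \<forall>j<m. x $$ (i, j + m) = x $$ (i + m, j))"
      unfolding all by (auto simp: J1)
    have tr: "(\<Sum>p<d2. x $$ (p, J p)) = 2 * (\<Sum>i<m. x $$ (i, i + m))"
      if "\<forall>i<m. \<forall>j<m. x $$ (i, j + m) = x $$ (i + m, j)"
    proof -
      have "(\<Sum>p<d2. x $$ (p, J p)) = (\<Sum>p<m. x $$ (p, J p)) + (\<Sum>p<m. x $$ (p + m, J (p + m)))"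
        using sum.atLeastLessThan_concat[of 0 m d2 "\<lambda>p. x $$ (p, J p)"]
          sum.shift_bounds_nat_ivl[of "\<lambda>p. x $$ (p, J p)" 0 m m]
        by (simp add: lessThan_atLeast0)
      also have "\<dots> = (\<Sum>i<m. x $$ (i, i + m)) + (\<Sum>i<m. x $$ (i, i + m))"
        using that by (intro arg_cong2[of _ _ _ _ "(+)"] sum.cong refl) (auto simp: J1)
      finally show ?thesis by simp
    qed
    show ?thesis
    proof
      assume "x \<in> {x \<in> carrier (sl m m). case split_block x m m of (x1, x2, x3, x4) \<Rightarrow> x1 = x4 \<and> x2 = x3 \<and> trace x2 = 0}"
      then show "x \<in> sq_set" using x inv tr by (auto simp: sq_set_def blocks)
    next
      assume s: "x \<in> sq_set"
      then have i: "\<forall>a<d2. \<forall>b<d2. x $$ (J a, J b) = x $$ (a, b)" and t: "(\<Sum>p<d2. x $$ (p, J p)) = 0"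
        by (auto simp: sq_set_def)
      note i' = i[unfolded inv]
      have "(\<Sum>i<m. x $$ (i, i + m)) = 0" using tr[OF conjunct2[OF i']] t by simp
      then show "x \<in> {x \<in> carrier (sl m m). case split_block x m m of (x1, x2, x3, x4) \<Rightarrow> x1 = x4 \<and> x2 = x3 \<and> trace x2 = 0}"
        using x i' sq_set_supertrace[OF s] by (simp add: blocks sl_eq sl_set_def)
    qed
  qed
  have "{x \<in> carrier (sl m m). case split_block x m m of (x1, x2, x3, x4) \<Rightarrow> x1 = x4 \<and> x2 = x3 \<and> trace x2 = 0}
    = (sq_set :: 'k mat set)" by (rule Set.set_eqI, rule eq)
  then show ?thesis unfolding sq_def by simp
qed

end

section \<open>Matrices leaving a form invariant\<close>

text \<open>In the computations with forms below, a sign identity is established by cases on degrees and then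
  carried through a product of field elements.\<close>

lemma sign_rearrange:
  fixes a b c d e y g h g' h' :: "'k :: field"
  shows "a * b = c * d \<Longrightarrow> a * g * (b * y * h) = - (c * y * - (d * h * g))"
    and "a * b = c * d \<Longrightarrow> - (a * h * g) * - (b * h' * g') = h * g' * c * d * (h' * g)"
    and "a * b * c = d \<Longrightarrow> a * - (b * h * g) * - (c * h' * g') = d * g' * h * (h' * g)"
proof -
  assume K: "a * b = c * d"
  have "a * g * (b * y * h) = (a * b) * (g * y * h)" by (simp only: mult_ac)
  also have "\<dots> = - (c * y * - (d * h * g))" unfolding K by (simp add: mult_ac)
  finally show "a * g * (b * y * h) = - (c * y * - (d * h * g))" .
  have "- (a * h * g) * - (b * h' * g') = (a * b) * (h * g * h' * g')" by (simp add: mult_ac)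
  also have "\<dots> = h * g' * c * d * (h' * g)" unfolding K by (simp only: mult_ac)
  finally show "- (a * h * g) * - (b * h' * g') = h * g' * c * d * (h' * g)" .
next
  assume K: "a * b * c = d"
  show "a * - (b * h * g) * - (c * h' * g') = d * g' * h * (h' * g)"
    unfolding K[symmetric] by (simp add: mult_ac)
qed

text \<open>A homogeneous form is given by its Gram matrix \<open>g\<close> with inverse \<open>h\<close>; it has degree \<open>\<delta>\<close>, and
  \<open>\<zeta>\<close> is 1 if it is supersymmetric and -1 if it is super-antisymmetric.\<close>

locale super_form =
  fixes m n :: nat and g h :: "nat \<Rightarrow> nat \<Rightarrow> 'k :: field_char_0" and \<delta> :: bit and \<zeta> :: 'k
  assumes g_degree: "\<lbrakk>i < m + n; j < m + n; g i j \<noteq> 0\<rbrakk> \<Longrightarrow> coord_degree m i + coord_degree m j = \<delta>"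
    and g_sym: "\<lbrakk>i < m + n; j < m + n\<rbrakk> \<Longrightarrow> g i j = \<zeta> * ksign (coord_degree m i) (coord_degree m j) * g j i"
    and g_h: "\<lbrakk>i < m + n; j < m + n\<rbrakk> \<Longrightarrow> (\<Sum>r<m + n. g i r * h r j) = (if i = j then 1 else 0)"
    and h_g: "\<lbrakk>i < m + n; j < m + n\<rbrakk> \<Longrightarrow> (\<Sum>r<m + n. h i r * g r j) = (if i = j then 1 else 0)"
begin

abbreviation (input) "fd \<equiv> m + n"
abbreviation (input) "fg \<equiv> coord_degree m"

text \<open>A column of \<open>h\<close> is the unique solution of a system of linear equations with matrix \<open>g\<close>. If \<open>g\<close> is
  a block matrix for the labels \<open>\<kappa>\<close> of its rows and \<open>\<mu>\<close> of its columns, then the column with its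
  entries outside the matching block deleted is a solution, too.\<close>

lemma h_pattern:
  assumes pat: "\<And>k i. k < fd \<Longrightarrow> i < fd \<Longrightarrow> g k i \<noteq> 0 \<Longrightarrow> \<kappa> k = \<mu> i"
    and ij: "i < fd" "j < fd" and nz: "h i j \<noteq> 0"
  shows "\<kappa> j = \<mu> i"
proof -
  define h' where "h' l = (if \<mu> l = \<kappa> j then h l j else 0)" for l
  have gh': "(\<Sum>l<fd. g k l * h' l) = (if k = j then 1 else 0)" if k: "k < fd" for k
  proof (cases "\<kappa> k = \<kappa> j")
    case True
    have "(\<Sum>l<fd. g k l * h' l) = (\<Sum>l<fd. g k l * h l j)"
    proof (intro sum.cong refl)
      fix l assume "l \<in> {..<fd}"
      then have "g k l = 0 \<or> \<kappa> k = \<mu> l" using pat[OF k] by blast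
      then show "g k l * h' l = g k l * h l j" using True by (auto simp: h'_def)
    qed
    then show ?thesis using g_h[OF k ij(2)] by simp
  next
    case False
    have "(\<Sum>l<fd. g k l * h' l) = 0"
    proof (intro sum.neutral ballI)
      fix l assume "l \<in> {..<fd}"
      then have "g k l = 0 \<or> \<kappa> k = \<mu> l" using pat[OF k] by blast
      then show "g k l * h' l = 0" using False by (auto simp: h'_def)
    qed
    then show ?thesis using False by auto
  qed
  have "h' i = (\<Sum>l<fd. (if i = l then 1 else 0) * h' l)"
  proof -
    have "(\<Sum>l<fd. (if i = l then 1 else 0) * h' l) = (\<Sum>l<fd. if l = i then h' i else 0)"
      by (intro sum.cong refl) auto
    then show ?thesis using ij(1) by simp
  qed
  also have "\<dots> = (\<Sum>l<fd. \<Sum>k<fd. h i k * (g k l * h' l))"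
  proof (intro sum.cong refl)
    fix l assume "l \<in> {..<fd}"
    then show "(if i = l then 1 else 0) * h' l = (\<Sum>k<fd. h i k * (g k l * h' l))"
      using h_g[OF ij(1), of l] by (simp only: lessThan_iff mult.assoc[symmetric] sum_distrib_right[symmetric])
  qed
  also have "\<dots> = (\<Sum>k<fd. \<Sum>l<fd. h i k * (g k l * h' l))" by (rule sum.swap)
  also have "\<dots> = (\<Sum>k<fd. h i k * (if k = j then 1 else 0))"
    by (intro sum.cong refl) (simp only: sum_distrib_left[symmetric] gh' lessThan_iff)
  also have "\<dots> = (\<Sum>k<fd. if k = j then h i j else 0)" by (intro sum.cong refl) auto
  also have "\<dots> = h i j" using ij(2) by simp
  finally show ?thesis using nz unfolding h'_def by (auto split: if_splits)
qed

lemma h_degree: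
  assumes "i < fd" "j < fd" "h i j \<noteq> 0"
  shows "fg i + fg j = \<delta>"
proof -
  have "fg j = fg i + \<delta>"
  proof (rule h_pattern[where \<kappa> = fg and \<mu> = "\<lambda>i. fg i + \<delta>", OF _ assms])
    fix k i assume "k < fd" "i < fd" "g k i \<noteq> 0"
    then have "fg k + fg i = \<delta>" by (rule g_degree)
    then show "fg k = fg i + \<delta>"
      by (cases "fg k" rule: bit_cases; cases "fg i" rule: bit_cases) auto
  qed
  then show ?thesis by (cases "fg i" rule: bit_cases; cases \<delta> rule: bit_cases) auto
qed

text \<open>For homogeneous \<open>x\<close> this is \<open>b(x e\<^sub>u, e\<^sub>v) + (-1)\<^bsup>|x| |u|\<^esup> b(e\<^sub>u, x e\<^sub>v)\<close> (see \<open>form_defect_homog\<close>), extended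
  linearly in \<open>x\<close>: the entry of \<open>x\<close> at \<open>(r, v)\<close> belongs to the component of degree \<open>|r| + |v|\<close>.\<close>

definition form_defect :: "'k mat \<Rightarrow> nat \<Rightarrow> nat \<Rightarrow> 'k" where
  "form_defect x u v = (\<Sum>r<fd. x $$ (r, u) * g r v) + (\<Sum>r<fd. ksign (fg r + fg v) (fg u) * g u r * x $$ (r, v))"

text \<open>This is \<open>osp\<close> for \<open>\<delta> = 0\<close>, \<open>\<zeta> = 1\<close> and \<open>SP\<close> for \<open>\<delta> = 1\<close>, \<open>\<zeta> = -1\<close>.\<close>

definition form_set :: "'k mat set" where
  "form_set = {x \<in> sl_set m n. \<forall>u<fd. \<forall>v<fd. form_defect x u v = 0}"

lemma form_set_carrier: "x \<in> form_set \<Longrightarrow> x \<in> carrier_mat fd fd"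
  by (simp add: form_set_def sl_set_def)

lemma form_set_eq:
  assumes "x \<in> form_set" "u < fd" "v < fd"
  shows "(\<Sum>r<fd. x $$ (r, u) * g r v) = - (\<Sum>r<fd. ksign (fg r + fg v) (fg u) * g u r * x $$ (r, v))"
  using assms by (simp add: form_set_def form_defect_def eq_neg_iff_add_eq_0)

lemma form_defect_component:
  assumes x: "x \<in> carrier_mat fd fd" and uv: "u < fd" "v < fd"
  shows "form_defect (mat_component m p x) u v = (if fg u + fg v + \<delta> = p then form_defect x u v else 0)"
proof -
  have 1: "mat_component m p x $$ (r, u) * g r v = (if fg u + fg v + \<delta> = p then x $$ (r, u) * g r v else 0)"
    if r: "r < fd" for r
  proof (cases "g r v = 0")
    case False
    then have d: "fg r + fg v = \<delta>" using g_degree r uv by simp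
    have "fg r + fg u = p \<longleftrightarrow> fg u + fg v + \<delta> = p"
      unfolding d[symmetric] by (cases "fg r" rule: bit_cases; cases "fg v" rule: bit_cases; cases "fg u" rule: bit_cases) simp_all
    then show ?thesis using mat_component_entry[OF x r uv(1), of p] by simp
  qed simp
  have 2: "ksign (fg r + fg v) (fg u) * g u r * mat_component m p x $$ (r, v)
    = (if fg u + fg v + \<delta> = p then ksign (fg r + fg v) (fg u) * g u r * x $$ (r, v) else 0)"
    if r: "r < fd" for r
  proof (cases "g u r = 0")
    case False
    then have d: "fg u + fg r = \<delta>" using g_degree r uv by simp
    have "fg r + fg v = p \<longleftrightarrow> fg u + fg v + \<delta> = p"
      unfolding d[symmetric] by (cases "fg r" rule: bit_cases; cases "fg v" rule: bit_cases; cases "fg u" rule: bit_cases) simp_all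
    then show ?thesis using mat_component_entry[OF x r uv(2), of p] by simp
  qed simp
  show ?thesis unfolding form_defect_def by (simp add: 1 2 del: add_bit_eq_xor)
qed

lemma form_defect_homog:
  assumes "x \<in> homog_mat m n s" "u < fd" "v < fd"
  shows "form_defect x u v = (\<Sum>r<fd. x $$ (r, u) * g r v) + ksign s (fg u) * (\<Sum>r<fd. g u r * x $$ (r, v))"
proof -
  have e: "ksign (fg r + fg v) (fg u) * g u r * x $$ (r, v) = ksign s (fg u) * (g u r * x $$ (r, v))" if "r < fd" for r
    using homog_mat_entry[OF assms(1) that assms(3)] by (cases "fg r + fg v = s") simp_all
  show ?thesis unfolding form_defect_def sum_distrib_left
    by (intro arg_cong2[of _ _ _ _ "(+)"] sum.cong refl) (simp only: e lessThan_iff)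
qed

lemma form_defect_add:
  assumes "x \<in> carrier_mat fd fd" "u < fd" "v < fd"
  shows "y \<in> carrier_mat fd fd \<Longrightarrow> form_defect (x + y) u v = form_defect x u v + form_defect y u v"
    and "form_defect (c \<cdot>\<^sub>m x) u v = c * form_defect x u v"
  using assms by (simp_all add: form_defect_def algebra_simps sum.distrib sum_distrib_left del: add_bit_eq_xor)

text \<open>Invariance moves first \<open>x\<close> and then \<open>y\<close> from the left to the right argument of the form, which
  reverses their order.\<close>

lemma form_product:
  assumes x: "x \<in> form_set" "x \<in> homog_mat m n s" and y: "y \<in> form_set" "y \<in> homog_mat m n t"
    and uv: "u < fd" "v < fd"
  shows "(\<Sum>r<fd. (x * y) $$ (r, u) * g r v) = ksign s (t + fg u) * ksign t (fg u) * (\<Sum>k<fd. g u k * (y * x) $$ (k, v))"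
proof -
  have cx: "x \<in> carrier_mat fd fd" and cy: "y \<in> carrier_mat fd fd" using x y form_set_carrier by auto
  have prod: "(a * b) $$ (i, j) = (\<Sum>k<fd. a $$ (i, k) * b $$ (k, j))"
    if "a \<in> carrier_mat fd fd" "b \<in> carrier_mat fd fd" "i < fd" "j < fd" for a b :: "'k mat" and i j
    using that by (auto simp: scalar_prod_def lessThan_atLeast0)
  have ex: "(\<Sum>r<fd. x $$ (r, k) * g r v) = - (ksign s (fg k) * (\<Sum>r<fd. g k r * x $$ (r, v)))" if "k < fd" for k
    using x(1) form_defect_homog[OF x(2) that uv(2)] that uv by (simp add: form_set_def eq_neg_iff_add_eq_0)
  have ey: "(\<Sum>r<fd. y $$ (r, u) * g r k) = - (ksign t (fg u) * (\<Sum>r<fd. g u r * y $$ (r, k)))" if "k < fd" for k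
    using y(1) form_defect_homog[OF y(2) uv(1) that] that uv by (simp add: form_set_def eq_neg_iff_add_eq_0)
  have "(\<Sum>r<fd. (x * y) $$ (r, u) * g r v) = (\<Sum>r<fd. \<Sum>k<fd. y $$ (k, u) * (x $$ (r, k) * g r v))"
    by (intro sum.cong refl) (simp add: prod[OF cx cy _ uv(1)] sum_distrib_right sum_distrib_left mult_ac)
  also have "\<dots> = (\<Sum>k<fd. y $$ (k, u) * (\<Sum>r<fd. x $$ (r, k) * g r v))"
    by (subst sum.swap) (simp add: sum_distrib_left)
  also have "\<dots> = (\<Sum>k<fd. - ksign s (t + fg u) * (y $$ (k, u) * (\<Sum>r<fd. g k r * x $$ (r, v))))"
  proof (intro sum.cong refl)
    fix k assume "k \<in> {..<fd}"
    then have k: "k < fd" by simp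
    show "y $$ (k, u) * (\<Sum>r<fd. x $$ (r, k) * g r v) = - ksign s (t + fg u) * (y $$ (k, u) * (\<Sum>r<fd. g k r * x $$ (r, v)))"
    proof (cases "y $$ (k, u) = 0")
      case False
      then have "fg k + fg u = t" using homog_mat_entry[OF y(2) k uv(1)] by metis
      then have kt: "fg k = t + fg u" by (cases "fg k" rule: bit_cases; cases "fg u" rule: bit_cases) auto
      show ?thesis unfolding ex[OF k] unfolding kt by (simp only: mult_minus_left mult_minus_right mult.left_commute)
    qed simp
  qed
  also have "\<dots> = - ksign s (t + fg u) * (\<Sum>k<fd. \<Sum>r<fd. x $$ (r, v) * (y $$ (k, u) * g k r))"
    by (simp only: sum_distrib_left mult_ac)
  also have "(\<Sum>k<fd. \<Sum>r<fd. x $$ (r, v) * (y $$ (k, u) * g k r)) = (\<Sum>r<fd. x $$ (r, v) * (\<Sum>k<fd. y $$ (k, u) * g k r))"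
    by (subst sum.swap) (simp only: sum_distrib_left)
  also have "\<dots> = (\<Sum>r<fd. - ksign t (fg u) * (x $$ (r, v) * (\<Sum>k<fd. g u k * y $$ (k, r))))"
    by (intro sum.cong refl) (simp only: ey lessThan_iff mult_minus_left mult_minus_right mult.left_commute)
  also have "\<dots> = - ksign t (fg u) * (\<Sum>k<fd. g u k * (\<Sum>r<fd. y $$ (k, r) * x $$ (r, v)))"
    unfolding sum_distrib_left[symmetric]
    by (simp only: sum_distrib_left, subst sum.swap) (simp only: mult_ac)
  also have "(\<Sum>k<fd. g u k * (\<Sum>r<fd. y $$ (k, r) * x $$ (r, v))) = (\<Sum>k<fd. g u k * (y * x) $$ (k, v))"
    by (intro sum.cong refl) (simp add: prod[OF cy cx _ uv(2)])
  finally show ?thesis by (simp only: mult_minus_left mult_minus_right minus_minus mult.assoc)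
qed

lemma form_set_superalgebra: "matrix_superalgebra m n form_set"
proof -
  interpret sl: matrix_superalgebra m n "sl_set m n :: 'k mat set" by (rule sl_set_superalgebra)
  show ?thesis
  proof (unfold_locales, goal_cases)
    case (1 x)
    then show ?case by (rule form_set_carrier)
  next
    case 2
    show ?case using sl.S_zero by (simp add: form_set_def form_defect_def)
  next
    case (3 x y)
    then show ?case using form_set_carrier by (simp add: form_set_def sl.S_add form_defect_add sl.S_carrier)
  next
    case (4 x c)
    then show ?case by (simp add: form_set_def sl.S_smult form_defect_add(2)[OF sl.S_carrier])
  next
    case (5 x p)
    then show ?case by (simp add: form_set_def sl.S_component form_defect_component[OF sl.S_carrier])
  next
    case (6 x y s t)
    have cx: "x \<in> carrier_mat fd fd" and cy: "y \<in> carrier_mat fd fd" using 6 form_set_carrier by auto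
    have "form_defect (supercommutator m x y) u v = 0" if uv: "u < fd" "v < fd" for u v
    proof -
      let ?L = "\<lambda>z :: 'k mat. (\<Sum>r<fd. z $$ (r, u) * g r v)" and ?R = "\<lambda>z :: 'k mat. (\<Sum>r<fd. g u r * z $$ (r, v))"
      have e: "supercommutator m x y $$ (a, b) = (x * y) $$ (a, b) - ksign s t * (y * x) $$ (a, b)" if "a < fd" "b < fd" for a b
        unfolding supercommutator_homog[OF 6(3,4)] using cx cy that by (simp del: index_mult_mat(1))
      have L: "?L (supercommutator m x y) = ?L (x * y) - ksign s t * ?L (y * x)"
        by (simp add: e uv left_diff_distrib sum_subtractf sum_distrib_left mult.assoc del: index_mult_mat(1))
      have R: "?R (supercommutator m x y) = ?R (x * y) - ksign s t * ?R (y * x)"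
        by (simp add: e uv right_diff_distrib sum_subtractf sum_distrib_left mult.left_commute del: index_mult_mat(1))
      have "form_defect (supercommutator m x y) u v = ?L (supercommutator m x y) + ksign (s + t) (fg u) * ?R (supercommutator m x y)"
        by (rule form_defect_homog[OF homog_mat_supercommutator[OF 6(3,4)] uv])
      also have "\<dots> = ksign s (t + fg u) * ksign t (fg u) * ?R (y * x) - ksign s t * (ksign t (s + fg u) * ksign s (fg u) * ?R (x * y))
        + ksign (s + t) (fg u) * (?R (x * y) - ksign s t * ?R (y * x))"
        unfolding L R form_product[OF 6(1,3,2,4) uv] form_product[OF 6(2,4,1,3) uv] ..
      also have "\<dots> = 0"
        by (cases s rule: bit_cases; cases t rule: bit_cases; cases "fg u" rule: bit_cases) simp_all
      finally show ?thesis .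
    qed
    moreover have "supercommutator m x y \<in> sl_set m n" using 6 by (intro sl.S_bracket) (auto simp: form_set_def)
    ultimately show ?case by (simp add: form_set_def)
  qed
qed

text \<open>Invariance of the dual form, whose Gram matrix is \<open>h\<close>.\<close>

lemma form_h_relation:
  assumes y: "y \<in> form_set" and aq: "a < fd" "q < fd"
  shows "(\<Sum>r<fd. y $$ (a, r) * h q r) = - (\<Sum>r<fd. ksign (fg q + fg r) (fg q + \<delta>) * y $$ (q, r) * h r a)"
proof -
  have "(\<Sum>r<fd. y $$ (a, r) * h q r) = (\<Sum>u<fd. h q u * (\<Sum>r<fd. y $$ (r, u) * (if r = a then 1 else 0)))"
  proof -
    have "(\<Sum>r<fd. y $$ (r, u) * (if r = a then 1 else 0)) = y $$ (a, u)" for u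
      using aq(1) by (simp add: if_distrib[of "(*) _"] cong: if_cong)
    then show ?thesis by (simp only: mult.commute)
  qed
  also have "\<dots> = (\<Sum>u<fd. h q u * (\<Sum>r<fd. y $$ (r, u) * (\<Sum>v<fd. g r v * h v a)))"
    by (intro sum.cong refl arg_cong2[of _ _ _ _ "(*)"]) (simp only: g_h[OF _ aq(1)] lessThan_iff)
  also have "\<dots> = (\<Sum>u<fd. h q u * (\<Sum>v<fd. (\<Sum>r<fd. y $$ (r, u) * g r v) * h v a))"
  proof (intro sum.cong refl)
    fix u
    have "(\<Sum>r<fd. y $$ (r, u) * (\<Sum>v<fd. g r v * h v a)) = (\<Sum>v<fd. (\<Sum>r<fd. y $$ (r, u) * g r v) * h v a)"
      unfolding sum_distrib_left sum_distrib_right by (subst sum.swap) (simp only: mult.assoc)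
    then show "h q u * (\<Sum>r<fd. y $$ (r, u) * (\<Sum>v<fd. g r v * h v a)) = h q u * (\<Sum>v<fd. (\<Sum>r<fd. y $$ (r, u) * g r v) * h v a)"
      by simp
  qed
  also have "\<dots> = (\<Sum>u<fd. h q u * (\<Sum>v<fd. (- (\<Sum>r<fd. ksign (fg r + fg v) (fg u) * g u r * y $$ (r, v))) * h v a))"
    by (intro sum.cong refl arg_cong2[of _ _ _ _ "(*)"]) (simp only: form_set_eq[OF y] lessThan_iff cong: sum.cong)
  also have "\<dots> = - (\<Sum>u<fd. \<Sum>v<fd. \<Sum>r<fd. (h q u * g u r) * (ksign (fg r + fg v) (fg q + \<delta>) * y $$ (r, v) * h v a))"
  proof -
    have "h q u * (\<Sum>v<fd. (- (\<Sum>r<fd. ksign (fg r + fg v) (fg u) * g u r * y $$ (r, v))) * h v a)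
      = - (\<Sum>v<fd. \<Sum>r<fd. (h q u * g u r) * (ksign (fg r + fg v) (fg q + \<delta>) * y $$ (r, v) * h v a))" if u: "u < fd" for u
    proof (cases "h q u = 0")
      case False
      then have "fg q + fg u = \<delta>" using h_degree aq u by simp
      then have fu: "fg u = fg q + \<delta>" by (cases "fg u" rule: bit_cases; cases "fg q" rule: bit_cases) auto
      show ?thesis unfolding fu
        by (simp only: sum_distrib_left sum_distrib_right sum_negf[symmetric] mult_minus_left mult_minus_right mult_ac)
    qed simp
    then show ?thesis by (simp add: sum_negf del: add_bit_eq_xor)
  qed
  also have "(\<Sum>u<fd. \<Sum>v<fd. \<Sum>r<fd. (h q u * g u r) * (ksign (fg r + fg v) (fg q + \<delta>) * y $$ (r, v) * h v a))
    = (\<Sum>v<fd. \<Sum>r<fd. \<Sum>u<fd. (h q u * g u r) * (ksign (fg r + fg v) (fg q + \<delta>) * y $$ (r, v) * h v a))"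
    by (rule trans[OF sum.swap], rule sum.cong[OF refl], rule sum.swap)
  also have "\<dots> = (\<Sum>v<fd. \<Sum>r<fd. (if q = r then 1 else 0) * (ksign (fg r + fg v) (fg q + \<delta>) * y $$ (r, v) * h v a))"
    by (intro sum.cong refl) (simp only: sum_distrib_right[symmetric] h_g[OF aq(2)] lessThan_iff)
  also have "\<dots> = (\<Sum>v<fd. ksign (fg q + fg v) (fg q + \<delta>) * y $$ (q, v) * h v a)"
  proof (intro sum.cong refl)
    fix v
    have "(\<Sum>r<fd. (if q = r then 1 else 0) * (ksign (fg r + fg v) (fg q + \<delta>) * y $$ (r, v) * h v a))
      = (\<Sum>r<fd. if r = q then ksign (fg q + fg v) (fg q + \<delta>) * y $$ (q, v) * h v a else 0)"
      by (intro sum.cong refl) auto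
    then show "(\<Sum>r<fd. (if q = r then 1 else 0) * (ksign (fg r + fg v) (fg q + \<delta>) * y $$ (r, v) * h v a))
      = ksign (fg q + fg v) (fg q + \<delta>) * y $$ (q, v) * h v a" using aq(2) by simp
  qed
  finally show ?thesis .
qed

text \<open>This is \<open>-\<theta>(E\<^bsub>i j\<^esub>)\<close> for the superadjoint \<open>\<theta>\<close> of the form, so that \<open>E\<^bsub>i j\<^esub> - \<theta>(E\<^bsub>i j\<^esub>)\<close> leaves the form
  invariant.\<close>

definition neg_adjoint_unit :: "nat \<Rightarrow> nat \<Rightarrow> nat \<Rightarrow> nat \<Rightarrow> 'k" where
  "neg_adjoint_unit i j a b = - (ksign (fg i + fg j) (fg b) * h j a * g b i)"

lemma neg_adjoint_homog:
  assumes "i < fd" "j < fd" "a < fd" "b < fd" "neg_adjoint_unit i j a b \<noteq> 0"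
  shows "fg a + fg b = fg i + fg j"
proof -
  have "fg j + fg a = \<delta>" "fg b + fg i = \<delta>"
    using assms h_degree g_degree by (auto simp: neg_adjoint_unit_def)
  then show ?thesis
    by (cases "fg j" rule: bit_cases; cases "fg a" rule: bit_cases; cases "fg b" rule: bit_cases; cases "fg i" rule: bit_cases) auto
qed

lemma unit_minus_adjoint_invariant:
  assumes ij: "i < fd" "j < fd" and uv: "u < fd" "v < fd"
  shows "form_defect (mat fd fd (\<lambda>(a, b). mat_unit i j a b + neg_adjoint_unit i j a b)) u v = 0"
proof -
  let ?T = "neg_adjoint_unit i j"
  \<comment> \<open>of the four sums, the first cancels with the fourth and the second with the third\<close>
  have 1: "(\<Sum>r<fd. mat_unit i j r u * g r v) = (if u = j then g i v else 0)"
    using sum_mat_unit(1)[OF ij, of "\<lambda>r. g r v" u] by (simp add: mult.commute)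
  have 2: "(\<Sum>r<fd. ksign (fg r + fg v) (fg u) * g u r * mat_unit i j r v)
    = (if v = j then ksign (fg i + fg j) (fg u) * g u i else 0)"
    using sum_mat_unit(1)[OF ij, of "\<lambda>r. ksign (fg r + fg v) (fg u) * g u r" v] by simp
  have 3: "(\<Sum>r<fd. ?T r u * g r v) = (if v = j then - (ksign (fg i + fg j) (fg u) * g u i) else 0)"
  proof -
    have "(\<Sum>r<fd. ?T r u * g r v) = - (ksign (fg i + fg j) (fg u) * g u i) * (\<Sum>r<fd. h j r * g r v)"
      unfolding sum_distrib_left neg_adjoint_unit_def by (intro sum.cong refl) (simp add: mult_ac del: add_bit_eq_xor)
    then show ?thesis using h_g[OF ij(2) uv(2)] by auto
  qed
  have 4: "(\<Sum>r<fd. ksign (fg r + fg v) (fg u) * g u r * ?T r v) = (if u = j then - g i v else 0)"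
  proof -
    have "ksign (fg r + fg v) (fg u) * g u r * ?T r v
      = - (ksign (fg u + \<delta> + fg v) (fg u) * ksign (fg i + fg j) (fg v) * g v i * \<zeta> * ksign (fg u) (fg u + \<delta>)) * (h j r * g r u)"
      if r: "r < fd" for r
    proof (cases "g u r = 0")
      case True
      have "\<zeta> * ksign (fg u) (fg r) * g r u = 0" using g_sym[OF uv(1) r] True by simp
      then have "\<zeta> = 0 \<or> g r u = 0" by (auto simp: ksign_def split: if_splits)
      then show ?thesis using True by auto
    next
      case False
      then have "fg u + fg r = \<delta>" using g_degree uv r by simp
      then have fr: "fg r = fg u + \<delta>" by (cases "fg u" rule: bit_cases; cases "fg r" rule: bit_cases) auto
      show ?thesis unfolding g_sym[OF uv(1) r] neg_adjoint_unit_def fr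
        by (simp only: mult_minus_left mult_minus_right mult_ac)
    qed
    then have S: "(\<Sum>r<fd. ksign (fg r + fg v) (fg u) * g u r * ?T r v)
      = - (ksign (fg u + \<delta> + fg v) (fg u) * ksign (fg i + fg j) (fg v) * g v i * \<zeta> * ksign (fg u) (fg u + \<delta>)) * (\<Sum>r<fd. h j r * g r u)"
      unfolding sum_distrib_left by (intro sum.cong refl) simp
    have K: "ksign (fg j + \<delta> + fg v) (fg j) * ksign (fg i + fg j) (fg v) * ksign (fg j) (fg j + \<delta>) = (ksign (fg i) (fg v) :: 'k)"
      by (cases "fg i" rule: bit_cases; cases "fg j" rule: bit_cases; cases "fg v" rule: bit_cases; cases \<delta> rule: bit_cases) simp_all
    have "ksign (fg j + \<delta> + fg v) (fg j) * ksign (fg i + fg j) (fg v) * g v i * \<zeta> * ksign (fg j) (fg j + \<delta>) = g i v"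
      unfolding g_sym[OF ij(1) uv(2)] K[symmetric] by (simp only: mult_ac)
    then show ?thesis unfolding S h_g[OF ij(2) uv(1)] by auto
  qed
  have "form_defect (mat fd fd (\<lambda>(a, b). mat_unit i j a b + ?T a b)) u v
    = (\<Sum>r<fd. mat_unit i j r u * g r v) + (\<Sum>r<fd. ?T r u * g r v)
      + ((\<Sum>r<fd. ksign (fg r + fg v) (fg u) * g u r * mat_unit i j r v) + (\<Sum>r<fd. ksign (fg r + fg v) (fg u) * g u r * ?T r v))"
    unfolding form_defect_def sum.distrib[symmetric] using uv
    by (intro arg_cong2[of _ _ _ _ "(+)"] sum.cong refl) (simp_all add: distrib_left distrib_right del: add_bit_eq_xor)
  then show ?thesis unfolding 1 2 3 4 by simp
qed

text \<open>The elements are \<open>E\<^bsub>i j\<^esub> - \<theta>(E\<^bsub>i j\<^esub>)\<close>. As \<open>g\<close> and \<open>h\<close> pair \<open>I\<close> only with itself, the bracket of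
  \<open>E\<^bsub>p w\<^esub>\<close> with \<open>\<theta>(E\<^bsub>w q\<^esub>)\<close> and that of \<open>\<theta>(E\<^bsub>p w\<^esub>)\<close> with \<open>E\<^bsub>w q\<^esub>\<close> vanish. The brackets of two corrections
  add up to \<open>-\<theta>(x)\<close> and a multiple of the supertrace of \<open>x\<close>, and \<open>-\<theta>(x) = x\<close> by invariance.\<close>

lemma form_section:
  assumes I: "I \<subseteq> {..<fd}" and w: "w < fd" "w \<notin> I"
    and block: "\<And>i j. i \<in> I \<Longrightarrow> j < fd \<Longrightarrow> j \<notin> I \<Longrightarrow> g i j = 0 \<and> g j i = 0"
  shows "\<exists>c e lam. equivariant_section m n form_set I w c e lam"
proof -
  interpret matrix_superalgebra m n form_set by (rule form_set_superalgebra)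
  let ?T = neg_adjoint_unit
  have lt: "p < fd" if "p \<in> I" for p using I that by auto
  have fin: "finite I" using I finite_subset by blast
  have hb: "h i j = 0" "h j i = 0" if "i \<in> I" "j < fd" "j \<notin> I" for i j
  proof -
    have pat: "(k \<in> I) = (i \<in> I)" if "k < fd" "i < fd" "g k i \<noteq> 0" for k i using block that by blast
    show "h i j = 0" using h_pattern[of "\<lambda>i. i \<in> I" "\<lambda>i. i \<in> I" i j] pat that lt by blast
    show "h j i = 0" using h_pattern[of "\<lambda>i. i \<in> I" "\<lambda>i. i \<in> I" j i] pat that lt by blast
  qed
  have out: "x $$ (a, b) = 0" if "x \<in> form_set" "supported I x" "a < fd" "b < fd" "a \<notin> I \<or> b \<notin> I" for x a b
  proof (rule ccontr)
    assume "x $$ (a, b) \<noteq> 0"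
    moreover have "a < dim_row x" "b < dim_col x" using that form_set_carrier[OF that(1)] by auto
    ultimately show False using that(2,5) unfolding supported_def by blast
  qed
  have restrict: "(\<Sum>r\<in>I. f r) = (\<Sum>r<fd. f r)" if "\<And>r. r < fd \<Longrightarrow> r \<notin> I \<Longrightarrow> f r = 0" for f :: "nat \<Rightarrow> 'k"
    by (rule sum.mono_neutral_left) (use I that in auto)
  have D: "mat fd fd (\<lambda>(a, b). mat_unit i j a b + ?T i j a b) \<in> form_set"
    if ij: "i < fd" "j < fd" and ne: "i \<in> I \<longleftrightarrow> j \<notin> I" for i j
  proof -
    have d: "mat_unit i j a a + ?T i j a a = 0" if a: "a < fd" for a
    proof -
      have "i \<noteq> j" using ne by auto
      then have "mat_unit i j a a = (0 :: 'k)" by (auto simp: mat_unit_def)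
      moreover have "h j a * g a i = 0"
      proof (cases "a \<in> I \<longleftrightarrow> i \<in> I")
        case True
        then have "h j a = 0" using hb ne a ij by metis
        then show ?thesis by simp
      next
        case False
        then have "g a i = 0" using block a ij by metis
        then show ?thesis by simp
      qed
      ultimately show ?thesis by (simp add: neg_adjoint_unit_def)
    qed
    then show ?thesis using unit_minus_adjoint_invariant[OF ij]
      by (simp add: form_set_def sl_set_def supertrace_def)
  qed
  have "corrected_units m n form_set I w ?T 2"
  proof (unfold_locales, goal_cases)
    case 1
    show ?case by (rule I)
  next
    case 2
    show ?case by (rule w(1))
  next
    case 3
    show ?case by (rule w(2))
  next
    case 4
    show ?case by simp
  next
    case (5 x)
    then show ?case by (simp add: form_set_def sl_set_def)
  next
    case (6 i j a b)
    then show ?case by (rule neg_adjoint_homog)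
  next
    case (7 p)
    then show ?case using D[of p w] lt w by blast
  next
    case (8 p)
    then show ?case using D[of w p] lt w by blast
  next
    case (9 y p a b)
    note p = lt[OF 9(3)]
    have "super_prod m n (\<lambda>a b. y $$ (a, b)) (?T p w) a b
      = (\<Sum>r<fd. (h w a * ksign (fg p + fg w) (fg b)) * (y $$ (r, b) * g r p))"
      unfolding super_prod_def
    proof (intro sum.cong refl)
      fix r assume "r \<in> {..<fd}"
      then have r: "r < fd" by simp
      have F1: "y $$ (a, r) * ?T p w r b = 0"
        using out[OF 9(1,2,4) r] hb(2)[OF _ w] by (cases "r \<in> I") (simp_all add: neg_adjoint_unit_def)
      have F2: "- (ksign (fg a + fg r) (fg r + fg b) * ?T p w a r * y $$ (r, b))
        = (h w a * ksign (fg p + fg w) (fg b)) * (y $$ (r, b) * g r p)"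
      proof (cases "h w a = 0 \<or> g r p = 0")
        case True
        then show ?thesis by (auto simp: neg_adjoint_unit_def)
      next
        case False
        then have "fg w + fg a = \<delta>" "fg r + fg p = \<delta>" using h_degree g_degree w(1) 9(4) r p by auto
        then have "fg a = fg w + (fg r + fg p)" by (cases "fg w" rule: bit_cases; cases "fg a" rule: bit_cases) auto
        then have K: "ksign (fg a + fg r) (fg r + fg b) * ksign (fg p + fg w) (fg r) = (ksign (fg p + fg w) (fg b) :: 'k)"
          by (cases "fg w" rule: bit_cases; cases "fg r" rule: bit_cases; cases "fg p" rule: bit_cases; cases "fg b" rule: bit_cases) simp_all
        show ?thesis unfolding neg_adjoint_unit_def K[symmetric] by (simp add: mult_ac del: add_bit_eq_xor)
      qed
      show "y $$ (a, r) * ?T p w r b - ksign (fg a + fg r) (fg r + fg b) * ?T p w a r * y $$ (r, b)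
        = (h w a * ksign (fg p + fg w) (fg b)) * (y $$ (r, b) * g r p)"
        unfolding F1 diff_0 F2 ..
    qed
    also have "\<dots> = (h w a * ksign (fg p + fg w) (fg b)) * - (\<Sum>r<fd. ksign (fg r + fg p) (fg b) * g b r * y $$ (r, p))"
      unfolding sum_distrib_left[symmetric] form_set_eq[OF 9(1) 9(5) p] ..
    also have "\<dots> = (\<Sum>r<fd. y $$ (r, p) * ?T r w a b)"
      unfolding sum_negf[symmetric] sum_distrib_left
    proof (intro sum.cong refl)
      fix r
      have K: "ksign (fg p + fg w) (fg b) * ksign (fg r + fg p) (fg b) = (ksign (fg r + fg w) (fg b) :: 'k)"
        by (cases "fg w" rule: bit_cases; cases "fg r" rule: bit_cases; cases "fg p" rule: bit_cases; cases "fg b" rule: bit_cases) simp_all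
      show "h w a * ksign (fg p + fg w) (fg b) * - (ksign (fg r + fg p) (fg b) * g b r * y $$ (r, p)) = y $$ (r, p) * ?T r w a b"
        unfolding neg_adjoint_unit_def K[symmetric] by (simp add: mult_ac del: add_bit_eq_xor)
    qed
    also have "\<dots> = (\<Sum>r\<in>I. y $$ (r, p) * ?T r w a b)"
      by (rule restrict[symmetric]) (use out[OF 9(1,2) _ p] in auto)
    finally show ?case .
  next
    case (10 y q a b)
    note q = lt[OF 10(3)]
    have "super_prod m n (\<lambda>a b. y $$ (a, b)) (?T w q) a b
      = (\<Sum>r<fd. - (ksign (fg w + fg q) (fg b) * g b w) * (y $$ (a, r) * h q r))"
      unfolding super_prod_def
    proof (intro sum.cong refl)
      fix r assume "r \<in> {..<fd}"
      then have r: "r < fd" by simp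
      have "?T w q a r * y $$ (r, b) = 0"
        using out[OF 10(1,2) r 10(5)] block[OF _ w] by (cases "r \<in> I") (simp_all add: neg_adjoint_unit_def)
      then show "y $$ (a, r) * ?T w q r b - ksign (fg a + fg r) (fg r + fg b) * ?T w q a r * y $$ (r, b)
        = - (ksign (fg w + fg q) (fg b) * g b w) * (y $$ (a, r) * h q r)"
        unfolding mult.assoc[of _ "?T w q a r"] by (simp add: neg_adjoint_unit_def)
    qed
    also have "\<dots> = (ksign (fg w + fg q) (fg b) * g b w) * (\<Sum>r<fd. ksign (fg q + fg r) (fg q + \<delta>) * y $$ (q, r) * h r a)"
      unfolding sum_distrib_left[symmetric] form_h_relation[OF 10(1,4) q] by simp
    also have "\<dots> = - (\<Sum>r<fd. ksign (fg q + fg r) (fg w + fg q) * y $$ (q, r) * ?T w r a b)"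
      unfolding sum_negf[symmetric] sum_distrib_left
    proof (intro sum.cong refl)
      fix r
      show "ksign (fg w + fg q) (fg b) * g b w * (ksign (fg q + fg r) (fg q + \<delta>) * y $$ (q, r) * h r a)
        = - (ksign (fg q + fg r) (fg w + fg q) * y $$ (q, r) * ?T w r a b)"
      proof (cases "g b w = 0")
        case False
        then have "fg b + fg w = \<delta>" using g_degree 10(5) w(1) by simp
        then have K: "ksign (fg w + fg q) (fg b) * ksign (fg q + fg r) (fg q + \<delta>)
          = (ksign (fg q + fg r) (fg w + fg q) * ksign (fg w + fg r) (fg b) :: 'k)"
          by (cases "fg w" rule: bit_cases; cases "fg r" rule: bit_cases; cases "fg q" rule: bit_cases; cases "fg b" rule: bit_cases) simp_all
        show ?thesis unfolding neg_adjoint_unit_def using sign_rearrange(1)[OF K] by simp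
      qed (simp add: neg_adjoint_unit_def)
    qed
    also have "(\<Sum>r<fd. ksign (fg q + fg r) (fg w + fg q) * y $$ (q, r) * ?T w r a b)
      = (\<Sum>r\<in>I. ksign (fg q + fg r) (fg w + fg q) * y $$ (q, r) * ?T w r a b)"
      by (rule restrict[symmetric]) (use out[OF 10(1,2) q] in auto)
    finally show ?case .
  next
    case (11 x a b)
    \<comment> \<open>the terms of \<open>-\<theta>(x)\<close> and those of the supertrace\<close>
    let ?X = "\<lambda>p q. - (g b p * (ksign (fg p + fg q) (fg p + \<delta>) * x $$ (p, q) * h q a))"
    let ?Y = "\<lambda>p q. (if q = p then (h w a * g b w * ksign (fg w) (fg w)) * (ksign (fg p) (fg p) * x $$ (p, p)) else 0)"
    have "(\<Sum>p\<in>I. \<Sum>q\<in>I. x $$ (p, q) * (super_prod m n (mat_unit p w) (?T w q) a b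
        + super_prod m n (?T p w) (mat_unit w q) a b + super_prod m n (?T p w) (?T w q) a b))
      = (\<Sum>p\<in>I. \<Sum>q\<in>I. ?X p q + ?Y p q)"
    proof (intro sum.cong refl)
      fix p q assume pI: "p \<in> I" and qI: "q \<in> I"
      note p = lt[OF pI] and q = lt[OF qI]
      have z: "?T w q w b = 0" "?T w q a p = 0" "?T p w a w = 0" "?T p w q b = 0"
        using hb[OF qI w] block[OF pI w] by (simp_all add: neg_adjoint_unit_def)
      have 1: "super_prod m n (mat_unit p w) (?T w q) a b = 0"
        unfolding super_prod_mat_unit_left[OF p w(1)] z by simp
      have 2: "super_prod m n (?T p w) (mat_unit w q) a b = 0"
        unfolding super_prod_mat_unit_right[OF w(1) q] z by simp
      have "super_prod m n (?T p w) (?T w q) a b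
        = (\<Sum>r<fd. h w a * g b w * ksign (fg w) (fg w) * ksign (fg p) (fg q) * (h q r * g r p)
          - ksign (fg p + fg q) (fg p + \<delta>) * g b p * h q a * (h w r * g r w))"
        unfolding super_prod_def
      proof (intro sum.cong refl)
        fix r assume "r \<in> {..<fd}"
        then have r: "r < fd" by simp
        have A: "?T p w a r * ?T w q r b = h w a * g b w * ksign (fg w) (fg w) * ksign (fg p) (fg q) * (h q r * g r p)"
        proof (cases "g r p = 0 \<or> g b w = 0 \<or> h q r = 0")
          case True
          then show ?thesis by (auto simp: neg_adjoint_unit_def)
        next
          case False
          then have "fg r + fg p = \<delta>" "fg b + fg w = \<delta>" "fg q + fg r = \<delta>" using g_degree h_degree r p q w(1) 11(4) by auto
          then have K: "ksign (fg p + fg w) (fg r) * ksign (fg w + fg q) (fg b) = (ksign (fg w) (fg w) * ksign (fg p) (fg q) :: 'k)"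
            by (cases "fg w" rule: bit_cases; cases "fg r" rule: bit_cases; cases "fg q" rule: bit_cases; cases "fg p" rule: bit_cases; cases "fg b" rule: bit_cases) auto
          show ?thesis unfolding neg_adjoint_unit_def using sign_rearrange(2)[OF K] by simp
        qed
        have B: "ksign (fg a + fg r) (fg r + fg b) * ?T w q a r * ?T p w r b
          = ksign (fg p + fg q) (fg p + \<delta>) * g b p * h q a * (h w r * g r w)"
        proof (cases "g r w = 0 \<or> g b p = 0 \<or> h q a = 0")
          case True
          then show ?thesis by (auto simp: neg_adjoint_unit_def)
        next
          case False
          then have d: "fg r + fg w = \<delta>" "fg b + fg p = \<delta>" "fg q + fg a = \<delta>" using g_degree h_degree r p q w(1) 11(3,4) by auto
          have K: "ksign (fg a + fg r) (fg r + fg b) * ksign (fg w + fg q) (fg r) * ksign (fg p + fg w) (fg b)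
            = (ksign (fg p + fg q) (fg p + \<delta>) :: 'k)"
            using d by (cases "fg w" rule: bit_cases; cases "fg r" rule: bit_cases; cases "fg q" rule: bit_cases; cases "fg p" rule: bit_cases; cases "fg b" rule: bit_cases; cases "fg a" rule: bit_cases) auto
          show ?thesis unfolding neg_adjoint_unit_def using sign_rearrange(3)[OF K] by simp
        qed
        show "?T p w a r * ?T w q r b - ksign (fg a + fg r) (fg r + fg b) * ?T w q a r * ?T p w r b
          = h w a * g b w * ksign (fg w) (fg w) * ksign (fg p) (fg q) * (h q r * g r p)
          - ksign (fg p + fg q) (fg p + \<delta>) * g b p * h q a * (h w r * g r w)"
          unfolding A B ..
      qed
      also have "\<dots> = h w a * g b w * ksign (fg w) (fg w) * ksign (fg p) (fg q) * (if q = p then 1 else 0)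
        - ksign (fg p + fg q) (fg p + \<delta>) * g b p * h q a"
        unfolding sum_subtractf sum_distrib_left[symmetric] h_g[OF q p] h_g[OF w(1) w(1)] by simp
      finally have 3: "super_prod m n (?T p w) (?T w q) a b
        = h w a * g b w * ksign (fg w) (fg w) * ksign (fg p) (fg q) * (if q = p then 1 else 0)
        - ksign (fg p + fg q) (fg p + \<delta>) * g b p * h q a" .
      show "x $$ (p, q) * (super_prod m n (mat_unit p w) (?T w q) a b
        + super_prod m n (?T p w) (mat_unit w q) a b + super_prod m n (?T p w) (?T w q) a b) = ?X p q + ?Y p q"
        unfolding 1 2 3 by (cases "q = p") (simp_all add: algebra_simps del: add_bit_eq_xor)
    qed
    also have "\<dots> = (\<Sum>p\<in>I. \<Sum>q\<in>I. ?X p q) + (\<Sum>p\<in>I. \<Sum>q\<in>I. ?Y p q)"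
      by (simp only: sum.distrib)
    also have "(\<Sum>p\<in>I. \<Sum>q\<in>I. ?Y p q) = (h w a * g b w * ksign (fg w) (fg w)) * supertrace m n x"
    proof -
      have "supertrace m n x = (\<Sum>p\<in>I. ksign (fg p) (fg p) * x $$ (p, p))"
        unfolding supertrace_def by (rule restrict[symmetric]) (use out[OF 11(1,2)] in auto)
      then show ?thesis using fin by (simp add: sum_distrib_left)
    qed
    also have "(\<Sum>p\<in>I. \<Sum>q\<in>I. ?X p q) = (\<Sum>p<fd. g b p * - (\<Sum>q<fd. ksign (fg p + fg q) (fg p + \<delta>) * x $$ (p, q) * h q a))"
    proof -
      have "(\<Sum>p\<in>I. \<Sum>q\<in>I. ?X p q) = (\<Sum>p\<in>I. \<Sum>q<fd. ?X p q)"
        by (intro sum.cong refl restrict) (use out[OF 11(1,2) lt] in auto)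
      also have "\<dots> = (\<Sum>p<fd. \<Sum>q<fd. ?X p q)"
        by (intro restrict sum.neutral) (use out[OF 11(1,2)] in auto)
      finally show ?thesis by (simp only: sum_distrib_left sum_negf mult_minus_right)
    qed
    also have "\<dots> = (\<Sum>p<fd. g b p * (\<Sum>r<fd. x $$ (a, r) * h p r))"
      by (intro sum.cong refl) (simp only: form_h_relation[OF 11(1,3)] lessThan_iff)
    also have "\<dots> = (\<Sum>r<fd. x $$ (a, r) * (\<Sum>p<fd. g b p * h p r))"
      unfolding sum_distrib_left by (subst sum.swap) (simp only: mult.left_commute)
    also have "\<dots> = (\<Sum>r<fd. if r = b then x $$ (a, b) else 0)"
      by (intro sum.cong refl) (auto simp: g_h[OF 11(4)])
    also have "\<dots> = x $$ (a, b)" using 11(4) by simp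
    finally show ?case using 11(1) by (simp add: form_set_def sl_set_def)
  qed
  then interpret corrected_units m n form_set I w ?T 2 .
  show ?thesis using equivariant_section by blast
qed

end

section \<open>The Gram matrix of a form\<close>

lemma linear_on_vec:
  fixes f :: "'k :: field vec \<Rightarrow> 'k"
  assumes add: "\<And>u v. u \<in> carrier_vec d \<Longrightarrow> v \<in> carrier_vec d \<Longrightarrow> f (u + v) = f u + f v"
    and smult: "\<And>c u. u \<in> carrier_vec d \<Longrightarrow> f (c \<cdot>\<^sub>v u) = c * f u"
    and u: "u \<in> carrier_vec d"
  shows "f u = (\<Sum>i<d. u $ i * f (unit_vec d i))"
proof -
  have "f (vec d (\<lambda>i. if i < k then u $ i else 0)) = (\<Sum>i<k. u $ i * f (unit_vec d i))" if "k \<le> d" for k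
    using that
  proof (induction k)
    case 0
    have "vec d (\<lambda>i. if i < 0 then u $ i else 0) = 0 \<cdot>\<^sub>v u" by (rule eq_vecI) (use u in auto)
    then show ?case using smult[OF u, of 0] by simp
  next
    case (Suc k)
    have e: "vec d (\<lambda>i. if i < Suc k then u $ i else 0)
      = vec d (\<lambda>i. if i < k then u $ i else 0) + u $ k \<cdot>\<^sub>v unit_vec d k"
      by (rule eq_vecI) (use Suc.prems in \<open>auto simp: unit_vec_def less_Suc_eq\<close>)
    show ?case unfolding e using Suc by (simp add: add smult)
  qed
  from this[of d] have "f (vec d (\<lambda>i. if i < d then u $ i else 0)) = (\<Sum>i<d. u $ i * f (unit_vec d i))" by simp
  moreover have "vec d (\<lambda>i. if i < d then u $ i else 0) = u" by (rule eq_vecI) (use u in auto)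
  ultimately show ?thesis by simp
qed

definition gram :: "nat \<Rightarrow> ('k :: field vec \<Rightarrow> 'k vec \<Rightarrow> 'k) \<Rightarrow> nat \<Rightarrow> nat \<Rightarrow> 'k" where
  "gram d b i j = b (unit_vec d i) (unit_vec d j)"

lemma bilinear_formD:
  assumes "bilinear_form d b" "u \<in> carrier_vec d" "v \<in> carrier_vec d"
  shows "w \<in> carrier_vec d \<Longrightarrow> b (u + v) w = b u w + b v w"
    and "w \<in> carrier_vec d \<Longrightarrow> b w (u + v) = b w u + b w v"
    and "b (c \<cdot>\<^sub>v u) v = c * b u v" and "b u (c \<cdot>\<^sub>v v) = c * b u v"
  using assms unfolding bilinear_form_def by blast+

lemma bilinear_form_left:
  assumes b: "bilinear_form d b" and u: "u \<in> carrier_vec d" and v: "v \<in> carrier_vec d"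
  shows "b u v = (\<Sum>i<d. u $ i * b (unit_vec d i) v)"
  by (rule linear_on_vec[where f = "\<lambda>u. b u v", OF _ _ u])
    (simp_all add: bilinear_formD[OF b] v)

lemma bilinear_form_right:
  assumes b: "bilinear_form d b" and u: "u \<in> carrier_vec d" and v: "v \<in> carrier_vec d"
  shows "b u v = (\<Sum>j<d. v $ j * b u (unit_vec d j))"
  by (rule linear_on_vec[where f = "\<lambda>v. b u v", OF _ _ v])
    (simp_all add: bilinear_formD[OF b] u)

text \<open>A vector in the kernel of the Gram matrix is orthogonal to all basis vectors.\<close>

lemma gram_inverse:
  fixes b :: "'k :: field vec \<Rightarrow> 'k vec \<Rightarrow> 'k"
  assumes b: "bilinear_form d b" and nd: "nondegenerate d b"
  shows "\<exists>h. (\<forall>i<d. \<forall>j<d. (\<Sum>r<d. gram d b i r * h r j) = (if i = j then 1 else 0)) \<and>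
    (\<forall>i<d. \<forall>j<d. (\<Sum>r<d. h i r * gram d b r j) = (if i = j then 1 else 0))"
proof -
  define A where "A = mat d d (\<lambda>(i, j). gram d b i j)"
  have A: "A \<in> carrier_mat d d" by (simp add: A_def)
  have "det A \<noteq> 0"
  proof
    assume "det A = 0"
    then obtain v where v: "v \<in> carrier_vec d" "v \<noteq> 0\<^sub>v d" "A *\<^sub>v v = 0\<^sub>v d"
      using det_0_iff_vec_prod_zero_field[OF A] by blast
    have "b (unit_vec d i) v = 0" if i: "i < d" for i
    proof -
      have "b (unit_vec d i) v = (\<Sum>j<d. v $ j * b (unit_vec d i) (unit_vec d j))"
        by (rule bilinear_form_right[OF b _ v(1)]) simp
      also have "\<dots> = (A *\<^sub>v v) $ i"
        using i v(1) by (auto simp: A_def gram_def scalar_prod_def lessThan_atLeast0 mult.commute intro!: sum.cong)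
      finally show ?thesis using v(3) i by simp
    qed
    then have "b u v = 0" if "u \<in> carrier_vec d" for u
      using bilinear_form_left[OF b that v(1)] by simp
    then show False using nd v(1,2) unfolding nondegenerate_def by blast
  qed
  then have "A \<in> Units (ring_mat TYPE('k) d ())" by (rule det_non_zero_imp_unit[OF A])
  then obtain B where B: "B \<in> carrier_mat d d" "B * A = 1\<^sub>m d" "A * B = 1\<^sub>m d"
    unfolding Units_def ring_mat_def by auto
  have e: "(X * Y) $$ (i, j) = (\<Sum>r<d. X $$ (i, r) * Y $$ (r, j))"
    if "X \<in> carrier_mat d d" "Y \<in> carrier_mat d d" "i < d" "j < d" for X Y :: "'k mat" and i j
    using that by (auto simp: scalar_prod_def lessThan_atLeast0)
  show ?thesis
  proof (intro exI[of _ "\<lambda>i j. B $$ (i, j)"] conjI allI impI)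
    fix i j assume ij: "i < d" "j < d"
    show "(\<Sum>r<d. gram d b i r * B $$ (r, j)) = (if i = j then 1 else 0)"
      using e[OF A B(1) ij] ij unfolding B(3) by (simp add: A_def)
    show "(\<Sum>r<d. B $$ (i, r) * gram d b r j) = (if i = j then 1 else 0)"
      using e[OF B(1) A ij] ij unfolding B(2) by (simp add: A_def)
  qed
qed

lemma unit_vec_homog: "i < m + n \<Longrightarrow> unit_vec (m + n) i \<in> homog_vec m n (coord_degree m i)"
  by (auto simp: homog_vec_def unit_vec_def)

lemma super_form_of:
  fixes b :: "'k :: field_char_0 vec \<Rightarrow> 'k vec \<Rightarrow> 'k"
  assumes b: "bilinear_form (m + n) b" and nd: "nondegenerate (m + n) b" and deg: "form_of_degree m n \<delta> b"
    and sym: "\<And>p q u v. u \<in> homog_vec m n p \<Longrightarrow> v \<in> homog_vec m n q \<Longrightarrow> b u v = \<zeta> * ksign p q * b v u"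
  shows "\<exists>h. super_form m n (gram (m + n) b) h \<delta> \<zeta>"
proof -
  obtain h where h: "\<forall>i<m + n. \<forall>j<m + n. (\<Sum>r<m + n. gram (m + n) b i r * h r j) = (if i = j then 1 else 0)"
    "\<forall>i<m + n. \<forall>j<m + n. (\<Sum>r<m + n. h i r * gram (m + n) b r j) = (if i = j then 1 else 0)"
    using gram_inverse[OF b nd] by (elim exE conjE)
  have "super_form m n (gram (m + n) b) h \<delta> \<zeta>"
  proof
    fix i j assume ij: "i < m + n" "j < m + n"
    note u = unit_vec_homog[OF ij(1)] unit_vec_homog[OF ij(2)]
    show "coord_degree m i + coord_degree m j = \<delta>" if "gram (m + n) b i j \<noteq> 0"
      using deg u that unfolding form_of_degree_def gram_def by blast
    show "gram (m + n) b i j = \<zeta> * ksign (coord_degree m i) (coord_degree m j) * gram (m + n) b j i"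
      unfolding gram_def by (rule sym[OF u])
  qed (use h in auto)
  then show ?thesis by blast
qed

lemma osp_super_form:
  assumes "osp_form m n b"
  shows "\<exists>h. super_form m n (gram (m + n) b) h 0 1"
proof -
  have a: "bilinear_form (m + n) b" "nondegenerate (m + n) b" "form_of_degree m n 0 b" "supersymmetric m n b"
    using assms unfolding osp_form_def by blast+
  show ?thesis
    by (rule super_form_of[OF a(1-3)], unfold mult_1, rule a(4)[unfolded supersymmetric_def, rule_format])
qed

lemma SP_super_form:
  assumes "SP_form m b"
  shows "\<exists>h. super_form m m (gram (m + m) b) h 1 (- 1)"
proof -
  have a: "bilinear_form (m + m) b" "nondegenerate (m + m) b" "form_of_degree m m 1 b" "super_antisymmetric m m b"
    using assms unfolding SP_form_def by blast+
  show ?thesis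
    by (rule super_form_of[OF a(1-3)], unfold mult_minus_left mult_1,
      rule a(4)[unfolded super_antisymmetric_def, rule_format])
qed

lemma homog_vec_carrier: "u \<in> homog_vec m n p \<Longrightarrow> u \<in> carrier_vec (m + n)"
  by (simp add: homog_vec_def)

text \<open>The coordinate vectors are homogeneous. Conversely, only coordinate vectors of degree \<open>q\<close> occur in a
  vector \<open>u\<close> of degree \<open>q\<close>, so that the sign is the same for all of them and bilinearity applies.\<close>

lemma (in super_form) leaves_invariant_iff:
  assumes b: "bilinear_form (m + n) b" and g: "g = gram (m + n) b" and x: "x \<in> homog_mat m n p"
  shows "leaves_invariant m n b p x \<longleftrightarrow> (\<forall>u<m + n. \<forall>v<m + n. form_defect x u v = 0)"
proof -
  have cx: "x \<in> carrier_mat (m + n) (m + n)" by (rule homog_mat_carrier[OF x])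
  have xe: "(x *\<^sub>v unit_vec (m + n) u) $ r = x $$ (r, u)" if "r < m + n" "u < m + n" for r u
    using cx that by (simp add: scalar_prod_right_unit)
  have xc: "x *\<^sub>v u \<in> carrier_vec (m + n)" if "u \<in> carrier_vec (m + n)" for u
    using cx that by simp
  have F: "form_defect x u v = b (x *\<^sub>v unit_vec (m + n) u) (unit_vec (m + n) v)
    + ksign p (coord_degree m u) * b (unit_vec (m + n) u) (x *\<^sub>v unit_vec (m + n) v)" if uv: "u < m + n" "v < m + n" for u v
  proof -
    have "b (x *\<^sub>v unit_vec (m + n) u) (unit_vec (m + n) v) = (\<Sum>r<m + n. x $$ (r, u) * g r v)"
      using bilinear_form_left[OF b xc[of "unit_vec (m + n) u"], of "unit_vec (m + n) v"] uv
      by (simp add: xe g gram_def)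
    moreover have "b (unit_vec (m + n) u) (x *\<^sub>v unit_vec (m + n) v) = (\<Sum>r<m + n. g u r * x $$ (r, v))"
      using bilinear_form_right[OF b _ xc[of "unit_vec (m + n) v"], of "unit_vec (m + n) u"] uv
      by (simp add: xe g gram_def mult.commute)
    ultimately show ?thesis unfolding form_defect_homog[OF x uv] by simp
  qed
  show ?thesis
  proof
    assume "leaves_invariant m n b p x"
    then show "\<forall>u<m + n. \<forall>v<m + n. form_defect x u v = 0"
      unfolding leaves_invariant_def using F unit_vec_homog by metis
  next
    assume d: "\<forall>u<m + n. \<forall>v<m + n. form_defect x u v = 0"
    show "leaves_invariant m n b p x"
      unfolding leaves_invariant_def
    proof (intro allI ballI)
      fix q r and u v :: "'k vec" assume u: "u \<in> homog_vec m n q" and v: "v \<in> homog_vec m n r"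
      note cu = homog_vec_carrier[OF u] and cv = homog_vec_carrier[OF v]
      define \<Phi> where "\<Phi> s t = b (x *\<^sub>v s) t + ksign p q * b s (x *\<^sub>v t)" for s t
      note bf = bilinear_formD[OF b]
      have lin: "x *\<^sub>v (s + t) = x *\<^sub>v s + x *\<^sub>v t" "x *\<^sub>v (c \<cdot>\<^sub>v s) = c \<cdot>\<^sub>v (x *\<^sub>v s)"
        if "s \<in> carrier_vec (m + n)" "t \<in> carrier_vec (m + n)" for s t c
        using mult_add_distrib_mat_vec[OF cx that] mult_mat_vec[OF cx that(1)] by auto
      have 1: "\<Phi> u v = (\<Sum>i<m + n. u $ i * \<Phi> (unit_vec (m + n) i) v)"
        by (rule linear_on_vec[where f = "\<lambda>u. \<Phi> u v", OF _ _ cu])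
          (simp_all add: \<Phi>_def lin bf xc cv algebra_simps)
      have 2: "\<Phi> s v = (\<Sum>j<m + n. v $ j * \<Phi> s (unit_vec (m + n) j))" if s: "s \<in> carrier_vec (m + n)" for s
        by (rule linear_on_vec[where f = "\<lambda>v. \<Phi> s v", OF _ _ cv])
          (simp_all add: \<Phi>_def lin bf xc s algebra_simps)
      have "u $ i * \<Phi> (unit_vec (m + n) i) v = 0" if i: "i < m + n" for i
      proof (cases "coord_degree m i = q")
        case True
        then have "\<Phi> (unit_vec (m + n) i) (unit_vec (m + n) j) = 0" if "j < m + n" for j
          using F[OF i that] d i that unfolding \<Phi>_def by simp
        then show ?thesis using 2[of "unit_vec (m + n) i"] by simp
      next
        case False
        then show ?thesis using u i by (simp add: homog_vec_def)
      qed
      then have "\<Phi> u v = 0" unfolding 1 by (intro sum.neutral) simp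
      then show "b (x *\<^sub>v u) v + ksign p q * b u (x *\<^sub>v v) = 0"
        unfolding \<Phi>_def .
    qed
  qed
qed

text \<open>A matrix in \<open>form_set\<close> is the sum of its homogeneous components, which lie in \<open>form_set\<close> again; so the
  homogeneous invariant matrices span it.\<close>

lemma (in super_form) form_superalgebra_eq:
  assumes b: "bilinear_form (m + n) b" and g: "g = gram (m + n) b"
  shows "form_superalgebra m n b = subsuperalgebra (gl m n) form_set"
proof -
  interpret sl: matrix_superalgebra m n "sl_set m n :: 'k mat set" by (rule sl_set_superalgebra)
  interpret F: matrix_superalgebra m n form_set by (rule form_set_superalgebra)
  let ?X = "{x. \<exists>p. x \<in> homog (sl m n) p \<and> leaves_invariant m n b p x}"
  have X: "x \<in> ?X \<longleftrightarrow> (\<exists>p. x \<in> homog_mat m n p \<and> x \<in> form_set)" for x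
    using leaves_invariant_iff[OF b g, of x] by (auto simp: sl_eq form_set_def)
  have sub: "VectorSpace.subspace class_ring form_set (sl m n)"
    unfolding sl_eq subspace_iff[OF sl.G_vspace]
    using F.S_zero F.S_add F.S_smult by (auto simp: form_set_def)
  have vs: "vspace (sl m n :: ('k, 'k mat) superalgebra)" unfolding sl_eq by (rule sl.G_vspace)
  have Xc: "?X \<subseteq> carrier (sl m n)" using X by (auto simp: sl_eq form_set_def)
  have "?X \<subseteq> form_set" using X by blast
  then have 1: "lspan (sl m n) ?X \<subseteq> form_set" by (rule lspan_minimal[OF vs sub])
  have 2: "form_set \<subseteq> lspan (sl m n) ?X"
  proof
    fix x assume x: "x \<in> form_set"
    have c: "mat_component m p x \<in> lspan (sl m n) ?X" for p
    proof -
      have "mat_component m p x \<in> ?X"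
        unfolding X using F.S_component[OF x] mat_component_homog[OF form_set_carrier[OF x]] by blast
      then show ?thesis using lspan_superset[OF vs Xc] by blast
    qed
    have "mat_component m 0 x \<oplus>\<^bsub>sl m n\<^esub> mat_component m 1 x \<in> lspan (sl m n) ?X"
      using lspan_subspace[OF vs Xc] c unfolding subspace_iff[OF vs] by simp
    then show "x \<in> lspan (sl m n) ?X"
      using mat_component_sum[OF form_set_carrier[OF x]] by (simp add: sl_eq)
  qed
  have "form_set \<subseteq> (sl_set m n :: 'k mat set)" by (auto simp: form_set_def)
  then show ?thesis
    unfolding form_superalgebra_def using equalityI[OF 1 2] by (simp only: sl_eq subsuperalgebra_twice)
qed

section \<open>Natural inclusions of matrix superalgebras\<close>

locale natural_inclusion =
  fixes m n m' n' :: nat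
  assumes mn: "m \<le> m'" "n \<le> n'"
begin

text \<open>Even coordinates are numbered before odd ones, so the odd ones move up.\<close>

definition \<iota> :: "nat \<Rightarrow> nat" where
  "\<iota> i = (if i < m then i else i - m + m')"

abbreviation "I \<equiv> \<iota> ` {..<m + n}"

lemma \<iota>_less: "i < m + n \<Longrightarrow> \<iota> i < m' + n'"
  using mn by (auto simp: \<iota>_def)

lemma \<iota>_eq_iff: "i < m + n \<Longrightarrow> j < m + n \<Longrightarrow> \<iota> i = \<iota> j \<longleftrightarrow> i = j"
  using mn by (auto simp: \<iota>_def)

lemma \<iota>_degree: "coord_degree m' (\<iota> i) = coord_degree m i"
  using mn by (auto simp: \<iota>_def coord_degree_def)

lemma I_less: "I \<subseteq> {..<m' + n'}"
  using \<iota>_less by auto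

lemma sum_\<iota>:
  fixes f :: "nat \<Rightarrow> 'b :: comm_monoid_add"
  assumes "\<And>r. r < m' + n' \<Longrightarrow> r \<notin> I \<Longrightarrow> f r = 0"
  shows "(\<Sum>r<m' + n'. f r) = (\<Sum>i<m + n. f (\<iota> i))"
proof -
  have "inj_on \<iota> {..<m + n}" by (rule inj_onI) (simp add: \<iota>_eq_iff)
  then have "(\<Sum>i<m + n. f (\<iota> i)) = (\<Sum>r\<in>I. f r)" by (simp add: sum.reindex)
  also have "\<dots> = (\<Sum>r<m' + n'. f r)" by (rule sum.mono_neutral_left) (use I_less assms in auto)
  finally show ?thesis by simp
qed

lemma incl_mat_carrier: "incl_mat m m' n' x \<in> carrier_mat (m' + n') (m' + n')"
  by (auto simp: incl_mat_def split_block_def Let_def pad_mat_def)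

lemma incl_mat_entry:
  assumes x: "x \<in> carrier_mat (m + n) (m + n)"
  shows "i < m + n \<Longrightarrow> j < m + n \<Longrightarrow> incl_mat m m' n' x $$ (\<iota> i, \<iota> j) = x $$ (i, j)"
    and "a < m' + n' \<Longrightarrow> b < m' + n' \<Longrightarrow> a \<notin> I \<or> b \<notin> I \<Longrightarrow> incl_mat m m' n' x $$ (a, b) = 0"
proof -
  show "incl_mat m m' n' x $$ (\<iota> i, \<iota> j) = x $$ (i, j)" if "i < m + n" "j < m + n"
    using x that mn by (auto simp: incl_mat_def split_block_def Let_def pad_mat_def \<iota>_def)
  assume ab: "a < m' + n'" "b < m' + n'" and ne: "a \<notin> I \<or> b \<notin> I"
  have J: "c \<in> I" if "c < m \<or> (m' \<le> c \<and> c - m' < n)" for c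
  proof (cases "c < m")
    case True
    then show ?thesis by (intro image_eqI[of _ _ c]) (auto simp: \<iota>_def)
  next
    case False
    then show ?thesis using that by (intro image_eqI[of _ _ "c - m' + m"]) (auto simp: \<iota>_def)
  qed
  show "incl_mat m m' n' x $$ (a, b) = 0"
    using x ab ne J[of a] J[of b] by (auto simp: incl_mat_def split_block_def Let_def pad_mat_def)
qed

lemma incl_mat_eqI:
  assumes "y \<in> carrier_mat (m' + n') (m' + n')" "z \<in> carrier_mat (m' + n') (m' + n')"
    and "\<And>i j. i < m + n \<Longrightarrow> j < m + n \<Longrightarrow> y $$ (\<iota> i, \<iota> j) = z $$ (\<iota> i, \<iota> j)"
    and "\<And>a b. a < m' + n' \<Longrightarrow> b < m' + n' \<Longrightarrow> a \<notin> I \<or> b \<notin> I \<Longrightarrow> y $$ (a, b) = z $$ (a, b)"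
  shows "y = z"
proof (rule eq_matI)
  fix a b assume "a < dim_row z" "b < dim_col z"
  then have ab: "a < m' + n'" "b < m' + n'" using assms(2) by auto
  show "y $$ (a, b) = z $$ (a, b)"
  proof (cases "a \<in> I \<and> b \<in> I")
    case True
    then show ?thesis using assms(3) by auto
  next
    case False
    then show ?thesis using assms(4) ab by auto
  qed
qed (use assms in auto)

lemma incl_mat_add:
  assumes x: "x \<in> carrier_mat (m + n) (m + n)" and y: "y \<in> carrier_mat (m + n) (m + n)"
  shows "incl_mat m m' n' (x + y) = incl_mat m m' n' x + incl_mat m m' n' y"
proof -
  have xy: "x + y \<in> carrier_mat (m + n) (m + n)" using x y by simp
  note C = incl_mat_carrier[of x] incl_mat_carrier[of y]
  show ?thesis
    by (rule incl_mat_eqI[OF incl_mat_carrier])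
      (use C x y in \<open>auto simp: incl_mat_entry[OF xy] incl_mat_entry[OF x] incl_mat_entry[OF y] \<iota>_less
        simp del: image_iff\<close>)
qed

lemma incl_mat_smult:
  assumes x: "x \<in> carrier_mat (m + n) (m + n)"
  shows "incl_mat m m' n' (c \<cdot>\<^sub>m x) = c \<cdot>\<^sub>m incl_mat m m' n' x"
proof -
  have cx: "c \<cdot>\<^sub>m x \<in> carrier_mat (m + n) (m + n)" using x by simp
  show ?thesis
    by (rule incl_mat_eqI[OF incl_mat_carrier])
      (use incl_mat_carrier[of x] x in \<open>auto simp: incl_mat_entry[OF cx] incl_mat_entry[OF x] \<iota>_less simp del: image_iff\<close>)
qed

lemma incl_mat_supercommutator:
  fixes x y :: "'k :: field mat"
  assumes x: "x \<in> carrier_mat (m + n) (m + n)" and y: "y \<in> carrier_mat (m + n) (m + n)"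
  shows "incl_mat m m' n' (supercommutator m x y) = supercommutator m' (incl_mat m m' n' x) (incl_mat m m' n' y)"
proof (rule incl_mat_eqI[OF incl_mat_carrier supercommutator_carrier[OF incl_mat_carrier incl_mat_carrier]])
  note xy = supercommutator_carrier[OF x y]
  note C = incl_mat_carrier[of x] incl_mat_carrier[of y]
  fix i j assume ij: "i < m + n" "j < m + n"
  let ?f = "\<lambda>r. incl_mat m m' n' x $$ (\<iota> i, r) * incl_mat m m' n' y $$ (r, \<iota> j)
    - ksign (coord_degree m' (\<iota> i) + coord_degree m' r) (coord_degree m' r + coord_degree m' (\<iota> j))
      * incl_mat m m' n' y $$ (\<iota> i, r) * incl_mat m m' n' x $$ (r, \<iota> j)"
  have "supercommutator m' (incl_mat m m' n' x) (incl_mat m m' n' y) $$ (\<iota> i, \<iota> j) = (\<Sum>r<m' + n'. ?f r)"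
    by (rule supercommutator_entry[OF C \<iota>_less[OF ij(1)] \<iota>_less[OF ij(2)]])
  also have "\<dots> = (\<Sum>r<m + n. ?f (\<iota> r))"
  proof (rule sum_\<iota>)
    fix r assume r: "r < m' + n'" "r \<notin> I"
    have "incl_mat m m' n' x $$ (r, \<iota> j) = 0" "incl_mat m m' n' y $$ (r, \<iota> j) = 0"
      using incl_mat_entry(2)[OF x r(1) \<iota>_less[OF ij(2)]] incl_mat_entry(2)[OF y r(1) \<iota>_less[OF ij(2)]] r(2) by auto
    then show "?f r = 0" by simp
  qed
  also have "\<dots> = (\<Sum>r<m + n. x $$ (i, r) * y $$ (r, j)
    - ksign (coord_degree m i + coord_degree m r) (coord_degree m r + coord_degree m j) * y $$ (i, r) * x $$ (r, j))"
    by (intro sum.cong refl) (simp add: incl_mat_entry(1)[OF x] incl_mat_entry(1)[OF y] ij \<iota>_degree del: add_bit_eq_xor)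
  also have "\<dots> = supercommutator m x y $$ (i, j)" by (rule supercommutator_entry[OF x y ij, symmetric])
  also have "\<dots> = incl_mat m m' n' (supercommutator m x y) $$ (\<iota> i, \<iota> j)"
    by (rule incl_mat_entry(1)[OF xy ij, symmetric])
  finally show "incl_mat m m' n' (supercommutator m x y) $$ (\<iota> i, \<iota> j)
    = supercommutator m' (incl_mat m m' n' x) (incl_mat m m' n' y) $$ (\<iota> i, \<iota> j)" by (rule sym)
next
  note xy = supercommutator_carrier[OF x y]
  note C = incl_mat_carrier[of x] incl_mat_carrier[of y]
  fix a b assume ab: "a < m' + n'" "b < m' + n'" and ne: "a \<notin> I \<or> b \<notin> I"
  have "supercommutator m' (incl_mat m m' n' x) (incl_mat m m' n' y) $$ (a, b) = 0"
    unfolding supercommutator_entry[OF C ab]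
  proof (intro sum.neutral ballI)
    fix r assume "r \<in> {..<m' + n'}"
    then have r: "r < m' + n'" by simp
    have "incl_mat m m' n' x $$ (a, r) * incl_mat m m' n' y $$ (r, b) = 0"
      "incl_mat m m' n' y $$ (a, r) * incl_mat m m' n' x $$ (r, b) = 0"
      using ne incl_mat_entry(2)[OF x ab(1) r] incl_mat_entry(2)[OF x r ab(2)]
        incl_mat_entry(2)[OF y ab(1) r] incl_mat_entry(2)[OF y r ab(2)] by auto
    then show "incl_mat m m' n' x $$ (a, r) * incl_mat m m' n' y $$ (r, b)
      - ksign (coord_degree m' a + coord_degree m' r) (coord_degree m' r + coord_degree m' b)
        * incl_mat m m' n' y $$ (a, r) * incl_mat m m' n' x $$ (r, b) = 0"
      by (simp only: mult.assoc mult_zero_right diff_zero)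
  qed
  then show "incl_mat m m' n' (supercommutator m x y) $$ (a, b)
    = supercommutator m' (incl_mat m m' n' x) (incl_mat m m' n' y) $$ (a, b)"
    using incl_mat_entry(2)[OF xy ab ne] by simp
qed

lemma incl_mat_homog:
  assumes x: "x \<in> homog_mat m n p"
  shows "incl_mat m m' n' x \<in> homog_mat m' n' p"
  unfolding homog_mat_def
proof (intro CollectI conjI allI impI incl_mat_carrier)
  note cx = homog_mat_carrier[OF x]
  fix a b assume ab: "a < m' + n'" "b < m' + n'" and ne: "coord_degree m' a + coord_degree m' b \<noteq> p"
  show "incl_mat m m' n' x $$ (a, b) = 0"
  proof (cases "a \<in> I \<and> b \<in> I")
    case True
    then obtain i j where ij: "i < m + n" "j < m + n" "a = \<iota> i" "b = \<iota> j" by auto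
    then have "coord_degree m i + coord_degree m j \<noteq> p" using ne by (simp only: \<iota>_degree not_False_eq_True)
    then show ?thesis using incl_mat_entry(1)[OF cx ij(1,2)] homog_mat_entry[OF x ij(1,2)] ij by simp
  next
    case False
    then show ?thesis using incl_mat_entry(2)[OF cx ab] by blast
  qed
qed

lemma incl_mat_hom:
  assumes S: "S \<subseteq> carrier_mat (m + n) (m + n)" and incl: "\<And>x. x \<in> S \<Longrightarrow> incl_mat m m' n' x \<in> S'"
  shows "incl_mat m m' n' \<in> superalgebra_hom (subsuperalgebra (gl m n) S) (subsuperalgebra (gl m' n') S')"
  unfolding superalgebra_hom_def
proof (intro CollectI conjI ballI allI)
  show "incl_mat m m' n' \<in> linear_maps (subsuperalgebra (gl m n) S) (subsuperalgebra (gl m' n') S')"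
    by (rule linear_mapsI) (use S incl in \<open>auto simp: incl_mat_add incl_mat_smult subset_iff\<close>)
qed (use S incl in \<open>auto simp: incl_mat_supercommutator incl_mat_homog subset_iff\<close>)

lemma incl_mat_supported:
  assumes "x \<in> carrier_mat (m + n) (m + n)"
  shows "supported I (incl_mat m m' n' x)"
  unfolding supported_def using incl_mat_entry(2)[OF assms] incl_mat_carrier[of x] by (metis carrier_matD)

lemma incl_mat_sl:
  assumes "x \<in> sl_set m n"
  shows "incl_mat m m' n' x \<in> sl_set m' n'"
proof -
  have x: "x \<in> carrier_mat (m + n) (m + n)" using assms by (simp add: sl_set_def)
  have "supertrace m' n' (incl_mat m m' n' x)
    = (\<Sum>i<m + n. ksign (coord_degree m' (\<iota> i)) (coord_degree m' (\<iota> i)) * incl_mat m m' n' x $$ (\<iota> i, \<iota> i))"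
    unfolding supertrace_def by (rule sum_\<iota>) (simp add: incl_mat_entry(2)[OF x])
  also have "\<dots> = supertrace m n x" unfolding supertrace_def
    by (intro sum.cong refl) (simp add: incl_mat_entry(1)[OF x] \<iota>_degree)
  finally show ?thesis using assms by (simp add: sl_set_def incl_mat_carrier)
qed

lemma incl_vec_unit: "i < m + n \<Longrightarrow> incl_vec m n m' n' (unit_vec (m + n) i) = unit_vec (m' + n') (\<iota> i)"
  by (rule eq_vecI)
    (use mn in \<open>auto simp: incl_vec_def pad_vec_def vec_first_def vec_last_def append_vec_def Let_def unit_vec_def \<iota>_def\<close>)

lemma unit_incl_compl:
  assumes "a < m' + n'" "a \<notin> I"
  shows "unit_vec (m' + n') a \<in> incl_compl m n m' n'"
proof -
  have 1: "i \<in> I" if "i < m" for i using that by (intro image_eqI[of _ _ i]) (auto simp: \<iota>_def)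
  have 2: "m' + j \<in> I" if "j < n" for j using that by (intro image_eqI[of _ _ "m + j"]) (auto simp: \<iota>_def)
  show ?thesis unfolding incl_compl_def using assms 1 2 mn by (auto simp: unit_vec_def simp del: image_iff)
qed

lemma compatible_gram:
  assumes "compatible_forms m n m' n' b b'"
  shows "i < m + n \<Longrightarrow> j < m + n \<Longrightarrow> gram (m' + n') b' (\<iota> i) (\<iota> j) = gram (m + n) b i j"
    and "p \<in> I \<Longrightarrow> a < m' + n' \<Longrightarrow> a \<notin> I \<Longrightarrow> gram (m' + n') b' p a = 0 \<and> gram (m' + n') b' a p = 0"
proof -
  show "gram (m' + n') b' (\<iota> i) (\<iota> j) = gram (m + n) b i j" if "i < m + n" "j < m + n"
    using assms that unfolding compatible_forms_def gram_def
    by (simp flip: incl_vec_unit)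
  assume "p \<in> I" and a: "a < m' + n'" "a \<notin> I"
  then obtain i where i: "i < m + n" "p = \<iota> i" by blast
  show "gram (m' + n') b' p a = 0 \<and> gram (m' + n') b' a p = 0"
    using assms unit_incl_compl[OF a] unit_vec_carrier[of "m + n" i]
    unfolding compatible_forms_def gram_def i(2) incl_vec_unit[OF i(1), symmetric] by blast
qed

text \<open>Outside the image of the smaller space, the entries of the matrix and the pairings between the
  space and its complement are zero, so no new condition arises.\<close>

lemma incl_mat_form:
  assumes F: "super_form m n g h \<delta> \<zeta>" and F': "super_form m' n' g' h' \<delta> \<zeta>"
    and g: "\<And>i j. i < m + n \<Longrightarrow> j < m + n \<Longrightarrow> g' (\<iota> i) (\<iota> j) = g i j"
    and block: "\<And>p a. p \<in> I \<Longrightarrow> a < m' + n' \<Longrightarrow> a \<notin> I \<Longrightarrow> g' p a = 0 \<and> g' a p = 0"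
    and x: "x \<in> super_form.form_set m n g"
  shows "incl_mat m m' n' x \<in> super_form.form_set m' n' g'"
proof -
  interpret F: super_form m n g h \<delta> \<zeta> by (rule F)
  interpret F': super_form m' n' g' h' \<delta> \<zeta> by (rule F')
  let ?x = "incl_mat m m' n' x"
  have cx: "x \<in> carrier_mat (m + n) (m + n)" by (rule F.form_set_carrier[OF x])
  note e1 = incl_mat_entry(1)[OF cx] and e2 = incl_mat_entry(2)[OF cx]
  have "F'.form_defect ?x u v = 0" if uv: "u < m' + n'" "v < m' + n'" for u v
  proof (cases "u \<in> I \<and> v \<in> I")
    case True
    then obtain i j where ij: "i < m + n" "j < m + n" "u = \<iota> i" "v = \<iota> j" by auto
    have "(\<Sum>r<m' + n'. ?x $$ (r, u) * g' r v) = (\<Sum>r<m + n. ?x $$ (\<iota> r, u) * g' (\<iota> r) v)"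
      by (rule sum_\<iota>) (simp add: e2 uv)
    moreover have "(\<Sum>r<m' + n'. ksign (coord_degree m' r + coord_degree m' v) (coord_degree m' u) * g' u r * ?x $$ (r, v))
      = (\<Sum>r<m + n. ksign (coord_degree m' (\<iota> r) + coord_degree m' v) (coord_degree m' u) * g' u (\<iota> r) * ?x $$ (\<iota> r, v))"
      by (rule sum_\<iota>) (simp add: e2 uv)
    ultimately have "F'.form_defect ?x u v = F.form_defect x i j"
      unfolding F'.form_defect_def F.form_defect_def ij(3,4)
      by (simp add: e1 g ij(1,2) \<iota>_degree del: add_bit_eq_xor)
    then show ?thesis using x ij by (simp add: F.form_set_def)
  next
    case False
    have "?x $$ (r, u) * g' r v = 0" if r: "r < m' + n'" for r
    proof -
      have "?x $$ (r, u) = 0 \<or> g' r v = 0" using e2[OF r uv(1)] block[of r v] uv False by blast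
      then show ?thesis by (simp only: mult_eq_0_iff)
    qed
    moreover have "g' u r * ?x $$ (r, v) = 0" if r: "r < m' + n'" for r
    proof -
      have "g' u r = 0 \<or> ?x $$ (r, v) = 0" using e2[OF r uv(2)] block[of r u] uv False by blast
      then show ?thesis by (simp only: mult_eq_0_iff)
    qed
    ultimately show ?thesis unfolding F'.form_defect_def by (simp add: mult.assoc del: add_bit_eq_xor mult_eq_0_iff)
  qed
  moreover have "?x \<in> sl_set m' n'" by (rule incl_mat_sl) (use x in \<open>simp add: F.form_set_def\<close>)
  ultimately show ?thesis by (simp add: F'.form_set_def)
qed

lemma new_coordinate:
  assumes "m < m' \<or> n < n'"
  obtains w where "w < m' + n'" "w \<notin> I"
proof (cases "m < m'")
  case True
  have "m \<notin> I" using True by (auto simp: \<iota>_def)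
  then show thesis using that[of m] True by simp
next
  case False
  then have "n < n'" using assms by blast
  moreover have "\<iota> x < m' + n" if "x < m + n" for x using that mn unfolding \<iota>_def by (auto split: if_splits)
  then have "m' + n \<notin> I" by (metis imageE lessThan_iff less_irrefl)
  ultimately show thesis using that[of "m' + n"] by simp
qed

end

lemma incl_mat_sq:
  fixes x :: "'k :: field_char_0 mat"
  assumes mm: "m \<le> m'" and x: "x \<in> sq_set m"
  shows "incl_mat m m' m' x \<in> sq_set m'"
proof -
  interpret natural_inclusion m m m' m' by unfold_locales (use mm in auto)
  have cx: "x \<in> carrier_mat (m + m) (m + m)" using x by (simp add: sq_set_def)
  have J: "parity_swap m' (\<iota> i) = \<iota> (parity_swap m i)" if "i < m + m" for i
    using that mm by (auto simp: parity_swap_def \<iota>_def)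
  have JI: "parity_swap m' a \<in> I" if "a \<in> I" for a
    using that J parity_swap_facts(1) by auto
  have JI': "a \<in> I" if "parity_swap m' a \<in> I" "a < m' + m'" for a
    using JI[OF that(1)] parity_swap_facts(2)[OF that(2)] by simp
  note e1 = incl_mat_entry(1)[OF cx] and e2 = incl_mat_entry(2)[OF cx]
  have "incl_mat m m' m' x $$ (parity_swap m' a, parity_swap m' b) = incl_mat m m' m' x $$ (a, b)"
    if ab: "a < m' + m'" "b < m' + m'" for a b
  proof (cases "a \<in> I \<and> b \<in> I")
    case True
    then obtain i j where ij: "i < m + m" "j < m + m" "a = \<iota> i" "b = \<iota> j" by auto
    then show ?thesis using x by (simp add: J e1 parity_swap_facts sq_set_def)
  next
    case False
    then have "parity_swap m' a \<notin> I \<or> parity_swap m' b \<notin> I" using JI' ab by blast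
    then show ?thesis using e2[OF parity_swap_facts(1)[OF ab(1)] parity_swap_facts(1)[OF ab(2)]] e2[OF ab False[unfolded de_Morgan_conj]] by simp
  qed
  moreover have "(\<Sum>p<m' + m'. incl_mat m m' m' x $$ (p, parity_swap m' p))
    = (\<Sum>i<m + m. incl_mat m m' m' x $$ (\<iota> i, parity_swap m' (\<iota> i)))"
    by (rule sum_\<iota>) (simp add: e2 parity_swap_facts)
  then have "(\<Sum>p<m' + m'. incl_mat m m' m' x $$ (p, parity_swap m' p)) = 0"
    using x by (simp add: J e1 parity_swap_facts sq_set_def)
  ultimately show ?thesis by (simp add: sq_set_def incl_mat_carrier)
qed

section \<open>The limits\<close>

text \<open>An equivariant section over the coordinates of the smaller module verifies both hypotheses of
  \<open>limit_centrally_closed\<close>; the functional on \<open>L i\<close> is the one of \<open>cocycle_is_coboundary\<close>, composed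
  with the inclusion.\<close>

theorem natural_limit_centrally_closed:
  fixes S :: "nat \<Rightarrow> 'k :: field_char_0 mat set"
  assumes L: "\<And>i. 2 \<le> i \<Longrightarrow> L i = subsuperalgebra (gl (m i) (n i)) (S i)"
    and S: "\<And>i. 2 \<le> i \<Longrightarrow> matrix_superalgebra (m i) (n i) (S i)"
    and mono: "\<And>i. m i \<le> m (Suc i)" "\<And>i. n i \<le> n (Suc i)"
    and incl: "\<And>i x. 2 \<le> i \<Longrightarrow> x \<in> S i \<Longrightarrow> incl_mat (m i) (m (Suc i)) (n (Suc i)) x \<in> S (Suc i)"
    and sect: "\<And>i. 2 \<le> i \<Longrightarrow> \<exists>w c e lam. equivariant_section (m (Suc i)) (n (Suc i)) (S (Suc i))
      (natural_inclusion.\<iota> (m i) (m (Suc i)) ` {..<m i + n i}) w c e lam"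
  shows "centrally_closed (natural_limit m n L)"
proof -
  let ?f = "\<lambda>i. incl_mat (m i) (m (Suc i)) (n (Suc i)) :: 'k mat \<Rightarrow> 'k mat"
  have N: "natural_inclusion (m i) (n i) (m (Suc i)) (n (Suc i))" for i
    by unfold_locales (rule mono)+
  have Sc: "S i \<subseteq> carrier_mat (m i + n i) (m i + n i)" if "2 \<le> i" for i
    using matrix_superalgebra.S_carrier[OF S[OF that]] by blast
  interpret lie_system 2 L ?f
  proof (rule lie_system.intro)
    fix i :: nat assume i: "2 \<le> i"
    show "lie_superalgebra (L i)" unfolding L[OF i] by (rule matrix_superalgebra.G_lie[OF S[OF i]])
    have i': "2 \<le> Suc i" using i by simp
    show "?f i \<in> superalgebra_hom (L i) (L (Suc i))"
      unfolding L[OF i] L[OF i'] by (rule natural_inclusion.incl_mat_hom[OF N Sc[OF i] incl[OF i]])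
  qed
  show ?thesis
    unfolding natural_limit_def
  proof (rule limit_centrally_closed)
    fix i x assume i: "2 \<le> i" and x: "x \<in> carrier (L i)"
    have i': "2 \<le> Suc i" using i by simp
    obtain w c e lam where "equivariant_section (m (Suc i)) (n (Suc i)) (S (Suc i))
      (natural_inclusion.\<iota> (m i) (m (Suc i)) ` {..<m i + n i}) w c e lam" using sect[OF i] by blast
    then interpret E: equivariant_section "m (Suc i)" "n (Suc i)" "S (Suc i)"
      "natural_inclusion.\<iota> (m i) (m (Suc i)) ` {..<m i + n i}" w c e lam .
    have xS: "x \<in> S i" using x unfolding L[OF i] by simp
    have xc: "x \<in> carrier_mat (m i + n i) (m i + n i)" using Sc[OF i] xS by blast
    show "?f i x \<in> lspan (L (Suc i)) {a \<otimes>\<^bsub>L (Suc i)\<^esub> b | a b. a \<in> carrier (L (Suc i)) \<and> b \<in> carrier (L (Suc i))}"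
      unfolding L[OF i']
      by (rule E.image_in_brackets[OF incl[OF i xS] natural_inclusion.incl_mat_supported[OF N xc]])
  next
    fix i \<phi> assume i: "2 \<le> i" and phi: "super_cocycle (L (Suc i)) \<phi>"
    have i': "2 \<le> Suc i" using i by simp
    obtain w c e lam where "equivariant_section (m (Suc i)) (n (Suc i)) (S (Suc i))
      (natural_inclusion.\<iota> (m i) (m (Suc i)) ` {..<m i + n i}) w c e lam" using sect[OF i] by blast
    then interpret E: equivariant_section "m (Suc i)" "n (Suc i)" "S (Suc i)"
      "natural_inclusion.\<iota> (m i) (m (Suc i)) ` {..<m i + n i}" w c e lam .
    obtain g :: "'k mat \<Rightarrow> 'k" where g:
      "\<And>x y. x \<in> carrier_mat E.dm E.dm \<Longrightarrow> y \<in> carrier_mat E.dm E.dm \<Longrightarrow> g (x + y) = g x + g y"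
      "\<And>r x. x \<in> carrier_mat E.dm E.dm \<Longrightarrow> g (r \<cdot>\<^sub>m x) = r * g x"
      "\<And>y x. y \<in> S (Suc i) \<Longrightarrow> supported (natural_inclusion.\<iota> (m i) (m (Suc i)) ` {..<m i + n i}) y \<Longrightarrow> x \<in> S (Suc i)
        \<Longrightarrow> supported (natural_inclusion.\<iota> (m i) (m (Suc i)) ` {..<m i + n i}) x \<Longrightarrow> \<phi> y x = g (supercommutator (m (Suc i)) y x)"
      using E.cocycle_is_coboundary[OF phi[unfolded L[OF i']]] by blast
    have c: "x \<in> carrier_mat (m i + n i) (m i + n i)" if "x \<in> S i" for x using that Sc[OF i] by blast
    note ic = natural_inclusion.incl_mat_carrier[OF N[of i]] and sup = natural_inclusion.incl_mat_supported[OF N[of i] c]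
    show "\<exists>g. (\<forall>x\<in>carrier (L i). \<forall>y\<in>carrier (L i). g (x \<oplus>\<^bsub>L i\<^esub> y) = g x + g y) \<and>
      (\<forall>c. \<forall>x\<in>carrier (L i). g (c \<odot>\<^bsub>L i\<^esub> x) = c * g x) \<and>
      (\<forall>x\<in>carrier (L i). \<forall>y\<in>carrier (L i). \<phi> (?f i x) (?f i y) = g (x \<otimes>\<^bsub>L i\<^esub> y))"
      unfolding L[OF i] subsuperalgebra_simps gl_simps
    proof (intro exI[of _ "\<lambda>x. g (?f i x)"] conjI ballI allI)
      fix x y assume x: "x \<in> S i" and y: "y \<in> S i"
      show "g (?f i (x + y)) = g (?f i x) + g (?f i y)"
        unfolding natural_inclusion.incl_mat_add[OF N c[OF x] c[OF y]] by (rule g(1)[OF ic ic])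
      show "\<phi> (?f i x) (?f i y) = g (?f i (supercommutator (m i) x y))"
        unfolding natural_inclusion.incl_mat_supercommutator[OF N c[OF x] c[OF y]]
        by (rule g(3)[OF incl[OF i x] sup[OF x] incl[OF i y] sup[OF y]])
    next
      fix r x assume x: "x \<in> S i"
      show "g (?f i (r \<cdot>\<^sub>m x)) = r * g (?f i x)"
        unfolding natural_inclusion.incl_mat_smult[OF N c[OF x]] by (rule g(2)[OF ic])
    qed
  qed
qed

lemma sl_limit_centrally_closed:
  assumes mono: "\<And>i. m i \<le> m (Suc i)" "\<And>i. n i \<le> n (Suc i)" and grow: "\<And>i. m i < m (Suc i) \<or> n i < n (Suc i)"
  shows "centrally_closed (sl_limit m n :: ('k :: field_char_0, _) superalgebra)"
  unfolding sl_limit_def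
proof (rule natural_limit_centrally_closed[where S = "\<lambda>i. sl_set (m i) (n i)"])
  fix i
  interpret natural_inclusion "m i" "n i" "m (Suc i)" "n (Suc i)" by unfold_locales (rule mono)+
  show "incl_mat (m i) (m (Suc i)) (n (Suc i)) x \<in> sl_set (m (Suc i)) (n (Suc i))" if "x \<in> sl_set (m i) (n i)" for x :: "'k mat"
    using that by (rule incl_mat_sl)
  obtain w where "w < m (Suc i) + n (Suc i)" "w \<notin> I" using new_coordinate[OF grow] .
  from sl_section[OF I_less this]
  show "\<exists>w c e lam. equivariant_section (m (Suc i)) (n (Suc i)) (sl_set (m (Suc i)) (n (Suc i)) :: 'k mat set)
      (\<iota> ` {..<m i + n i}) w c e lam" by blast
qed (simp_all add: sl_eq sl_set_superalgebra mono)

lemma form_limit_centrally_closed: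
  fixes b :: "nat \<Rightarrow> 'k :: field_char_0 vec \<Rightarrow> 'k vec \<Rightarrow> 'k"
  assumes mono: "\<And>i. m i \<le> m (Suc i)" "\<And>i. n i \<le> n (Suc i)" and grow: "\<And>i. m i < m (Suc i) \<or> n i < n (Suc i)"
    and bil: "\<And>i. 2 \<le> i \<Longrightarrow> bilinear_form (m i + n i) (b i)"
    and form: "\<And>i. 2 \<le> i \<Longrightarrow> \<exists>h. super_form (m i) (n i) (gram (m i + n i) (b i)) h \<delta> \<zeta>"
    and compat: "\<And>i. 2 \<le> i \<Longrightarrow> compatible_forms (m i) (n i) (m (Suc i)) (n (Suc i)) (b i) (b (Suc i))"
  shows "centrally_closed (natural_limit m n (\<lambda>i. form_superalgebra (m i) (n i) (b i)))"
proof (rule natural_limit_centrally_closed[where S = "\<lambda>i. super_form.form_set (m i) (n i) (gram (m i + n i) (b i))"])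
  fix i :: nat assume i: "2 \<le> i"
  obtain h where "super_form (m i) (n i) (gram (m i + n i) (b i)) h \<delta> \<zeta>" using form[OF i] by blast
  then interpret F: super_form "m i" "n i" "gram (m i + n i) (b i)" h \<delta> \<zeta> .
  show "form_superalgebra (m i) (n i) (b i) = subsuperalgebra (gl (m i) (n i)) F.form_set"
    by (rule F.form_superalgebra_eq[OF bil[OF i] refl])
  show "matrix_superalgebra (m i) (n i) F.form_set" by (rule F.form_set_superalgebra)
  have "2 \<le> Suc i" using i by simp
  then obtain h' where F': "super_form (m (Suc i)) (n (Suc i)) (gram (m (Suc i) + n (Suc i)) (b (Suc i))) h' \<delta> \<zeta>"
    using form by blast
  interpret natural_inclusion "m i" "n i" "m (Suc i)" "n (Suc i)" by unfold_locales (rule mono)+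
  note g = compatible_gram[OF compat[OF i]]
  show "incl_mat (m i) (m (Suc i)) (n (Suc i)) x \<in> super_form.form_set (m (Suc i)) (n (Suc i)) (gram (m (Suc i) + n (Suc i)) (b (Suc i)))"
    if "x \<in> F.form_set" for x
    by (rule incl_mat_form[OF F.super_form_axioms F' g that])
  obtain w where w: "w < m (Suc i) + n (Suc i)" "w \<notin> I" using new_coordinate[OF grow] .
  from super_form.form_section[OF F' I_less w g(2)]
  show "\<exists>w c e lam. equivariant_section (m (Suc i)) (n (Suc i))
      (super_form.form_set (m (Suc i)) (n (Suc i)) (gram (m (Suc i) + n (Suc i)) (b (Suc i)))) (\<iota> ` {..<m i + n i}) w c e lam"
    by blast
qed (rule mono)+

lemma osp_limit_centrally_closed:
  fixes b :: "nat \<Rightarrow> 'k :: field_char_0 vec \<Rightarrow> 'k vec \<Rightarrow> 'k"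
  assumes "\<And>i. m i \<le> m (Suc i)" "\<And>i. n i \<le> n (Suc i)" "\<And>i. m i < m (Suc i) \<or> n i < n (Suc i)"
    and b: "osp_forms m n b"
  shows "centrally_closed (osp_limit m n b)"
  unfolding osp_limit_def
proof (rule form_limit_centrally_closed[where m = m and n = n and b = b and \<delta> = 0 and \<zeta> = 1])
  fix i :: nat assume "2 \<le> i"
  then have f: "osp_form (m i) (n i) (b i)"
    and c: "compatible_forms (m i) (n i) (m (Suc i)) (n (Suc i)) (b i) (b (Suc i))"
    using b unfolding osp_forms_def by blast+
  show "bilinear_form (m i + n i) (b i)" using f unfolding osp_form_def by blast
  show "\<exists>h. super_form (m i) (n i) (gram (m i + n i) (b i)) h 0 1" by (rule osp_super_form[OF f])
  show "compatible_forms (m i) (n i) (m (Suc i)) (n (Suc i)) (b i) (b (Suc i))" by (rule c)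
qed (rule assms)+

lemma SP_limit_centrally_closed:
  fixes b :: "nat \<Rightarrow> 'k :: field_char_0 vec \<Rightarrow> 'k vec \<Rightarrow> 'k"
  assumes b: "SP_forms b"
  shows "centrally_closed (SP_limit b)"
  unfolding SP_limit_def
proof (rule form_limit_centrally_closed[where m = "\<lambda>i. i" and n = "\<lambda>i. i" and b = b and \<delta> = 1 and \<zeta> = "- 1"])
  fix i :: nat assume "2 \<le> i"
  then have f: "SP_form i (b i)" and c: "compatible_forms i i (Suc i) (Suc i) (b i) (b (Suc i))"
    using b unfolding SP_forms_def by blast+
  show "bilinear_form (i + i) (b i)" using f unfolding SP_form_def by blast
  show "\<exists>h. super_form i i (gram (i + i) (b i)) h 1 (- 1)" by (rule SP_super_form[OF f])
  show "compatible_forms i i (Suc i) (Suc i) (b i) (b (Suc i))" by (rule c)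
qed simp_all

lemma sq_limit_centrally_closed: "centrally_closed (sq_limit :: ('k :: field_char_0, _) superalgebra)"
  unfolding sq_limit_def
proof (rule natural_limit_centrally_closed[where S = sq_set])
  fix i :: nat
  interpret natural_inclusion i i "Suc i" "Suc i" by unfold_locales auto
  show "incl_mat i (Suc i) (Suc i) x \<in> sq_set (Suc i)" if "x \<in> sq_set i" for x :: "'k mat"
    using that by (intro incl_mat_sq) auto
  obtain w where w: "w < Suc i + Suc i" "w \<notin> I" using new_coordinate by auto
  have "parity_swap (Suc i) p \<in> I" if p: "p \<in> I" for p
  proof -
    obtain j where j: "j < i + i" "p = \<iota> j" using p by auto
    have "parity_swap (Suc i) (\<iota> j) = \<iota> (parity_swap i j)" using j by (auto simp: parity_swap_def \<iota>_def)
    then show ?thesis using parity_swap_facts(1)[OF j(1)] j(2) by auto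
  qed
  from sq_section[OF I_less w this]
  show "\<exists>w c e lam. equivariant_section (Suc i) (Suc i) (sq_set (Suc i) :: 'k mat set) (\<iota> ` {..<i + i}) w c e lam"
    by blast
qed (simp_all add: sq_eq sq_set_superalgebra)

theorem corollary2p8:
  fixes k :: "'k :: {alg_closed_field, field_char_0} itself"
  shows
    "(\<forall>n. centrally_closed (sl_limit (\<lambda>i. i) (\<lambda>i. n) :: ('k, _) superalgebra)) \<and>
     centrally_closed (sl_limit (\<lambda>i. i) (\<lambda>i. i) :: ('k, _) superalgebra) \<and>
     (\<forall>s. \<forall>b :: nat \<Rightarrow> 'k vec \<Rightarrow> 'k vec \<Rightarrow> 'k. osp_forms (\<lambda>i. 2 * i + 1) (\<lambda>i. 2 * s) b \<longrightarrow>
        centrally_closed (osp_limit (\<lambda>i. 2 * i + 1) (\<lambda>i. 2 * s) b)) \<and>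
     (\<forall>b :: nat \<Rightarrow> 'k vec \<Rightarrow> 'k vec \<Rightarrow> 'k. osp_forms (\<lambda>i. 2 * i + 1) (\<lambda>i. 2 * i) b \<longrightarrow>
        centrally_closed (osp_limit (\<lambda>i. 2 * i + 1) (\<lambda>i. 2 * i) b)) \<and>
     (\<forall>r. \<forall>b :: nat \<Rightarrow> 'k vec \<Rightarrow> 'k vec \<Rightarrow> 'k. osp_forms (\<lambda>i. 2 * r + 1) (\<lambda>i. 2 * i) b \<longrightarrow>
        centrally_closed (osp_limit (\<lambda>i. 2 * r + 1) (\<lambda>i. 2 * i) b)) \<and>
     (\<forall>b :: nat \<Rightarrow> 'k vec \<Rightarrow> 'k vec \<Rightarrow> 'k. osp_forms (\<lambda>i. 2) (\<lambda>i. 2 * i) b \<longrightarrow>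
        centrally_closed (osp_limit (\<lambda>i. 2) (\<lambda>i. 2 * i) b)) \<and>
     (\<forall>s. \<forall>b :: nat \<Rightarrow> 'k vec \<Rightarrow> 'k vec \<Rightarrow> 'k. osp_forms (\<lambda>i. 2 * i) (\<lambda>i. 2 * s) b \<longrightarrow>
        centrally_closed (osp_limit (\<lambda>i. 2 * i) (\<lambda>i. 2 * s) b)) \<and>
     (\<forall>b :: nat \<Rightarrow> 'k vec \<Rightarrow> 'k vec \<Rightarrow> 'k. osp_forms (\<lambda>i. 2 * i) (\<lambda>i. 2 * i) b \<longrightarrow>
        centrally_closed (osp_limit (\<lambda>i. 2 * i) (\<lambda>i. 2 * i) b)) \<and>
     (\<forall>m\<ge>2. \<forall>b :: nat \<Rightarrow> 'k vec \<Rightarrow> 'k vec \<Rightarrow> 'k. osp_forms (\<lambda>i. 2 * m) (\<lambda>i. 2 * i) b \<longrightarrow>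
        centrally_closed (osp_limit (\<lambda>i. 2 * m) (\<lambda>i. 2 * i) b)) \<and>
     (\<forall>b :: nat \<Rightarrow> 'k vec \<Rightarrow> 'k vec \<Rightarrow> 'k. SP_forms b \<longrightarrow> centrally_closed (SP_limit b)) \<and>
     centrally_closed (sq_limit :: ('k, _) superalgebra)"
  by (intro conjI allI impI sl_limit_centrally_closed osp_limit_centrally_closed SP_limit_centrally_closed
      sq_limit_centrally_closed) simp_all

end
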